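(* Let $s,t\in\mathbb N_0$. For any $f\in N_S$ (that is, $f\in D_S\subset L^2_{(s,t+1)}(\ell^2,P_r)$ with $Sf=0$), there exists $u\in L^2_{(s,t)}(\ell^2,P_r)$ such that $u\in D_T$, $Tu=f$ and $$\|u\|_{L^2_{(s,t)}(\ell^2,P_r)}\le\sqrt{\frac{2r^2}{t+1}}\;\|f\|_{L^2_{(s,t+1)}(\ell^2,P_r)} .$$
   Context: Fix $r>0$ and positive numbers $(a_i)_{i\ge1}$ with $\sum_ia_i<\infty$. Here $\ell^2$ is the space of complex sequences $\mathbf z=(z_i)_{i\in\mathbb N}$, $z_i=x_i+\sqrt{-1}y_i$, with $\sum|z_i|^2<\infty$. $P_r$ is the Borel probability measure on $\ell^2$ obtained by restricting to $\ell^2$ the product measure $\prod_i(\mathcal N_{ra_i}\times\mathcal N_{ra_i})$ on $\mathbb C^{\mathbb N}$ (real and imaginary parts), where $\mathcal N_a(dx)=\frac1{\sqrt{2\pi a^2}}e^{-x^2/(2a^2)}dx$. $\mathscr C_c^\infty$ is the union over $n$ of the complex-valued $C_c^\infty$ functions on $\mathbb C^n$, viewed as cylinder functions on $\ell^2$ of $(z_1,\dots,z_n)$. $\partial_i=\frac12(D_{x_i}-\sqrt{-1}D_{y_i})$ and $\delta_i\varphi=\partial_i\varphi-\frac{\overline{z_i}}{2r^2a_i^2}\varphi$. For strictly increasing multi-indices $I=(i_1,\dots,i_s)$, $J=(j_1,\dots,j_t)$ put $\mathbf a^{I,J}=\prod_la_{i_l}^2\prod_la_{j_l}^2$. An $(s,t)$-form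 is a formal sum $f=\sum'_{|I|=s}\sum'_{|J|=t}f_{I,J}\,dz_I\wedge d\overline{z_J}$ over strictly increasing multi-indices, i.e. a family of coefficient functions on $\ell^2$. $L^2_{(s,t)}(\ell^2,P_r)$ is the Hilbert space of such forms with $f_{I,J}\in L^2(\ell^2,P_r)$ and $\|f\|^2=\sum'_{I,J}\mathbf a^{I,J}\int|f_{I,J}|^2dP_r<\infty$. For $j\in\mathbb N$ and strictly increasing $J,K$ with $|J|=t,|K|=t+1$: $\varepsilon^K_{j,J}=0$ unless $K=J\cup\{j\}$ as sets, in which case it is the sign of the permutation taking $(j,j_1,\dots,j_t)$ to $K$. $f\in L^2_{(s,t)}(\ell^2,P_r)$ is in $D_{\overline\partial}$ if for all $I,K$ ($|I|=s,|K|=t+1$) there is $g_{I,K}\in L^2(\ell^2,P_r)$ with $\int g_{I,K}\overline\varphi\,dP_r=-\int\sum_{i\ge1}\sum'_{|J|=t}\varepsilon^K_{i,J}f_{I,J}\,\overline{\delta_i\varphi}\,dP_r$ for all $\varphi\in\mathscr C_c^\infty$, and $\sum'_{I,K}\mathbf a^{I,K}\int|g_{I,K}|^2dP_r<\infty$; then $\overline\partial f=(-1)^s\sum'_{I,K}g_{I,K}\,dz_I\wedge d\overline{z_K}$. $T$ is $\overline\partial$ as an operator $L^2_{(s,t)}\to L^2_{(s,t+1)}$ with domain $D_T$, and $S$ is $\overline\partial$ as an operator $L^2_{(s,t+1)}\to L^2_{(s,t+2)}$ with domain $D_S$. *)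

theory Defs
  imports "HOL-Probability.Probability" "HOL-Combinatorics.Permutations"
begin

text \<open>
  Coordinates are indexed by \<^typ>\<open>nat\<close>, starting at 0. Functions on \<open>\<ell>\<^sup>2\<close> are represented by
  functions on all complex sequences, of which only the values on \<open>\<ell>\<^sup>2\<close> matter.
\<close>

type_synonym cseq = "nat \<Rightarrow> complex"

definition ell2 :: "cseq set" where
  "ell2 = {z. summable (\<lambda>i. (cmod (z i))\<^sup>2)}"

definition ell2_norm :: "cseq \<Rightarrow> real" where
  "ell2_norm z = sqrt (\<Sum>i. (cmod (z i))\<^sup>2)"

definition complex_gauss :: "real \<Rightarrow> complex measure" where
  "complex_gauss \<sigma> =
     distr (density lborel (\<lambda>x. ennreal (normal_density 0 \<sigma> x))
            \<Otimes>\<^sub>M density lborel (\<lambda>y. ennreal (normal_density 0 \<sigma> y)))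
       borel (\<lambda>(x, y). Complex x y)"

definition P :: "real \<Rightarrow> (nat \<Rightarrow> real) \<Rightarrow> cseq measure" where
  "P r a = restrict_space (\<Pi>\<^sub>M i\<in>UNIV. complex_gauss (r * a i)) ell2"

definition L2 :: "real \<Rightarrow> (nat \<Rightarrow> real) \<Rightarrow> (cseq \<Rightarrow> complex) set" where
  "L2 r a = {h \<in> borel_measurable (P r a). integrable (P r a) (\<lambda>z. (cmod (h z))\<^sup>2)}"


text \<open>The \<open>\<sigma>\<close>-algebra of \<^term>\<open>P r a\<close> is the Borel \<open>\<sigma>\<close>-algebra of the norm topology of \<open>\<ell>\<^sup>2\<close>.\<close>

definition ell2_open :: "cseq set \<Rightarrow> bool" where
  "ell2_open U \<longleftrightarrow> U \<subseteq> ell2 \<and>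
     (\<forall>z\<in>U. \<exists>e>0. \<forall>w\<in>ell2. ell2_norm (\<lambda>i. z i - w i) < e \<longrightarrow> w \<in> U)"

lemma cmod_diff_sq_le:
  fixes x y v :: complex
  shows "(cmod (x - y))\<^sup>2 \<le> 2 * (cmod (x - v))\<^sup>2 + 2 * (cmod (v - y))\<^sup>2"
proof -
  have "cmod (x - y) \<le> cmod (x - v) + cmod (v - y)"
    using norm_triangle_ineq[of "x - v" "v - y"] by simp
  hence "(cmod (x - y))\<^sup>2 \<le> (cmod (x - v) + cmod (v - y))\<^sup>2"
    by (intro power_mono) auto
  also have "\<dots> \<le> 2 * (cmod (x - v))\<^sup>2 + 2 * (cmod (v - y))\<^sup>2"
    using sum_squares_bound[of "cmod (x - v)" "cmod (v - y)"]
    by (simp add: power2_sum)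
  finally show ?thesis .
qed

lemma ell2_diff:
  assumes "z \<in> ell2" "w \<in> ell2"
  shows "summable (\<lambda>i. (cmod (z i - w i))\<^sup>2)"
proof (rule summable_comparison_test')
  show "summable (\<lambda>i. 2 * (cmod (z i))\<^sup>2 + 2 * (cmod (w i))\<^sup>2)"
    using assms unfolding ell2_def by (intro summable_add summable_mult) auto
  show "norm ((cmod (z n - w n))\<^sup>2) \<le> 2 * (cmod (z n))\<^sup>2 + 2 * (cmod (w n))\<^sup>2" if "n \<ge> 0" for n
    using cmod_diff_sq_le[of "z n" "w n" 0] by simp
qed

lemma ell2_dist_sq_le:
  assumes "z \<in> ell2" "w \<in> ell2" "v \<in> ell2"
  shows "(\<Sum>i. (cmod (z i - w i))\<^sup>2)
       \<le> 2 * (\<Sum>i. (cmod (z i - v i))\<^sup>2) + 2 * (\<Sum>i. (cmod (v i - w i))\<^sup>2)"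
proof -
  have "(\<Sum>i. (cmod (z i - w i))\<^sup>2)
      \<le> (\<Sum>i. 2 * (cmod (z i - v i))\<^sup>2 + 2 * (cmod (v i - w i))\<^sup>2)"
    using assms
    by (intro suminf_le summable_add summable_mult ell2_diff cmod_diff_sq_le) auto
  also have "\<dots> = (\<Sum>i. 2 * (cmod (z i - v i))\<^sup>2) + (\<Sum>i. 2 * (cmod (v i - w i))\<^sup>2)"
    using assms by (intro suminf_add[symmetric] summable_mult ell2_diff) auto
  also have "\<dots> = 2 * (\<Sum>i. (cmod (z i - v i))\<^sup>2) + 2 * (\<Sum>i. (cmod (v i - w i))\<^sup>2)"
    using assms by (subst (1 2) suminf_mult) (auto intro: ell2_diff)
  finally show ?thesis .
qed

lemma ell2_countable_dense:
  obtains D where "countable D" "D \<subseteq> ell2"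
    "\<And>z e. z \<in> ell2 \<Longrightarrow> e > 0 \<Longrightarrow> \<exists>q\<in>D. (\<Sum>i. (cmod (z i - q i))\<^sup>2) < e"
proof -
  obtain C :: "complex set" where C: "countable C"
    "\<And>X. open X \<Longrightarrow> X \<noteq> {} \<Longrightarrow> \<exists>d\<in>C. d \<in> X"
    by (erule countable_dense_setE)
  define emb where "emb = (\<lambda>(xs::complex list) i. if i < length xs then xs ! i else 0)"
  define D where "D = emb ` lists C"
  have emb_ell2: "emb xs \<in> ell2" for xs
    unfolding ell2_def emb_def
    by (auto intro!: summable_finite[of "{..<length xs}"] split: if_splits)
  have dense: "\<exists>q\<in>D. (\<Sum>i. (cmod (z i - q i))\<^sup>2) < e" if z: "z \<in> ell2" and e: "e > 0" for z e
  proof -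
    have sz: "summable (\<lambda>i. (cmod (z i))\<^sup>2)" using z by (simp add: ell2_def)
    obtain N where N: "norm (\<Sum>i. (cmod (z (i + N)))\<^sup>2) < e / 2"
      using suminf_exist_split[OF _ sz, of "e / 2"] e by auto
    define \<eta> where "\<eta> = sqrt (e / (2 * (real N + 1)))"
    have \<eta>: "\<eta> > 0" using e by (simp add: \<eta>_def)
    have "\<exists>c\<in>C. cmod (z i - c) < \<eta>" for i
      using C(2)[of "ball (z i) \<eta>"] \<eta> by (auto simp: dist_norm)
    then obtain c where c: "\<And>i. c i \<in> C" "\<And>i. cmod (z i - c i) < \<eta>" by metis
    define q where "q = emb (map c [0..<N])"
    have q: "q i = (if i < N then c i else 0)" for i by (simp add: q_def emb_def)
    have "q \<in> D" unfolding q_def D_def by (rule imageI) (use c(1) in auto)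
    have sq: "summable (\<lambda>i. (cmod (z i - q i))\<^sup>2)"
      using ell2_diff[OF z emb_ell2[of "map c [0..<N]"]] by (simp add: q_def)
    have "(\<Sum>i. (cmod (z i - q i))\<^sup>2)
        = (\<Sum>i. (cmod (z (i + N)))\<^sup>2) + (\<Sum>i<N. (cmod (z i - c i))\<^sup>2)"
      by (subst suminf_split_initial_segment[OF sq, of N]) (simp add: q)
    also have "(\<Sum>i<N. (cmod (z i - c i))\<^sup>2) \<le> (\<Sum>i<N. \<eta>\<^sup>2)"
      using c(2) \<eta> by (intro sum_mono power_mono) (auto intro: less_imp_le)
    also have "\<dots> = real N * (e / (2 * (real N + 1)))"
      using e by (simp add: \<eta>_def)
    also have "\<dots> \<le> e / 2" using e by (simp add: field_simps)
    finally have "(\<Sum>i. (cmod (z i - q i))\<^sup>2) < e" using N by simp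
    with \<open>q \<in> D\<close> show ?thesis by blast
  qed
  show ?thesis
    by (rule that[of D]) (use dense emb_ell2 C(1) in \<open>auto simp: D_def\<close>)
qed

lemma sets_P: "sets (P r a) = sigma_sets ell2 (Collect ell2_open)"
proof -
  let ?B = "\<Pi>\<^sub>M i\<in>(UNIV :: nat set). (borel :: complex measure)"
  let ?S = "sigma ell2 (Collect ell2_open)"
  have setsB: "sets (\<Pi>\<^sub>M i\<in>UNIV. complex_gauss (r * a i)) = sets ?B"
    by (intro sets_PiM_cong) (simp_all add: complex_gauss_def)
  have sub: "Collect ell2_open \<subseteq> Pow ell2" by (auto simp: ell2_open_def)
  have setsS: "sets ?S = sigma_sets ell2 (Collect ell2_open)" "space ?S = ell2"
    using sub by auto
  have P_B: "sets (P r a) = sets (restrict_space ?B ell2)"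
    unfolding P_def by (simp add: sets_restrict_space setsB)
  have [measurable]: "(\<lambda>z. z) \<in> measurable ?S ?B"
  proof (rule measurable_PiM_single')
    fix i :: nat
    show "(\<lambda>z. z i) \<in> borel_measurable ?S"
    proof (rule borel_measurableI)
      fix V :: "complex set" assume V: "open V"
      have "ell2_open ((\<lambda>z. z i) -` V \<inter> ell2)"
        unfolding ell2_open_def
      proof (intro conjI ballI)
        fix z assume z: "z \<in> (\<lambda>z. z i) -` V \<inter> ell2"
        then obtain e where e: "e > 0" "\<And>w. dist w (z i) < e \<Longrightarrow> w \<in> V"
          using V unfolding open_dist by blast
        have "w i \<in> V" if w: "w \<in> ell2" "ell2_norm (\<lambda>i. z i - w i) < e" for w
        proof -
          have "(cmod (z i - w i))\<^sup>2 \<le> (\<Sum>i. (cmod (z i - w i))\<^sup>2)"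
            using sum_le_suminf[OF ell2_diff[of z w], of "{i}"] z w by auto
          hence "cmod (z i - w i) \<le> ell2_norm (\<lambda>i. z i - w i)"
            unfolding ell2_norm_def using real_le_rsqrt by blast
          thus ?thesis using w e(2)[of "w i"] by (simp add: dist_norm norm_minus_commute)
        qed
        thus "\<exists>e>0. \<forall>w\<in>ell2. ell2_norm (\<lambda>i. z i - w i) < e \<longrightarrow> w \<in> (\<lambda>z. z i) -` V \<inter> ell2"
          using e(1) by auto
      qed auto
      thus "(\<lambda>z. z i) -` V \<inter> space ?S \<in> sets ?S"
        using setsS by (auto intro: sigma_sets.Basic)
    qed
  qed (auto simp: space_PiM)
  have "sets (restrict_space ?B ell2) \<subseteq> sets ?S"
  proof
    fix A assume "A \<in> sets (restrict_space ?B ell2)"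
    then obtain A' where A': "A' \<in> sets ?B" "A = ell2 \<inter> A'"
      by (auto simp: sets_restrict_space)
    have "(\<lambda>z. z) -` A' \<inter> space ?S \<in> sets ?S"
      by (rule measurable_sets[OF _ A'(1)]) measurable
    thus "A \<in> sets ?S" using A'(2) setsS(2) by (simp add: Int_commute)
  qed
  moreover have "sigma_sets ell2 (Collect ell2_open) \<subseteq> sets (restrict_space ?B ell2)"
  proof -
    have "U \<in> sets (restrict_space ?B ell2)" if U: "ell2_open U" for U
    proof -
      obtain D where D: "countable D" "D \<subseteq> ell2"
        "\<And>z e. z \<in> ell2 \<Longrightarrow> e > 0 \<Longrightarrow> \<exists>q\<in>D. (\<Sum>i. (cmod (z i - q i))\<^sup>2) < e"
        using ell2_countable_dense by blast
      define cb where "cb = (\<lambda>(q::cseq, n::nat).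
        {w \<in> space (restrict_space ?B ell2). (\<Sum>i. (cmod (q i - w i))\<^sup>2) < 1 / real (Suc n)})"
      have sp: "space (restrict_space ?B ell2) = ell2"
        by (simp add: space_restrict_space space_PiM)
      have coord: "(\<lambda>w. w i) \<in> borel_measurable (restrict_space ?B ell2)" for i
        by (intro measurable_restrict_space1 measurable_component_singleton) auto
      have cb: "cb x \<in> sets (restrict_space ?B ell2)" for x
      proof -
        have "(\<lambda>w. \<Sum>i. (cmod (q i - w i))\<^sup>2) \<in> borel_measurable (restrict_space ?B ell2)"
          for q :: cseq
          using coord
          by (intro borel_measurable_suminf borel_measurable_power borel_measurable_norm
                borel_measurable_diff) auto
        thus ?thesis unfolding cb_def
          by (cases x) (auto intro!: borel_measurable_less)
      qed
      have "U = (\<Union>x\<in>{x \<in> D \<times> UNIV. cb x \<subseteq> U}. cb x)"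
      proof (rule equalityI)
        show "U \<subseteq> (\<Union>x\<in>{x \<in> D \<times> UNIV. cb x \<subseteq> U}. cb x)"
        proof
          fix z assume z: "z \<in> U"
          hence zl: "z \<in> ell2" using U by (auto simp: ell2_open_def)
          obtain e where e: "e > 0"
            "\<And>w. w \<in> ell2 \<Longrightarrow> ell2_norm (\<lambda>i. z i - w i) < e \<Longrightarrow> w \<in> U"
            using U z unfolding ell2_open_def by blast
          obtain n where n: "1 / real (Suc n) < e\<^sup>2 / 4"
            using nat_approx_posE[of "e\<^sup>2 / 4"] e(1) by auto
          obtain q where q: "q \<in> D" "(\<Sum>i. (cmod (z i - q i))\<^sup>2) < 1 / real (Suc n)"
            using D(3)[OF zl, of "1 / real (Suc n)"] by auto
          have ql: "q \<in> ell2" using q(1) D(2) by auto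
          have "cb (q, n) \<subseteq> U"
          proof
            fix w assume w: "w \<in> cb (q, n)"
            hence wl: "w \<in> ell2" and "(\<Sum>i. (cmod (q i - w i))\<^sup>2) < 1 / real (Suc n)"
              by (auto simp: cb_def sp)
            hence "(\<Sum>i. (cmod (z i - w i))\<^sup>2) < e\<^sup>2"
              using ell2_dist_sq_le[OF zl wl ql] q(2) n by linarith
            hence "ell2_norm (\<lambda>i. z i - w i) < e"
              unfolding ell2_norm_def using e(1) by (intro real_less_lsqrt) auto
            thus "w \<in> U" using e(2) wl by blast
          qed
          moreover have "z \<in> cb (q, n)"
            using q(2) zl by (simp add: cb_def sp norm_minus_commute)
          ultimately show "z \<in> (\<Union>x\<in>{x \<in> D \<times> UNIV. cb x \<subseteq> U}. cb x)"
            using q(1) by blast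
        qed
      qed auto
      moreover have "countable {x \<in> D \<times> (UNIV :: nat set). cb x \<subseteq> U}"
        using D(1) by (auto intro: countable_subset[of _ "D \<times> UNIV"])
      ultimately show ?thesis using cb
        by (metis (no_types, lifting) sets.countable_UN'' )
    qed
    moreover have "space (restrict_space ?B ell2) = ell2"
      by (simp add: space_restrict_space space_PiM)
    ultimately show ?thesis
      using sets.sigma_sets_subset[of "Collect ell2_open" "restrict_space ?B ell2"] by auto
  qed
  ultimately show ?thesis using P_B setsS(1) by auto
qed


text \<open>
  A function on \<open>\<complex>\<^sup>n\<close> is represented by a function of the whole sequence that
  depends on the first \<open>n\<close> coordinates only; for such functions, continuity for the product
  topology on sequences is continuity on \<open>\<complex>\<^sup>n\<close>.
\<close>

definition D_x :: "nat \<Rightarrow> (cseq \<Rightarrow> complex) \<Rightarrow> cseq \<Rightarrow> complex" where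
  "D_x i \<phi> z = vector_derivative (\<lambda>h::real. \<phi> (z(i := z i + of_real h))) (at 0)"

definition D_y :: "nat \<Rightarrow> (cseq \<Rightarrow> complex) \<Rightarrow> cseq \<Rightarrow> complex" where
  "D_y i \<phi> z = vector_derivative (\<lambda>h::real. \<phi> (z(i := z i + \<i> * of_real h))) (at 0)"

primrec C_k :: "nat \<Rightarrow> (cseq \<Rightarrow> complex) \<Rightarrow> bool" where
  "C_k 0 \<phi> \<longleftrightarrow> continuous_on UNIV \<phi>"
| "C_k (Suc k) \<phi> \<longleftrightarrow> continuous_on UNIV \<phi> \<and>
     (\<forall>i z. (\<lambda>h::real. \<phi> (z(i := z i + of_real h))) differentiable (at 0) \<and>
            (\<lambda>h::real. \<phi> (z(i := z i + \<i> * of_real h))) differentiable (at 0)) \<and>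
     (\<forall>i. C_k k (D_x i \<phi>) \<and> C_k k (D_y i \<phi>))"

text \<open>The last conjunct says that the support, as a subset of \<open>\<complex>\<^sup>n\<close>, is bounded.\<close>

definition Cc_infty :: "(cseq \<Rightarrow> complex) set" where
  "Cc_infty = {\<phi>. \<exists>n\<ge>1.
      (\<forall>z w. (\<forall>i<n. z i = w i) \<longrightarrow> \<phi> z = \<phi> w) \<and>
      (\<forall>k. C_k k \<phi>) \<and>
      (\<exists>R. \<forall>z. \<phi> z \<noteq> 0 \<longrightarrow> (\<forall>i<n. cmod (z i) \<le> R))}"

definition del :: "nat \<Rightarrow> (cseq \<Rightarrow> complex) \<Rightarrow> cseq \<Rightarrow> complex" where
  "del i \<phi> z = (D_x i \<phi> z - \<i> * D_y i \<phi> z) / 2"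

definition delta :: "real \<Rightarrow> (nat \<Rightarrow> real) \<Rightarrow> nat \<Rightarrow> (cseq \<Rightarrow> complex) \<Rightarrow> cseq \<Rightarrow> complex" where
  "delta r a i \<phi> z = del i \<phi> z - cnj (z i) / of_real (2 * r\<^sup>2 * (a i)\<^sup>2) * \<phi> z"


definition MI :: "nat \<Rightarrow> nat list set" where
  "MI s = {I. length I = s \<and> sorted_wrt (<) I}"

definition weight :: "(nat \<Rightarrow> real) \<Rightarrow> nat list \<Rightarrow> nat list \<Rightarrow> real" where
  "weight a I J = (\<Prod>i\<leftarrow>I. (a i)\<^sup>2) * (\<Prod>j\<leftarrow>J. (a j)\<^sup>2)"

text \<open>
  Only used for \<open>J \<in> MI t\<close> and \<open>K \<in> MI (t + 1)\<close>; then \<open>set K = insert j (set J)\<close> forces \<open>j \<notin> set J\<close>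
  and the permutation is unique.
\<close>

definition eps :: "nat list \<Rightarrow> nat \<Rightarrow> nat list \<Rightarrow> int" where
  "eps K j J =
     (if set K = insert j (set J)
      then sign (THE p. p permutes set K \<and> map p (j # J) = K) else 0)"


text \<open>
  A form is its family of coefficient functions; those at indices outside \<open>MI s \<times> MI t\<close> are
  irrelevant, and forms are identified when their coefficients agree almost everywhere.
\<close>

type_synonym form = "nat list \<Rightarrow> nat list \<Rightarrow> cseq \<Rightarrow> complex"

definition L2_form :: "real \<Rightarrow> (nat \<Rightarrow> real) \<Rightarrow> nat \<Rightarrow> nat \<Rightarrow> form set" where
  "L2_form r a s t = {f.
     (\<forall>I\<in>MI s. \<forall>J\<in>MI t. f I J \<in> L2 r a) \<and>
     (\<lambda>(I, J). weight a I J * (\<integral>z. (cmod (f I J z))\<^sup>2 \<partial>P r a)) summable_on (MI s \<times> MI t)}"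

definition form_norm :: "real \<Rightarrow> (nat \<Rightarrow> real) \<Rightarrow> nat \<Rightarrow> nat \<Rightarrow> form \<Rightarrow> real" where
  "form_norm r a s t f =
     sqrt (\<Sum>\<^sub>\<infinity>(I, J)\<in>MI s \<times> MI t. weight a I J * (\<integral>z. (cmod (f I J z))\<^sup>2 \<partial>P r a))"

definition form_eq :: "real \<Rightarrow> (nat \<Rightarrow> real) \<Rightarrow> nat \<Rightarrow> nat \<Rightarrow> form \<Rightarrow> form \<Rightarrow> bool" where
  "form_eq r a s t f g \<longleftrightarrow> (\<forall>I\<in>MI s. \<forall>J\<in>MI t. AE z in P r a. f I J z = g I J z)"


text \<open>\<open>g\<close> is the family of coefficients in the definition of \<open>f \<in> D\<close>, before the factor \<open>(-1)\<^sup>s\<close>.\<close>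

definition weak_dbar_coeffs :: "real \<Rightarrow> (nat \<Rightarrow> real) \<Rightarrow> nat \<Rightarrow> nat \<Rightarrow> form \<Rightarrow> form \<Rightarrow> bool" where
  "weak_dbar_coeffs r a s t f g \<longleftrightarrow>
     g \<in> L2_form r a s (t + 1) \<and>
     (\<forall>I\<in>MI s. \<forall>K\<in>MI (t + 1). \<forall>\<phi>\<in>Cc_infty.
        (\<integral>z. g I K z * cnj (\<phi> z) \<partial>P r a) =
        - (\<integral>z. (\<Sum>\<^sub>\<infinity>i. \<Sum>\<^sub>\<infinity>J\<in>MI t.
                  of_int (eps K i J) * f I J z * cnj (delta r a i \<phi> z)) \<partial>P r a))"

definition dbar_dom :: "real \<Rightarrow> (nat \<Rightarrow> real) \<Rightarrow> nat \<Rightarrow> nat \<Rightarrow> form set" where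
  "dbar_dom r a s t = {f \<in> L2_form r a s t. \<exists>g. weak_dbar_coeffs r a s t f g}"

text \<open>The coefficients are determined up to null sets, so the choice is one of representatives.\<close>

definition dbar :: "real \<Rightarrow> (nat \<Rightarrow> real) \<Rightarrow> nat \<Rightarrow> nat \<Rightarrow> form \<Rightarrow> form" where
  "dbar r a s t f = (\<lambda>I K z. (-1) ^ s * (SOME g. weak_dbar_coeffs r a s t f g) I K z)"

definition dbar_ker :: "real \<Rightarrow> (nat \<Rightarrow> real) \<Rightarrow> nat \<Rightarrow> nat \<Rightarrow> form set" where
  "dbar_ker r a s t =
     {f \<in> dbar_dom r a s t. form_eq r a s (t + 1) (dbar r a s t f) (\<lambda>I K z. 0)}"

end

theory Submission
  imports Defs "HOL-Real_Asymp.Real_Asymp"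
begin

text \<open>
  In the orthogonal basis of complex Hermite polynomials, which are products of the polynomials
  \<open>R\<^sup>n z\<^sup>m\<close> with the raising operator \<open>R = c \<cdot> cnj z - \<partial>\<close>, each \<open>\<partial>\<close>-bar derivative lowers the
  antiholomorphic degree by one. Hence the operators \<open>T\<close> and \<open>S\<close> split into finite-dimensional
  Koszul complexes, one for every value of \<open>\<gamma> = B + mset J\<close>, where \<open>B\<close> is the antiholomorphic
  degree and \<open>J\<close> the index of the form. On such a block \<open>T T* + S* S\<close> is the scalar
  \<open>size \<gamma> / (2 r\<^sup>2)\<close>, because the weight \<open>a\<^sub>i\<^sup>2\<close> of \<open>d cnj z\<^sub>i\<close> cancels the variance in the
  commutation relation; and \<open>size \<gamma> \<ge> t + 1\<close> on forms of degree \<open>t + 1\<close>. So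
  \<open>u = 2 r\<^sup>2 / size \<gamma> \<cdot> T* f\<close> on each block solves \<open>T u = f\<close> with the asserted bound. Cutoff functions
  carry the weak equations from test functions to polynomials, and Parseval's identity carries them back.
\<close>

subsection \<open>Square-integrable functions\<close>

text \<open>The blocks replace the functional analysis of unbounded operators: adjoints with their
  domains and closed ranges never appear, only families of numbers \<open>F K B\<close>, and
  \<open>u\<close> is recovered from its coefficients by the Riesz-Fischer theorem. The adjoint
  survives as a formula. When \<open>T\<close> is applied to it, the off-diagonal terms are those of
  \<open>S* S\<close> with the opposite sign, and these are known because \<open>S f = 0\<close>.
  The norm then costs nothing more: on a block with eigenvalue \<lambda>, <u,u> = <T* f,u>/\<lambda>
  = <f,Tu>/\<lambda> = <f,f>/\<lambda>. Two mismatches shape the rest. The hypothesis is tested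
  against compactly supported functions, the coefficients against polynomials, and the conclusion
  has to return to the former. And the measure lives on \<open>ell2\<close>, whereas Fubini's
  theorem and continuity are at hand on the space of all sequences; so the analysis is done for the
  full product measure \<open>Q\<close>, for which \<open>ell2\<close> has measure 1. The Hermite
  polynomials stay unnormalised because \<open>delta r a i\<close> then shifts their degree with the
  constant -1; all other constants are collected in the squared norms \<open>N A B\<close>.\<close>

lemma borel_measurable_cnj[measurable (raw)]:
  "f \<in> borel_measurable M \<Longrightarrow> (\<lambda>x. cnj (f x)) \<in> borel_measurable M"
  by (rule borel_measurable_continuous_on[where f = cnj]) (auto intro: continuous_intros)

text \<open>Functions rather than classes modulo null sets, since the coefficients of a
  \<open>form\<close> are functions. The measure is a parameter because both \<open>Q\<close> and
  \<open>P r a\<close> occur.\<close>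

definition sq_int :: "'a measure \<Rightarrow> ('a \<Rightarrow> complex) set" where
  "sq_int M = {f \<in> borel_measurable M. integrable M (\<lambda>x. (cmod (f x))\<^sup>2)}"

definition ip :: "'a measure \<Rightarrow> ('a \<Rightarrow> complex) \<Rightarrow> ('a \<Rightarrow> complex) \<Rightarrow> complex" where
  "ip M f g = (\<integral>x. f x * cnj (g x) \<partial>M)"

definition nsq :: "'a measure \<Rightarrow> ('a \<Rightarrow> complex) \<Rightarrow> real" where
  "nsq M f = (\<integral>x. (cmod (f x))\<^sup>2 \<partial>M)"

lemma sq_int_measurable[measurable_dest]: "f \<in> sq_int M \<Longrightarrow> f \<in> borel_measurable M"
  by (simp add: sq_int_def)

lemma sq_int_integrable: "f \<in> sq_int M \<Longrightarrow> integrable M (\<lambda>x. (cmod (f x))\<^sup>2)"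
  by (simp add: sq_int_def)

lemma sq_int_bounded_by:
  assumes "f \<in> borel_measurable M" "integrable M g" "\<And>x. (cmod (f x))\<^sup>2 \<le> g x"
  shows "f \<in> sq_int M"
proof -
  have "(cmod (f x))\<^sup>2 \<le> norm (g x)" for x
    using assms(3)[of x] by simp
  hence "integrable M (\<lambda>x. (cmod (f x))\<^sup>2)"
    using assms(1) by (intro Bochner_Integration.integrable_bound[OF assms(2)]) auto
  with assms(1) show ?thesis by (simp add: sq_int_def)
qed

lemma sq_int_mult_integrable:
  assumes f: "f \<in> sq_int M" and g: "g \<in> sq_int M"
  shows "integrable M (\<lambda>x. f x * g x)"
proof (rule Bochner_Integration.integrable_bound)
  show "integrable M (\<lambda>x. (cmod (f x))\<^sup>2 + (cmod (g x))\<^sup>2)"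
    using f g by (simp add: sq_int_integrable)
  have "cmod (f x) * cmod (g x) \<le> (cmod (f x))\<^sup>2 + (cmod (g x))\<^sup>2" for x
    using sum_squares_bound[of "cmod (f x)" "cmod (g x)"]
      mult_nonneg_nonneg[of "cmod (f x)" "cmod (g x)", OF norm_ge_zero norm_ge_zero] by linarith
  thus "AE x in M. norm (f x * g x) \<le> norm ((cmod (f x))\<^sup>2 + (cmod (g x))\<^sup>2)"
    by (simp add: norm_mult)
qed (use f g in measurable)

lemma sq_int_cnj: "f \<in> sq_int M \<Longrightarrow> (\<lambda>x. cnj (f x)) \<in> sq_int M"
  by (auto simp: sq_int_def)

lemma sq_int_ip_integrable:
  "f \<in> sq_int M \<Longrightarrow> g \<in> sq_int M \<Longrightarrow> integrable M (\<lambda>x. f x * cnj (g x))"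
  by (intro sq_int_mult_integrable sq_int_cnj)

lemma sq_int_scale: "f \<in> sq_int M \<Longrightarrow> (\<lambda>x. c * f x) \<in> sq_int M"
  by (auto simp: sq_int_def norm_mult power_mult_distrib)

lemma sq_int_add:
  assumes f: "f \<in> sq_int M" and g: "g \<in> sq_int M"
  shows "(\<lambda>x. f x + g x) \<in> sq_int M"
proof (rule sq_int_bounded_by)
  show "integrable M (\<lambda>x. 2 * (cmod (f x))\<^sup>2 + 2 * (cmod (g x))\<^sup>2)"
    using f g by (simp add: sq_int_integrable)
  show "(cmod (f x + g x))\<^sup>2 \<le> 2 * (cmod (f x))\<^sup>2 + 2 * (cmod (g x))\<^sup>2" for x
    using cmod_diff_sq_le[of "f x" "- g x" 0] by simp
qed (use f g in measurable)

lemma sq_int_diff: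
  assumes "f \<in> sq_int M" "g \<in> sq_int M"
  shows "(\<lambda>x. f x - g x) \<in> sq_int M"
  using sq_int_add[OF assms(1) sq_int_scale[OF assms(2), of "-1"]] by simp

lemma sq_int_zero[simp]: "(\<lambda>x. 0) \<in> sq_int M"
  by (simp add: sq_int_def)

lemma sq_int_sum:
  "(\<And>i. i \<in> S \<Longrightarrow> f i \<in> sq_int M) \<Longrightarrow> (\<lambda>x. \<Sum>i\<in>S. f i x) \<in> sq_int M"
  by (induction S rule: infinite_finite_induct) (auto intro: sq_int_add)

lemma (in finite_measure) sq_int_integrable1:
  assumes "f \<in> sq_int M" shows "integrable M f"
  using sq_int_mult_integrable[OF assms, of "\<lambda>x. 1"] by (simp add: sq_int_def)

lemma ip_add_left:
  "f \<in> sq_int M \<Longrightarrow> g \<in> sq_int M \<Longrightarrow> h \<in> sq_int M \<Longrightarrow>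
    ip M (\<lambda>x. f x + g x) h = ip M f h + ip M g h"
  by (simp add: ip_def distrib_right sq_int_ip_integrable)

lemma ip_diff_left:
  "f \<in> sq_int M \<Longrightarrow> g \<in> sq_int M \<Longrightarrow> h \<in> sq_int M \<Longrightarrow>
    ip M (\<lambda>x. f x - g x) h = ip M f h - ip M g h"
  by (simp add: ip_def left_diff_distrib sq_int_ip_integrable)

lemma ip_scale_left: "ip M (\<lambda>x. c * f x) g = c * ip M f g"
  by (simp add: ip_def mult.assoc)

lemma ip_cnj: "ip M g f = cnj (ip M f g)"
  unfolding ip_def
  by (subst Bochner_Integration.integral_cnj[symmetric]) (simp add: mult.commute)

lemma ip_sum_left:
  assumes "\<And>i. i \<in> S \<Longrightarrow> f i \<in> sq_int M" "h \<in> sq_int M"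
  shows "ip M (\<lambda>x. \<Sum>i\<in>S. f i x) h = (\<Sum>i\<in>S. ip M (f i) h)"
  using assms by (simp add: ip_def sum_distrib_right sq_int_ip_integrable)

lemma ip_self: "ip M f f = of_real (nsq M f)"
  by (simp add: ip_def nsq_def flip: integral_complex_of_real complex_norm_square)

lemma nsq_nonneg[simp]: "0 \<le> nsq M f"
  by (simp add: nsq_def)

lemma ip_cong_AE:
  assumes "AE x in M. f x = f' x" "f \<in> borel_measurable M" "f' \<in> borel_measurable M" "g \<in> borel_measurable M"
  shows "ip M f g = ip M f' g"
  unfolding ip_def by (rule integral_cong_AE) (use assms in auto)

lemma ip_Cauchy_Schwarz:
  assumes f: "f \<in> sq_int M" and g: "g \<in> sq_int M"
  shows "(cmod (ip M f g))\<^sup>2 \<le> nsq M f * nsq M g"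
proof -
  have i: "integrable M (\<lambda>x. cmod (f x) * cmod (g x))"
    using integrable_norm[OF sq_int_mult_integrable[OF f g]] by (simp add: norm_mult)
  define C where "C = (\<integral>x. cmod (f x) * cmod (g x) \<partial>M)"
  have C: "C \<ge> 0" by (simp add: C_def)
  have [measurable]: "f \<in> borel_measurable M" "g \<in> borel_measurable M"
    using f g by auto
  have "(\<integral>\<^sup>+x. ennreal (cmod (f x)) * ennreal (cmod (g x)) \<partial>M)\<^sup>2
      \<le> (\<integral>\<^sup>+x. ennreal (cmod (f x)) ^ 2 \<partial>M) * (\<integral>\<^sup>+x. ennreal (cmod (g x)) ^ 2 \<partial>M)"
    by (rule Cauchy_Schwarz_nn_integral) auto
  hence "ennreal C ^ 2 \<le> ennreal (nsq M f) * ennreal (nsq M g)"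
    unfolding C_def nsq_def using f g i
    by (simp add: ennreal_power nn_integral_eq_integral sq_int_integrable flip: ennreal_mult)
  hence "C\<^sup>2 \<le> nsq M f * nsq M g"
    using C by (simp add: ennreal_power nsq_nonneg flip: ennreal_mult)
  moreover have "cmod (ip M f g) \<le> C"
    unfolding ip_def C_def using integral_norm_bound[of M "\<lambda>x. f x * cnj (g x)"]
    by (simp add: norm_mult)
  ultimately show ?thesis
    using power_mono[of "cmod (ip M f g)" C 2] by simp
qed

text \<open>With a geometric rate as hypothesis no subsequence has to be extracted. On a probability
  space the increments have L1 norms at most 2^(-n), by Cauchy-Schwarz, so they are absolutely
  summable almost everywhere; Fatou's lemma then turns the rate for \<open>f m - f j\<close> into
  the same rate for \<open>u - f j\<close>.\<close>

lemma (in prob_space) sq_int_complete: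
  assumes f: "\<And>n. f n \<in> sq_int M"
    and cau: "\<And>j m. j \<le> m \<Longrightarrow> nsq M (\<lambda>x. f m x - f j x) \<le> (1/4) ^ j"
  obtains u where "u \<in> sq_int M" "(\<lambda>j. nsq M (\<lambda>x. u x - f j x)) \<longlonglongrightarrow> 0"
proof -
  have [measurable]: "f n \<in> borel_measurable M" for n using f by auto
  define d where "d = (\<lambda>j x. f (Suc j) x - f j x)"
  have [measurable]: "d n \<in> borel_measurable M" for n by (simp add: d_def)
  have d: "d n \<in> sq_int M" for n unfolding d_def by (intro sq_int_diff f)
  have one: "(\<lambda>x. 1) \<in> sq_int M" by (simp add: sq_int_def)
  have "(\<integral>\<^sup>+x. ennreal (cmod (d n x)) \<partial>M) \<le> ennreal ((1/2) ^ n)" for n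
  proof -
    have "(\<integral>x. cmod (d n x) \<partial>M)\<^sup>2 \<le> nsq M (d n)"
    proof -
      have "(\<lambda>x. of_real (cmod (d n x))) \<in> sq_int M" using d by (simp add: sq_int_def)
      from ip_Cauchy_Schwarz[OF this one]
      show ?thesis by (simp add: ip_def nsq_def prob_space)
    qed
    also have "\<dots> \<le> (1/4) ^ n" using cau[of n "Suc n"] by (simp add: d_def)
    also have "\<dots> = ((1/2) ^ n)\<^sup>2" by (simp add: power2_eq_square flip: power_mult_distrib)
    finally have "(\<integral>x. cmod (d n x) \<partial>M) \<le> (1/2) ^ n" by (rule power2_le_imp_le) simp
    thus ?thesis using sq_int_integrable1[OF d, of n]
      by (simp add: nn_integral_eq_integral)
  qed
  hence "(\<integral>\<^sup>+x. (\<Sum>n. ennreal (cmod (d n x))) \<partial>M) \<le> (\<Sum>n. ennreal ((1/2) ^ n))"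
    by (subst nn_integral_suminf) (auto intro!: suminf_le)
  also have "\<dots> = ennreal (\<Sum>n. (1/2) ^ n)" by (intro suminf_ennreal_eq) (auto simp: geometric_sums[of "1/2::real", simplified] summable_sums)
  also have "\<dots> < \<infinity>" by simp
  finally have "AE x in M. (\<Sum>n. ennreal (cmod (d n x))) \<noteq> \<infinity>"
    by (intro nn_integral_PInf_AE) auto
  hence conv: "AE x in M. convergent (\<lambda>n. f n x)"
  proof eventually_elim
    case (elim x)
    hence "summable (\<lambda>n. cmod (d n x))"
      by (intro summable_suminf_not_top) auto
    hence "summable (\<lambda>n. d n x)" by (rule summable_norm_cancel)
    hence "convergent (\<lambda>n. \<Sum>k<n. d k x)" by (simp add: summable_iff_convergent)
    hence "convergent (\<lambda>n. (\<Sum>k<n. d k x) + f 0 x)" by (intro convergent_add convergent_const)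
    moreover have "(\<Sum>k<n. d k x) + f 0 x = f n x" for n
      by (induction n) (auto simp: d_def algebra_simps)
    ultimately show ?case by simp
  qed
  define u where "u = (\<lambda>x. lim (\<lambda>n. f n x))"
  have [measurable]: "u \<in> borel_measurable M" unfolding u_def by measurable
  have bound: "(\<integral>\<^sup>+x. ennreal ((cmod (u x - f j x))\<^sup>2) \<partial>M) \<le> ennreal ((1/4) ^ j)" for j
  proof -
    have "(\<integral>\<^sup>+x. ennreal ((cmod (u x - f j x))\<^sup>2) \<partial>M)
        = (\<integral>\<^sup>+x. liminf (\<lambda>m. ennreal ((cmod (f m x - f j x))\<^sup>2)) \<partial>M)"
    proof (rule nn_integral_cong_AE)
      show "AE x in M. ennreal ((cmod (u x - f j x))\<^sup>2) = liminf (\<lambda>m. ennreal ((cmod (f m x - f j x))\<^sup>2))"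
        using conv
      proof eventually_elim
        case (elim x)
        hence "(\<lambda>n. f n x) \<longlonglongrightarrow> u x" by (simp add: u_def convergent_LIMSEQ_iff)
        hence "(\<lambda>m. ennreal ((cmod (f m x - f j x))\<^sup>2)) \<longlonglongrightarrow> ennreal ((cmod (u x - f j x))\<^sup>2)"
          by (intro tendsto_intros)
        thus ?case by (rule lim_imp_Liminf[OF sequentially_bot, symmetric])
      qed
    qed
    also have "\<dots> \<le> liminf (\<lambda>m. \<integral>\<^sup>+x. ennreal ((cmod (f m x - f j x))\<^sup>2) \<partial>M)"
      by (rule nn_integral_liminf) auto
    also have "\<dots> \<le> ennreal ((1/4) ^ j)"
    proof (rule Liminf_le)
      show "\<forall>\<^sub>F m in sequentially. (\<integral>\<^sup>+x. ennreal ((cmod (f m x - f j x))\<^sup>2) \<partial>M) \<le> ennreal ((1/4) ^ j)"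
        using eventually_ge_at_top[of j]
      proof eventually_elim
        case (elim m)
        have "(\<lambda>x. f m x - f j x) \<in> sq_int M" by (intro sq_int_diff f)
        thus ?case using cau[OF elim]
          by (simp add: nn_integral_eq_integral sq_int_integrable nsq_def)
      qed
    qed auto
    finally show ?thesis .
  qed
  have sq: "(\<lambda>x. u x - f j x) \<in> sq_int M" for j
    using order_le_less_trans[OF bound[of j] ennreal_less_top]
    by (auto simp: sq_int_def intro!: integrableI_bounded)
  have le: "nsq M (\<lambda>x. u x - f j x) \<le> (1/4) ^ j" for j
    using bound[of j] sq_int_integrable[OF sq[of j]]
    by (simp add: nsq_def nn_integral_eq_integral)
  show ?thesis
  proof (rule that)
    show "u \<in> sq_int M" using sq_int_add[OF sq[of 0] f[of 0]] by simp
    show "(\<lambda>j. nsq M (\<lambda>x. u x - f j x)) \<longlonglongrightarrow> 0"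
      by (rule tendsto_sandwich[of "\<lambda>_. 0" _ _ "\<lambda>j. (1/4) ^ j"])
        (use le nsq_nonneg LIMSEQ_power_zero[of "1/4::real"] in auto)
  qed
qed


subsection \<open>Orthonormal families\<close>

text \<open>The index type is countably infinite so that a bijection with the natural numbers
  enumerates it, along which partial sums of an expansion form a sequence.\<close>

locale ortho = prob_space M for M :: "'a measure" +
  fixes e :: "'i \<Rightarrow> 'a \<Rightarrow> complex"
  assumes countable_index: "countable (UNIV :: 'i set)" "infinite (UNIV :: 'i set)"
    and e_sq_int: "e i \<in> sq_int M"
    and ip_e: "ip M (e i) (e j) = (if i = j then 1 else 0)"
begin

lemma ip_sum_e:
  assumes "finite S"
  shows "ip M (\<lambda>x. \<Sum>i\<in>S. c i * e i x) (e j) = (if j \<in> S then c j else 0)"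
  using assms
  by (subst ip_sum_left) (auto intro!: sq_int_scale e_sq_int simp: ip_scale_left ip_e if_distrib cong: if_cong)

lemma nsq_sum_e:
  assumes "finite S"
  shows "nsq M (\<lambda>x. \<Sum>i\<in>S. c i * e i x) = (\<Sum>i\<in>S. (cmod (c i))\<^sup>2)"
proof -
  let ?s = "\<lambda>x. \<Sum>i\<in>S. c i * e i x"
  have s: "?s \<in> sq_int M" by (intro sq_int_sum sq_int_scale e_sq_int)
  have "ip M ?s ?s = (\<Sum>i\<in>S. c i * ip M (e i) ?s)"
    using s by (subst ip_sum_left) (auto intro!: sq_int_scale e_sq_int simp: ip_scale_left)
  also have "\<dots> = (\<Sum>i\<in>S. c i * cnj (c i))"
    using assms by (intro sum.cong) (auto simp: ip_cnj[of M "e _"] ip_sum_e)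
  also have "\<dots> = of_real (\<Sum>i\<in>S. (cmod (c i))\<^sup>2)"
    by (simp add: complex_norm_square del: of_real_power)
  finally show ?thesis by (simp only: ip_self of_real_eq_iff)
qed

lemma bessel:
  assumes S: "finite S" and f: "f \<in> sq_int M"
  shows "(\<Sum>i\<in>S. (cmod (ip M f (e i)))\<^sup>2) \<le> nsq M f"
proof -
  define c where "c = (\<lambda>i. ip M f (e i))"
  define s where "s = (\<lambda>x. \<Sum>i\<in>S. c i * e i x)"
  have s: "s \<in> sq_int M" unfolding s_def by (intro sq_int_sum sq_int_scale e_sq_int)
  have "ip M s f = (\<Sum>i\<in>S. c i * ip M (e i) f)"
    unfolding s_def using f by (subst ip_sum_left) (auto intro!: sq_int_scale e_sq_int simp: ip_scale_left)
  also have "\<dots> = (\<Sum>i\<in>S. c i * cnj (c i))"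
    by (simp add: c_def ip_cnj[of M "e _"])
  also have "\<dots> = of_real (\<Sum>i\<in>S. (cmod (c i))\<^sup>2)"
    by (simp add: complex_norm_square del: of_real_power)
  finally have 1: "ip M s f = of_real (nsq M s)"
    unfolding s_def by (simp add: nsq_sum_e[OF S])
  hence 2: "ip M f s = of_real (nsq M s)" by (simp add: ip_cnj[of M f])
  have "ip M (\<lambda>x. f x - s x) (\<lambda>x. f x - s x) = of_real (nsq M f - nsq M s)"
  proof -
    have "ip M (\<lambda>x. f x - s x) g = ip M f g - ip M s g" if "g \<in> sq_int M" for g
      using f s that by (rule ip_diff_left)
    moreover have "ip M g (\<lambda>x. f x - s x) = ip M g f - ip M g s" if "g \<in> sq_int M" for g
      using f s that by (subst ip_cnj) (simp add: ip_diff_left ip_cnj[of M g])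
    ultimately show ?thesis using f s sq_int_diff[OF f s] 1 2 ip_self[of M f] ip_self[of M s]
      by (simp del: ip_self)
  qed
  hence "nsq M f - nsq M s = nsq M (\<lambda>x. f x - s x)"
    unfolding ip_self of_real_eq_iff by simp
  hence "nsq M s \<le> nsq M f" using nsq_nonneg[of M "\<lambda>x. f x - s x"] by linarith
  thus ?thesis by (simp add: s_def nsq_sum_e[OF S] c_def)
qed

text \<open>Absolute convergence makes the sum of the products independent of the order, so its
  value may be computed along any enumeration.\<close>

lemma coeffs_abs_summable:
  assumes c: "\<And>S. finite S \<Longrightarrow> (\<Sum>i\<in>S. (cmod (c i))\<^sup>2) \<le> B" and v: "v \<in> sq_int M"
  shows "(\<lambda>i. norm (c i * cnj (ip M v (e i)))) summable_on UNIV"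
proof (rule nonneg_bdd_above_summable_on)
  have "(\<Sum>i\<in>S. norm (c i * cnj (ip M v (e i)))) \<le> B + nsq M v" if S: "finite S" for S
  proof -
    have "(\<Sum>i\<in>S. norm (c i * cnj (ip M v (e i)))) \<le> (\<Sum>i\<in>S. (cmod (c i))\<^sup>2 + (cmod (ip M v (e i)))\<^sup>2)"
    proof (rule sum_mono)
      fix i
      have "0 \<le> cmod (c i) * cmod (ip M v (e i))" by simp
      hence "cmod (c i) * cmod (ip M v (e i)) \<le> (cmod (c i))\<^sup>2 + (cmod (ip M v (e i)))\<^sup>2"
        using sum_squares_bound[of "cmod (c i)" "cmod (ip M v (e i))"] by linarith
      thus "norm (c i * cnj (ip M v (e i))) \<le> (cmod (c i))\<^sup>2 + (cmod (ip M v (e i)))\<^sup>2"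
        by (simp add: norm_mult)
    qed
    also have "\<dots> \<le> B + nsq M v"
      using c[OF S] bessel[OF S v] by (simp add: sum.distrib)
    finally show ?thesis .
  qed
  thus "bdd_above (sum (\<lambda>i. norm (c i * cnj (ip M v (e i)))) ` {F. F \<subseteq> UNIV \<and> finite F})"
    by (intro bdd_aboveI2) auto
qed auto

text \<open>The last conclusion, an expansion of \<open>ip M u v\<close> for every square-integrable
  \<open>v\<close>, is the form that matters later: it is how identities between coefficients become
  identities between integrals.\<close>

lemma riesz_fischer:
  assumes c: "\<And>S. finite S \<Longrightarrow> (\<Sum>i\<in>S. (cmod (c i))\<^sup>2) \<le> B"
  obtains u where "u \<in> sq_int M" "\<And>i. ip M u (e i) = c i" "nsq M u \<le> B"
    "\<And>v. v \<in> sq_int M \<Longrightarrow> ((\<lambda>i. c i * cnj (ip M v (e i))) has_sum ip M u v) UNIV"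
proof -
  define b :: "nat \<Rightarrow> 'i" where "b = from_nat_into UNIV"
  have b: "bij b" unfolding b_def
    using bij_betw_from_nat_into[OF countable_index] .
  have inj: "inj b" using b by (simp add: bij_def)
  have a_sum: "summable (\<lambda>k. (cmod (c (b k)))\<^sup>2)"
  proof (rule summableI_nonneg_bounded)
    fix n
    have "(\<Sum>k<n. (cmod (c (b k)))\<^sup>2) = (\<Sum>i\<in>b ` {..<n}. (cmod (c i))\<^sup>2)"
      using inj by (subst sum.reindex) (auto intro: inj_on_subset)
    thus "(\<Sum>k<n. (cmod (c (b k)))\<^sup>2) \<le> B" using c[of "b ` {..<n}"] by simp
  qed auto
  have "\<forall>j. \<exists>N. \<forall>m\<ge>N. \<forall>n. norm (\<Sum>k=m..<n. (cmod (c (b k)))\<^sup>2) < (1/4) ^ j"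
    using a_sum by (auto simp: summable_Cauchy)
  then obtain N where N: "\<And>j m n. m \<ge> N j \<Longrightarrow> norm (\<Sum>k=m..<n. (cmod (c (b k)))\<^sup>2) < (1/4) ^ j"
    by metis
  \<comment> \<open>The sum makes \<open>N'\<close> monotone and at least \<open>N j\<close>; the
    summand \<open>j\<close> makes it tend to infinity.\<close>
  define N' where "N' = (\<lambda>j. j + (\<Sum>i\<le>j. N i))"
  have N'_mono: "N' j \<le> N' m" if "j \<le> m" for j m
    unfolding N'_def using that by (intro add_mono sum_mono2) auto
  have N'_ge: "N j \<le> N' j" for j
    unfolding N'_def using member_le_sum[of j "{..j}" N] by simp
  define f where "f = (\<lambda>j x. \<Sum>i\<in>b ` {..<N' j}. c i * e i x)"
  have f: "f j \<in> sq_int M" for j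
    unfolding f_def by (intro sq_int_sum sq_int_scale e_sq_int)
  have cau: "nsq M (\<lambda>x. f m x - f j x) \<le> (1/4) ^ j" if "j \<le> m" for j m
  proof -
    have "(\<lambda>x. f m x - f j x) = (\<lambda>x. \<Sum>i\<in>b ` {N' j..<N' m}. c i * e i x)"
    proof
      fix x
      have "{..<N' m} = {..<N' j} \<union> {N' j..<N' m}" using N'_mono[OF that] by auto
      hence "f m x = f j x + (\<Sum>i\<in>b ` {N' j..<N' m}. c i * e i x)"
        unfolding f_def using inj
        by (subst sum.union_disjoint[symmetric]) (auto dest: injD simp: image_Un)
      thus "f m x - f j x = (\<Sum>i\<in>b ` {N' j..<N' m}. c i * e i x)" by simp
    qed
    hence "nsq M (\<lambda>x. f m x - f j x) = (\<Sum>i\<in>b ` {N' j..<N' m}. (cmod (c i))\<^sup>2)"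
      by (simp add: nsq_sum_e)
    also have "\<dots> = (\<Sum>k=N' j..<N' m. (cmod (c (b k)))\<^sup>2)"
      using inj by (subst sum.reindex) (auto intro: inj_on_subset)
    also have "\<dots> \<le> (1/4) ^ j"
      using N[of j "N' j" "N' m"] N'_ge[of j] by (simp add: sum_nonneg)
    finally show ?thesis .
  qed
  obtain u where u: "u \<in> sq_int M" and conv: "(\<lambda>j. nsq M (\<lambda>x. u x - f j x)) \<longlonglongrightarrow> 0"
    using sq_int_complete[OF f cau] by blast
  have ip_conv: "(\<lambda>j. ip M (f j) v) \<longlonglongrightarrow> ip M u v" if v: "v \<in> sq_int M" for v
  proof -
    have "(\<lambda>j. (cmod (ip M (\<lambda>x. u x - f j x) v))\<^sup>2) \<longlonglongrightarrow> 0"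
      by (rule tendsto_sandwich[of "\<lambda>_. 0" _ _ "\<lambda>j. nsq M (\<lambda>x. u x - f j x) * nsq M v"])
        (use ip_Cauchy_Schwarz[OF sq_int_diff[OF u f] v] tendsto_mult_left_zero[OF conv] in auto)
    hence "(\<lambda>j. ip M (\<lambda>x. u x - f j x) v) \<longlonglongrightarrow> 0"
      by (simp add: tendsto_norm_zero_iff)
    hence "(\<lambda>j. ip M u v - ip M (f j) v) \<longlonglongrightarrow> 0"
      using u f v by (simp add: ip_diff_left)
    from tendsto_diff[OF tendsto_const[of "ip M u v"] this] show ?thesis by simp
  qed
  \<comment> \<open>Absolute convergence supplies some value \<open>T\<close>; the partial sums
    along \<open>N'\<close> are \<open>ip M (f j) v\<close>, which identifies
    \<open>T\<close>.\<close>
  have hs: "((\<lambda>i. c i * cnj (ip M v (e i))) has_sum ip M u v) UNIV" if v: "v \<in> sq_int M" for v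
  proof -
    have "(\<lambda>i. c i * cnj (ip M v (e i))) summable_on UNIV"
      using abs_summable_summable[OF coeffs_abs_summable[OF c v]] by simp
    then obtain T where T: "((\<lambda>i. c i * cnj (ip M v (e i))) has_sum T) UNIV"
      by (auto simp: summable_on_def)
    have "((\<lambda>k. c (b k) * cnj (ip M v (e (b k)))) has_sum T) UNIV"
      using has_sum_reindex_bij_betw[of b UNIV UNIV "\<lambda>i. c i * cnj (ip M v (e i))" T] b T by simp
    hence "(\<lambda>k. c (b k) * cnj (ip M v (e (b k)))) sums T"
      by (rule has_sum_imp_sums)
    hence lim: "(\<lambda>n. \<Sum>k<n. c (b k) * cnj (ip M v (e (b k)))) \<longlonglongrightarrow> T" by (simp add: sums_def)
    have "filterlim N' at_top sequentially"
      by (rule filterlim_at_top_mono[OF filterlim_ident]) (auto simp: N'_def)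
    from filterlim_compose[OF lim this]
    have "(\<lambda>j. \<Sum>k<N' j. c (b k) * cnj (ip M v (e (b k)))) \<longlonglongrightarrow> T" .
    moreover have "(\<Sum>k<N' j. c (b k) * cnj (ip M v (e (b k)))) = ip M (f j) v" for j
    proof -
      have "ip M (f j) v = (\<Sum>i\<in>b ` {..<N' j}. c i * ip M (e i) v)"
        unfolding f_def using v by (subst ip_sum_left) (auto intro!: sq_int_scale e_sq_int simp: ip_scale_left)
      also have "\<dots> = (\<Sum>k<N' j. c (b k) * ip M (e (b k)) v)"
        using inj by (subst sum.reindex) (auto intro: inj_on_subset)
      finally show ?thesis by (simp add: ip_cnj[of M "e _" v])
    qed
    ultimately have "(\<lambda>j. ip M (f j) v) \<longlonglongrightarrow> T" by simp
    with ip_conv[OF v] have "T = ip M u v" by (rule LIMSEQ_unique[symmetric])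
    thus ?thesis using T by simp
  qed
  have coef: "ip M u (e i) = c i" for i
  proof -
    have "((\<lambda>j. c j * cnj (ip M (e i) (e j))) has_sum c i) UNIV"
      by (rule has_sum_finite_neutralI[of "{i}"]) (auto simp: ip_e)
    thus ?thesis using has_sum_unique[OF hs[OF e_sq_int]] by blast
  qed
  show ?thesis
  proof (rule that[OF u coef _ hs])
    have "((\<lambda>i. of_real ((cmod (c i))\<^sup>2)) has_sum (of_real (nsq M u) :: complex)) UNIV"
      using hs[OF u] by (simp add: coef ip_self complex_norm_square del: of_real_power)
    hence "((\<lambda>i. (cmod (c i))\<^sup>2) has_sum nsq M u) UNIV"
      by (simp only: has_sum_of_real_iff)
    thus "nsq M u \<le> B"
      by (rule has_sum_le_finite_sums) (rule c)
  qed
qed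

text \<open>Riesz-Fischer applied to the coefficients of \<open>f\<close> returns some
  \<open>u\<close>, and completeness forces \<open>u = f\<close> almost everywhere.\<close>

lemma parseval:
  assumes complete: "\<And>g. g \<in> sq_int M \<Longrightarrow> (\<And>i. ip M g (e i) = 0) \<Longrightarrow> AE x in M. g x = 0"
    and f: "f \<in> sq_int M" and g: "g \<in> sq_int M"
  shows "((\<lambda>i. ip M f (e i) * cnj (ip M g (e i))) has_sum ip M f g) UNIV"
proof -
  obtain u where u: "u \<in> sq_int M" "\<And>i. ip M u (e i) = ip M f (e i)" "nsq M u \<le> nsq M f"
    "\<And>v. v \<in> sq_int M \<Longrightarrow> ((\<lambda>i. ip M f (e i) * cnj (ip M v (e i))) has_sum ip M u v) UNIV"
    by (rule riesz_fischer[OF bessel[OF _ f]]) (assumption, rule that)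
  have "AE x in M. u x - f x = 0"
    using u f by (intro complete sq_int_diff) (auto simp: ip_diff_left e_sq_int)
  hence "AE x in M. u x = f x" by simp
  hence "ip M u g = ip M f g" using u(1) f g by (intro ip_cong_AE) auto
  thus ?thesis using u(4)[OF g] by simp
qed

end

subsection \<open>Signs of increasing multi-indices\<close>

text \<open>The sign of moving \<open>i\<close> from the front to its place among the entries of
  \<open>K\<close>, that is \<open>eps K i (remove1 i K)\<close> when \<open>i\<close> is an entry.
  Counting only smaller entries makes it meaningful for every \<open>i\<close>, so that one function
  handles both wedging with an index and contracting it.\<close>

definition sg :: "nat \<Rightarrow> nat list \<Rightarrow> int" where
  "sg i K = (-1) ^ card {l \<in> set K. l < i}"

lemma sg_mult_self[simp]: "sg i K * sg i K = 1"
  by (simp add: sg_def flip: power_mult_distrib)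

lemma MI_iff: "K \<in> MI n \<longleftrightarrow> length K = n \<and> sorted K \<and> distinct K"
  by (auto simp: MI_def strict_sorted_iff)

lemma MI_remove1:
  assumes "K \<in> MI (Suc n)" "i \<in> set K"
  shows "remove1 i K \<in> MI n"
  using assms by (auto simp: MI_iff length_remove1 sorted_remove1)

lemma MI_insort:
  assumes "J \<in> MI n" "i \<notin> set J"
  shows "insort i J \<in> MI (Suc n)"
  using assms by (auto simp: MI_iff sorted_insort distinct_insort)

lemma set_remove1_MI: "K \<in> MI n \<Longrightarrow> set (remove1 i K) = set K - {i}"
  by (simp add: MI_iff)

lemma remove1_insort_MI:
  assumes "J \<in> MI n" "i \<notin> set J"
  shows "remove1 i (insort i J) = J"
proof (rule sorted_distinct_set_unique)
  show "set (remove1 i (insort i J)) = set J"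
    using assms MI_insort[OF assms] by (auto simp: set_remove1_MI set_insort_key)
qed (use assms MI_insort[OF assms] in \<open>auto simp: MI_iff sorted_remove1 sorted_insort distinct_insort distinct_remove1\<close>)

lemma insort_remove1_MI: "K \<in> MI n \<Longrightarrow> i \<in> set K \<Longrightarrow> insort i (remove1 i K) = K"
  by (simp add: MI_iff insort_remove1)

lemma insort_remove1_commute_MI:
  assumes "K \<in> MI n" "i \<in> set K" "j \<notin> set K"
  shows "insort j (remove1 i K) = remove1 i (insort j K)"
proof (rule sorted_distinct_set_unique)
  have n: "n = Suc (n - 1)" using assms by (cases K) (auto simp: MI_iff)
  have r: "remove1 i K \<in> MI (n - 1)" using assms n MI_remove1 by metis
  show "set (insort j (remove1 i K)) = set (remove1 i (insort j K))"
    using assms r MI_insort[OF assms(1,3)] by (auto simp: set_insort_key set_remove1_MI)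
  show "sorted (insort j (remove1 i K))" "sorted (remove1 i (insort j K))"
    using assms by (auto simp: MI_iff sorted_remove1 sorted_insort)
  show "distinct (insort j (remove1 i K))" "distinct (remove1 i (insort j K))"
    using assms by (auto simp: MI_iff distinct_insort distinct_remove1)
qed

lemma sg_insort_self: "i \<notin> set J \<Longrightarrow> sg i (insort i J) = sg i J"
  unfolding sg_def by (rule arg_cong[where f = "\<lambda>S. (-1) ^ card S"]) (auto simp: set_insort_key)

lemma sg_insort:
  assumes "j \<notin> set K"
  shows "sg i (insort j K) = (if j < i then - sg i K else sg i K)"
proof -
  have "{l \<in> set (insort j K). l < i}
      = (if j < i then insert j {l \<in> set K. l < i} else {l \<in> set K. l < i})"
    by (auto simp: set_insort_key)
  thus ?thesis using assms by (simp add: sg_def)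
qed

lemma sg_remove1:
  assumes "K \<in> MI n" "i \<in> set K"
  shows "sg j (remove1 i K) = (if i < j then - sg j K else sg j K)"
proof -
  have "i \<notin> set (remove1 i K)" using assms by (simp add: set_remove1_MI)
  from sg_insort[OF this, of j] show ?thesis
    using insort_remove1_MI[OF assms] by (auto split: if_splits)
qed

text \<open>The anticommutation of wedging with \<open>j\<close> and contracting with
  \<open>i\<close>. Since \<open>i\<close> and \<open>j\<close> differ, exactly one of them is below
  the other, so exactly one of the two orders picks up an extra sign.\<close>

lemma sg_exchange:
  assumes "K \<in> MI n" "i \<in> set K" "j \<notin> set K"
  shows "sg i K * sg j (remove1 i K) = - (sg j (insort j K) * sg i (insort j K))"
  using assms by (cases "i < j") (auto simp: sg_remove1 sg_insort sg_insort_self)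

text \<open>Each entry of \<open>xs\<close> that \<open>j\<close> jumps over costs one
  transposition.\<close>

lemma moving_permutation:
  assumes "distinct (xs @ j # ys)"
  shows "\<exists>p. p permutes set (xs @ j # ys) \<and> map p (j # xs @ ys) = xs @ j # ys \<and> sign p = (-1) ^ length xs"
  using assms
proof (induction xs)
  case Nil
  thus ?case by (intro exI[of _ id] conjI permutes_id) (auto simp: sign_id)
next
  case (Cons x xs)
  then obtain p where p: "p permutes set (xs @ j # ys)" "map p (j # xs @ ys) = xs @ j # ys"
    "sign p = (-1) ^ length xs" by auto
  \<comment> \<open>As \<open>p\<close> fixes \<open>x\<close>, this map sends \<open>j\<close> to
    \<open>x\<close> and \<open>x\<close> to \<open>p j\<close>, and agrees with \<open>p\<close>
    elsewhere.\<close>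
  let ?q = "p \<circ> Transposition.transpose j x"
  have px: "p x = x" using p(1) Cons.prems by (auto intro: permutes_not_in)
  have t: "Transposition.transpose j x permutes set (x # xs @ j # ys)"
    by (rule permutes_swap_id) auto
  have p': "p permutes set (x # xs @ j # ys)"
    by (rule permutes_subset[OF p(1)]) auto
  have "?q permutes set ((x # xs) @ j # ys)"
    using permutes_compose[OF t p'] by simp
  moreover have "map ?q xs = map p xs" "map ?q ys = map p ys"
    using Cons.prems by (auto simp: Transposition.transpose_def)
  hence "map ?q (j # (x # xs) @ ys) = (x # xs) @ j # ys"
    using p(2) px by (simp add: Transposition.transpose_def del: map_eq_conv)
  moreover have "sign ?q = (-1) ^ length (x # xs)"
    using p Cons.prems permutation_permutes[of p]
    by (subst sign_compose) (auto simp: permutation_swap_id sign_swap_id)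
  ultimately show ?case by blast
qed

lemma eps_eq:
  assumes K: "K \<in> MI (Suc n)" and i: "i \<in> set K"
  shows "eps K i (remove1 i K) = sg i K"
proof -
  obtain xs ys where split: "K = xs @ i # ys" "i \<notin> set xs"
    using i by (auto dest: split_list_first)
  have d: "distinct (xs @ i # ys)" and s: "sorted (xs @ i # ys)" using K split by (auto simp: MI_iff)
  have r: "remove1 i K = xs @ ys" using split by (simp add: remove1_append)
  obtain p where p: "p permutes set K" "map p (i # xs @ ys) = K" "sign p = (-1) ^ length xs"
    using moving_permutation[OF d] split by auto
  have "(THE p. p permutes set K \<and> map p (i # xs @ ys) = K) = p"
  proof (rule the_equality)
    fix q assume q: "q permutes set K \<and> map q (i # xs @ ys) = K"
    show "q = p"
    proof
      fix x
      show "q x = p x"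
      proof (cases "x \<in> set K")
        case True
        hence "x \<in> set (i # xs @ ys)" using split by auto
        moreover have "map q (i # xs @ ys) = map p (i # xs @ ys)" using q p by simp
        ultimately show ?thesis by (simp only: map_eq_conv)
      next
        case False
        thus ?thesis using q p(1) permutes_not_in[of q "set K" x] permutes_not_in[of p "set K" x] by simp
      qed
    qed
  qed (use p in auto)
  \<comment> \<open>Sortedness identifies the number of entries jumped over with the exponent in
    \<open>sg\<close>.\<close>
  moreover have "{l \<in> set K. l < i} = set xs"
    using s d split by (force simp: sorted_append)
  hence "sg i K = (-1) ^ length xs" using d by (simp add: sg_def distinct_card)
  moreover have "set K = insert i (set (xs @ ys))" using split by auto
  ultimately show ?thesis using p(3) unfolding eps_def r by simp
qed

lemma eps_eq_0:
  assumes "K \<in> MI (Suc n)" "J \<in> MI n" "i \<notin> set K \<or> J \<noteq> remove1 i K"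
  shows "eps K i J = 0"
proof (rule ccontr)
  assume "eps K i J \<noteq> 0"
  hence e: "set K = insert i (set J)" by (auto simp: eps_def split: if_splits)
  have "i \<notin> set J"
  proof
    assume "i \<in> set J"
    hence "set K = set J" using e by auto
    hence "length K = length J"
      using assms by (metis MI_iff distinct_card)
    thus False using assms by (auto simp: MI_iff)
  qed
  hence "set J = set (remove1 i K)" using e assms by (auto simp: set_remove1_MI)
  hence "J = remove1 i K" using assms
    by (intro sorted_distinct_set_unique) (auto simp: MI_iff sorted_remove1)
  thus False using e assms by auto
qed

text \<open>For fixed \<open>K\<close> each \<open>i\<close> determines the only possible
  \<open>J\<close>. The two infinite sums in the weak equation thereby become a finite sum, which
  can be exchanged with the integral.\<close>

lemma infsum_eps:
  fixes X :: "nat \<Rightarrow> nat list \<Rightarrow> complex"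
  assumes K: "K \<in> MI (Suc n)"
  shows "(\<Sum>\<^sub>\<infinity>i. \<Sum>\<^sub>\<infinity>J\<in>MI n. of_int (eps K i J) * X i J)
       = (\<Sum>i\<in>set K. of_int (sg i K) * X i (remove1 i K))"
proof -
  have "(\<Sum>\<^sub>\<infinity>J\<in>MI n. of_int (eps K i J) * X i J)
      = (if i \<in> set K then of_int (sg i K) * X i (remove1 i K) else 0)" for i
  proof (cases "i \<in> set K")
    case True
    have "(\<Sum>\<^sub>\<infinity>J\<in>MI n. of_int (eps K i J) * X i J)
        = (\<Sum>\<^sub>\<infinity>J\<in>{remove1 i K}. of_int (eps K i J) * X i J)"
      using eps_eq_0[OF K] MI_remove1[OF K True] by (intro infsum_cong_neutral) auto
    thus ?thesis using True eps_eq[OF K True] by simp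
  next
    case False
    thus ?thesis using eps_eq_0[OF K] by (auto intro!: infsum_0)
  qed
  hence "(\<Sum>\<^sub>\<infinity>i. \<Sum>\<^sub>\<infinity>J\<in>MI n. of_int (eps K i J) * X i J)
       = (\<Sum>\<^sub>\<infinity>i\<in>set K. of_int (sg i K) * X i (remove1 i K))"
    by (simp only:) (rule infsum_cong_neutral, auto)
  thus ?thesis by simp
qed

subsection \<open>The homotopy formula on coefficients\<close>

text \<open>
  \<open>F K B\<close> stands for the inner product of the coefficient \<open>f\<^sub>K\<close> with the Hermite polynomial of
  antiholomorphic degree \<open>B\<close>. In these coordinates \<open>S\<close> only shifts \<open>B\<close>, without any constants,
  and \<open>homotopy\<close> is \<open>T*\<close> divided by the eigenvalue of the block.
\<close>

definition homotopy :: "nat \<Rightarrow> (nat list \<Rightarrow> nat multiset \<Rightarrow> complex) \<Rightarrow> nat list \<Rightarrow> nat multiset \<Rightarrow> complex" where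
  "homotopy t F J B = (\<Sum>i\<in>set_mset B - set J. of_int (sg i J) * of_nat (count B i) *
      F (insort i J) (B - {#i#})) / of_nat (size B + t)"

text \<open>The Koszul identity. By \<open>sg_exchange\<close> the terms with \<open>j\<close>
  outside \<open>K\<close> are, up to sign, those of the closedness relation for
  \<open>insort j K\<close>, which replaces them by multiples of \<open>F K B\<close>. What remains
  is \<open>F K B\<close> times a number, and that number is the denominator.\<close>

lemma homotopy_solves:
  assumes K: "K \<in> MI (Suc t)"
    and closed: "\<And>L B. L \<in> MI (Suc (Suc t)) \<Longrightarrow>
      (\<Sum>i\<in>set L. of_int (sg i L) * F (remove1 i L) (add_mset i B)) = 0"
  shows "(\<Sum>i\<in>set K. of_int (sg i K) * homotopy t F (remove1 i K) (add_mset i B)) = F K B"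
proof -
  \<comment> \<open>The denominator of \<open>homotopy\<close> at \<open>add_mset i B\<close>, the
    same for every \<open>i\<close>.\<close>
  let ?n = "of_nat (size B + 1 + t) :: complex"
  have n0: "?n \<noteq> 0" using of_nat_eq_0_iff[of "size B + 1 + t", where 'a = complex] by simp
  have summand: "of_int (sg i K) * (homotopy t F (remove1 i K) (add_mset i B) * ?n)
      = of_nat (count B i + 1) * F K B
        - (\<Sum>j\<in>set_mset B - set K. of_nat (count B j) * (of_int (sg j (insort j K)) *
            (of_int (sg i (insort j K)) * F (remove1 i (insort j K)) (add_mset i (B - {#j#})))))"
    if i: "i \<in> set K" for i
  proof -
    have ins: "set_mset (add_mset i B) - set (remove1 i K) = insert i (set_mset B - set K)"
      using i K by (auto simp: set_remove1_MI)
    have "homotopy t F (remove1 i K) (add_mset i B) * ?n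
        = (\<Sum>j\<in>insert i (set_mset B - set K). of_int (sg j (remove1 i K)) *
            of_nat (count (add_mset i B) j) * F (insort j (remove1 i K)) (add_mset i B - {#j#}))"
      unfolding homotopy_def ins using n0 by (simp del: of_nat_add)
    \<comment> \<open>The diagonal term \<open>j = i\<close>: the index that was removed from
      \<open>K\<close> and added to \<open>B\<close> is moved back.\<close>
    also have "\<dots> = of_int (sg i K) * of_nat (count B i + 1) * F K B
        + (\<Sum>j\<in>set_mset B - set K. of_int (sg j (remove1 i K)) *
            of_nat (count (add_mset i B) j) * F (insort j (remove1 i K)) (add_mset i B - {#j#}))"
      using i K by (subst sum.insert) (auto simp: insort_remove1_MI sg_remove1)
    finally have 1: "homotopy t F (remove1 i K) (add_mset i B) * ?n = \<dots>" .
    have 2: "of_int (sg i K) * (of_int (sg j (remove1 i K)) *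
            of_nat (count (add_mset i B) j) * F (insort j (remove1 i K)) (add_mset i B - {#j#}))
        = - (of_nat (count B j) * (of_int (sg j (insort j K)) *
            (of_int (sg i (insort j K)) * F (remove1 i (insort j K)) (add_mset i (B - {#j#})))))"
      if j: "j \<in> set_mset B - set K" for j
    proof -
      have "i \<noteq> j" using i j by auto
      moreover have "of_int (sg i K) * of_int (sg j (remove1 i K))
          = - (of_int (sg j (insort j K)) * of_int (sg i (insort j K)) :: complex)"
        using sg_exchange[OF K i, of j] j by (simp flip: of_int_mult of_int_minus)
      moreover have "insort j (remove1 i K) = remove1 i (insort j K)"
        using insort_remove1_commute_MI[OF K i, of j] j by simp
      moreover have "add_mset i B - {#j#} = add_mset i (B - {#j#})"
        using \<open>i \<noteq> j\<close> by simp
      moreover have "a * (b * c * x) = - (c * (d * (e * x)))" if "a * b = - (d * e)" for a b c d e x :: complex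
        using arg_cong[OF that, of "\<lambda>y. y * c * x"] by (simp add: mult_ac)
      ultimately show ?thesis by simp
    qed
    have 3: "of_int (sg i K) * (of_int (sg i K) * x) = (x :: complex)" for x
      by (simp flip: of_int_mult mult.assoc)
    show ?thesis
      unfolding 1 distrib_left sum_distrib_left
      by (simp only: 2 cong: sum.cong) (simp add: sum_negf 3 mult.assoc)
  qed
  \<comment> \<open>Closedness for \<open>insort j K\<close> has one summand beyond those over
    \<open>set K\<close>, namely \<open>i = j\<close>; it is \<open>F K B\<close> up to
    sign.\<close>
  have closed': "(\<Sum>i\<in>set K. of_int (sg i (insort j K)) * F (remove1 i (insort j K)) (add_mset i (B - {#j#})))
      = - (of_int (sg j (insort j K)) * F K B)" if j: "j \<in> set_mset B - set K" for j
  proof -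
    have L: "insort j K \<in> MI (Suc (Suc t))" using MI_insort[OF K] j by auto
    have "(\<Sum>i\<in>insert j (set K). of_int (sg i (insort j K)) * F (remove1 i (insort j K)) (add_mset i (B - {#j#}))) = 0"
      using closed[OF L, of "B - {#j#}"] by (simp add: set_insort_key)
    thus ?thesis using j K
      by (subst (asm) sum.insert) (auto simp: remove1_insort_MI add_eq_0_iff2)
  qed
  have sq: "of_int (sg j L) * of_int (sg j L) = (1::complex)" for j L by (simp flip: of_int_mult)
  have "(\<Sum>i\<in>set K. of_int (sg i K) * homotopy t F (remove1 i K) (add_mset i B)) * ?n
      = (\<Sum>i\<in>set K. of_nat (count B i + 1) * F K B)
        - (\<Sum>i\<in>set K. \<Sum>j\<in>set_mset B - set K. of_nat (count B j) * (of_int (sg j (insort j K)) *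
            (of_int (sg i (insort j K)) * F (remove1 i (insort j K)) (add_mset i (B - {#j#})))))"
    by (simp only: sum_distrib_right mult.assoc summand sum_subtractf cong: sum.cong)
  also have "(\<Sum>i\<in>set K. \<Sum>j\<in>set_mset B - set K. of_nat (count B j) * (of_int (sg j (insort j K)) *
            (of_int (sg i (insort j K)) * F (remove1 i (insort j K)) (add_mset i (B - {#j#})))))
      = (\<Sum>j\<in>set_mset B - set K. of_nat (count B j) * (of_int (sg j (insort j K)) *
          (\<Sum>i\<in>set K. of_int (sg i (insort j K)) * F (remove1 i (insort j K)) (add_mset i (B - {#j#})))))"
    by (subst sum.swap) (simp add: sum_distrib_left)
  also have "\<dots> = (\<Sum>j\<in>set_mset B - set K. - (of_nat (count B j) * F K B))"
  proof (rule sum.cong)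
    fix j assume "j \<in> set_mset B - set K"
    thus "of_nat (count B j) * (of_int (sg j (insort j K)) *
          (\<Sum>i\<in>set K. of_int (sg i (insort j K)) * F (remove1 i (insort j K)) (add_mset i (B - {#j#}))))
        = - (of_nat (count B j) * F K B)"
      using sq[of j "insort j K"] by (simp only: closed') (simp flip: mult.assoc)
  qed simp
  also have "(\<Sum>i\<in>set K. of_nat (count B i + 1) * F K B) - \<dots>
      = of_nat ((\<Sum>i\<in>set K. count B i) + card (set K) + (\<Sum>j\<in>set_mset B - set K. count B j)) * F K B"
    by (simp add: sum_negf sum.distrib sum_distrib_right distrib_right)
  \<comment> \<open>The eigenvalue, up to scale. Indices in \<open>K\<close> contribute their
    multiplicity in \<open>B\<close> plus one, the others their multiplicity, which together give
    the size of \<open>B + mset K\<close>.\<close>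
  also have "(\<Sum>i\<in>set K. count B i) + card (set K) + (\<Sum>j\<in>set_mset B - set K. count B j) = size B + 1 + t"
  proof -
    have "(\<Sum>i\<in>set K. count B i) = (\<Sum>i\<in>set_mset B \<inter> set K. count B i)"
      by (rule sum.mono_neutral_right) (auto simp: not_in_iff)
    moreover have "size B = (\<Sum>i\<in>set_mset B \<inter> set K. count B i) + (\<Sum>j\<in>set_mset B - set K. count B j)"
      unfolding size_multiset_overloaded_eq by (subst sum.union_disjoint[symmetric]) (auto simp: Int_Diff_Un)
    moreover have "card (set K) = Suc t" using K by (auto simp: MI_iff distinct_card)
    ultimately show ?thesis by simp
  qed
  finally show ?thesis using n0 by (simp only: mult.commute[of _ "F K B"] mult_cancel_right) simp
qed


section \<open>Norm bound for the homotopy\<close>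

definition wt :: "(nat \<Rightarrow> real) \<Rightarrow> nat list \<Rightarrow> real" where
  "wt a J = (\<Prod>j\<leftarrow>J. (a j)\<^sup>2)"

lemma wt_insort: "wt a (insort i J) = (a i)\<^sup>2 * wt a J"
  by (induction J) (auto simp: wt_def mult_ac)

lemma weight_eq: "weight a I J = wt a I * wt a J"
  by (simp add: weight_def wt_def)

lemma wt_pos: "(\<And>i. a i > 0) \<Longrightarrow> wt a J > 0"
  by (induction J) (auto simp: wt_def intro!: mult_pos_pos zero_less_power)

text \<open>A block is finite because the entries of \<open>J\<close> lie in the support of \<gamma>
  and \<open>B\<close> is then \<open>\<gamma> - mset J\<close>.\<close>

lemma finite_blocks:
  assumes "finite \<Gamma>"
  shows "finite {(J, B). J \<in> MI t \<and> B + mset J \<in> \<Gamma>}"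
proof (rule finite_subset)
  let ?L = "{J. set J \<subseteq> (\<Union>\<gamma>\<in>\<Gamma>. set_mset \<gamma>) \<and> length J = t}"
  show "{(J, B). J \<in> MI t \<and> B + mset J \<in> \<Gamma>} \<subseteq> (\<lambda>(J, \<gamma>). (J, \<gamma> - mset J)) ` (?L \<times> \<Gamma>)"
  proof
    fix x assume "x \<in> {(J, B). J \<in> MI t \<and> B + mset J \<in> \<Gamma>}"
    then obtain J B where x: "x = (J, B)" and J: "J \<in> MI t" and B: "B + mset J \<in> \<Gamma>" by blast
    have "set J \<subseteq> set_mset (B + mset J)" by simp
    hence "J \<in> ?L" using J B unfolding MI_iff by blast
    thus "x \<in> (\<lambda>(J, \<gamma>). (J, \<gamma> - mset J)) ` (?L \<times> \<Gamma>)"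
      using B by (intro image_eqI[of _ _ "(J, B + mset J)"]) (auto simp: x)
  qed
  show "finite ((\<lambda>(J, \<gamma>). (J, \<gamma> - mset J)) ` (?L \<times> \<Gamma>))"
    using assms by (intro finite_imageI finite_cartesian_product finite_lists_length_eq) auto
qed

text \<open>One copy of \<open>U\<close> in its squared norm is expanded by its definition; moving
  \<open>i\<close> from \<open>B\<close> to \<open>J\<close> is the adjointness of \<open>T\<close>
  and \<open>T*\<close>, and turns the other copy into \<open>T U\<close>, which is \<open>F\<close>
  by \<open>homotopy_solves\<close>. So the weighted norm of \<open>U\<close> equals that of
  \<open>F\<close> with each term divided by its eigenvalue.\<close>

lemma homotopy_norm:
  fixes N :: "nat multiset \<Rightarrow> real"
  assumes closed: "\<And>L B. L \<in> MI (Suc (Suc t)) \<Longrightarrow>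
      (\<Sum>i\<in>set L. of_int (sg i L) * F (remove1 i L) (add_mset i B)) = 0"
    and N: "\<And>i B. N (add_mset i B) = N B * (c i * (real (count B i) + 1))" "\<And>B. N B > 0"
    and a: "\<And>i. a i > 0" "\<And>i. c i * (a i)\<^sup>2 = \<kappa>" "\<kappa> > 0"
    and \<Gamma>: "finite \<Gamma>"
  shows "(\<Sum>(J, B)\<in>{(J, B). J \<in> MI t \<and> B + mset J \<in> \<Gamma>}. wt a J * ((cmod (homotopy t F J B))\<^sup>2 / N B))
    \<le> 1 / (\<kappa> * (real t + 1)) *
       (\<Sum>(K, B)\<in>{(K, B). K \<in> MI (Suc t) \<and> B + mset K \<in> \<Gamma>}. wt a K * ((cmod (F K B))\<^sup>2 / N B))"
proof -
  define X where "X = {(J, B). J \<in> MI t \<and> B + mset J \<in> \<Gamma>}"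
  define Y where "Y = {(K, B). K \<in> MI (Suc t) \<and> B + mset K \<in> \<Gamma>}"
  have fin: "finite X" "finite Y" unfolding X_def Y_def using \<Gamma> by (simp_all only: finite_blocks)
  define U where "U = homotopy t F"
  \<comment> \<open>The denominator is 0 only for \<open>t = 0\<close> and empty \<open>B\<close>,
    and then there is no index \<open>i\<close> to sum over.\<close>
  define G where "G = (\<lambda>((J, B), i). complex_of_real (wt a J / N B) * cnj (U J B) *
    (of_int (sg i J) * of_nat (count B i) * F (insort i J) (B - {#i#})) / of_nat (size B + t))"
  define G' where "G' = (\<lambda>((K, B), i). complex_of_real (wt a K / (\<kappa> * N B)) *
    (of_int (sg i K) * cnj (U (remove1 i K) (add_mset i B))) * F K B / of_nat (size B + 1 + t))"
  \<comment> \<open>Both maps preserve \<open>B + mset J\<close>, so they stay within the blocks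
    listed in \<Gamma>; \<open>i\<close> is carried along to make them inverse to each
    other.\<close>
  define up :: "(nat list \<times> nat multiset) \<times> nat \<Rightarrow> _"
    where "up = (\<lambda>((J, B), i). ((insort i J, B - {#i#}), i))"
  define down :: "(nat list \<times> nat multiset) \<times> nat \<Rightarrow> _"
    where "down = (\<lambda>((K, B), i). ((remove1 i K, add_mset i B), i))"
  have "complex_of_real (\<Sum>(J, B)\<in>X. wt a J * ((cmod (U J B))\<^sup>2 / N B))
      = (\<Sum>(J, B)\<in>X. \<Sum>i\<in>set_mset B - set J. G ((J, B), i))"
  proof -
    have "complex_of_real (wt a J * ((cmod (U J B))\<^sup>2 / N B)) = (\<Sum>i\<in>set_mset B - set J. G ((J, B), i))" for J B
    proof -
      have "complex_of_real (wt a J * ((cmod (U J B))\<^sup>2 / N B)) = of_real (wt a J / N B) * cnj (U J B) * U J B"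
        by (simp add: complex_norm_square del: of_real_power)
      also have "\<dots> = (\<Sum>i\<in>set_mset B - set J. G ((J, B), i))"
        unfolding U_def[symmetric] G_def
        by (subst (2) U_def) (simp add: homotopy_def sum_distrib_left sum_divide_distrib)
      finally show ?thesis .
    qed
    thus ?thesis by (simp add: case_prod_unfold)
  qed
  also have "\<dots> = sum G (SIGMA x:X. set_mset (snd x) - set (fst x))"
    using fin(1) sum.Sigma[of X "\<lambda>x. set_mset (snd x) - set (fst x)" "\<lambda>x i. G (x, i)"]
    by (simp add: case_prod_unfold)
  also have "\<dots> = sum G' (SIGMA x:Y. set (fst x))"
  proof (rule sum.reindex_bij_witness[where j = up and i = down])
    fix x assume "x \<in> (SIGMA x:X. set_mset (snd x) - set (fst x))"
    then obtain J B i where x: "x = ((J, B), i)" and J: "J \<in> MI t" "i \<notin> set J" and B: "i \<in># B"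
      "B + mset J \<in> \<Gamma>"
      by (auto simp: X_def)
    obtain B' where B': "B = add_mset i B'" using B(1) by (blast dest: multi_member_split)
    show "down (up x) = x"
      using J B by (simp add: x up_def down_def remove1_insort_MI)
    show "up x \<in> (SIGMA x:Y. set (fst x))"
      using J B by (auto simp: x up_def B' Y_def MI_insort set_insort_key)
    have "c i * (a i)\<^sup>2 > 0" using a(2,3) by simp
    hence ci: "c i > 0" using a(1)[of i] by (simp add: zero_less_mult_iff)
    \<comment> \<open>Here the weight meets the variance: \<open>insort i J\<close> contributes
      \<open>(a i)\<^sup>2\<close>, the step from \<open>B'\<close> to \<open>B\<close> contributes
      \<open>c i\<close>, and their product is \<kappa>. The prefactor of \<open>G'\<close> is
      therefore independent of \<open>i\<close> and comes out of the sum that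
      \<open>homotopy_solves\<close> evaluates.\<close>
    have ratio: "(a i)\<^sup>2 * w / (c i * (a i)\<^sup>2 * m) = w / (m * (c i * n)) * n" if "m > 0" "n > 0" for w m n :: real
      using a(1)[of i] ci that by (simp add: field_simps)
    have "wt a (insort i J) / (\<kappa> * N B') = wt a J / N B * real (count B i)"
      using ratio[OF N(2)[of B'], of "real (count B' i) + 1" "wt a J"] unfolding a(2)
      by (simp add: wt_insort B' N(1) add.commute)
    hence w: "complex_of_real (wt a (insort i J) / (\<kappa> * N B')) = of_real (wt a J / N B) * of_nat (count B i)"
      by (simp only: of_real_mult of_real_of_nat_eq)
    have "G' ((insort i J, B'), i) = G ((J, B), i)"
      unfolding G'_def G_def prod.case w
      using J by (simp add: sg_insort_self remove1_insort_MI B' mult_ac)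
    thus "G' (up x) = G x"
      by (simp add: x up_def B')
  next
    fix y assume "y \<in> (SIGMA x:Y. set (fst x))"
    then obtain K B i where y: "y = ((K, B), i)" and K: "K \<in> MI (Suc t)" "i \<in> set K" and B: "B + mset K \<in> \<Gamma>"
      by (auto simp: Y_def)
    show "up (down y) = y"
      using K by (simp add: y up_def down_def insort_remove1_MI)
    show "down y \<in> (SIGMA x:X. set_mset (snd x) - set (fst x))"
      using K B by (auto simp: y down_def X_def MI_remove1 set_remove1_MI)
  qed
  also have "\<dots> = (\<Sum>(K, B)\<in>Y. \<Sum>i\<in>set K. G' ((K, B), i))"
    using fin(2) sum.Sigma[of Y "\<lambda>x. set (fst x)" "\<lambda>x i. G' (x, i)"]
    by (simp add: case_prod_unfold)
  also have "\<dots> = (\<Sum>x\<in>Y. of_real (case x of (K, B) \<Rightarrow>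
      wt a K * ((cmod (F K B))\<^sup>2 / N B) / (\<kappa> * real (size B + 1 + t))))"
  proof (intro sum.cong refl)
    fix x assume "x \<in> Y"
    then obtain K B where x: "x = (K, B)" and "(K, B) \<in> Y" by (cases x) auto
    hence K: "K \<in> MI (Suc t)" by (simp add: Y_def)
    have solves: "(\<Sum>i\<in>set K. of_int (sg i K) * U (remove1 i K) (add_mset i B)) = F K B"
      unfolding U_def by (rule homotopy_solves[OF K]) (rule closed)
    have "(\<Sum>i\<in>set K. G' ((K, B), i)) = of_real (wt a K / (\<kappa> * N B)) *
        cnj (\<Sum>i\<in>set K. of_int (sg i K) * U (remove1 i K) (add_mset i B)) * F K B / of_nat (size B + 1 + t)"
      by (simp add: G'_def sum_distrib_left sum_distrib_right sum_divide_distrib)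
    also have "\<dots> = of_real (wt a K / (\<kappa> * N B)) * (F K B * cnj (F K B)) / of_nat (size B + 1 + t)"
      unfolding solves by (simp add: mult_ac)
    also have "\<dots> = of_real (wt a K * ((cmod (F K B))\<^sup>2 / N B) / (\<kappa> * real (size B + 1 + t)))"
      by (simp add: complex_norm_square del: of_real_power of_nat_add)
    finally show "(case x of (K, B) \<Rightarrow> \<Sum>i\<in>set K. G' ((K, B), i))
      = of_real (case x of (K, B) \<Rightarrow> wt a K * ((cmod (F K B))\<^sup>2 / N B) / (\<kappa> * real (size B + 1 + t)))"
      by (simp only: x prod.case)
  qed
  also have "\<dots> = of_real (\<Sum>(K, B)\<in>Y. wt a K * ((cmod (F K B))\<^sup>2 / N B) / (\<kappa> * real (size B + 1 + t)))"
    by (simp add: case_prod_unfold)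
  finally have "(\<Sum>(J, B)\<in>X. wt a J * ((cmod (U J B))\<^sup>2 / N B))
      = (\<Sum>(K, B)\<in>Y. wt a K * ((cmod (F K B))\<^sup>2 / N B) / (\<kappa> * real (size B + 1 + t)))"
    by (simp only: of_real_eq_iff)
  \<comment> \<open>The only inequality: the eigenvalue is least for empty \<open>B\<close>, whence
    \<open>t + 1\<close>.\<close>
  also have "\<dots> \<le> (\<Sum>(K, B)\<in>Y. 1 / (\<kappa> * (real t + 1)) * (wt a K * ((cmod (F K B))\<^sup>2 / N B)))"
  proof (intro sum_mono)
    fix x :: "nat list \<times> nat multiset"
    obtain K B where x: "x = (K, B)" by (cases x)
    have "wt a K * ((cmod (F K B))\<^sup>2 / N B) / (\<kappa> * real (size B + 1 + t))
      \<le> wt a K * ((cmod (F K B))\<^sup>2 / N B) / (\<kappa> * (real t + 1))"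
      using a(3) N(2)[of B] wt_pos[of a K, OF a(1)]
      by (intro divide_left_mono mult_nonneg_nonneg mult_left_mono mult_pos_pos divide_nonneg_nonneg) (auto intro: less_imp_le)
    thus "(case x of (K, B) \<Rightarrow> wt a K * ((cmod (F K B))\<^sup>2 / N B) / (\<kappa> * real (size B + 1 + t)))
      \<le> (case x of (K, B) \<Rightarrow> 1 / (\<kappa> * (real t + 1)) * (wt a K * ((cmod (F K B))\<^sup>2 / N B)))"
      by (simp only: x prod.case) (simp add: mult_ac)
  qed
  finally show ?thesis unfolding X_def Y_def U_def
    by (simp add: sum_distrib_left case_prod_unfold)
qed

subsection \<open>Polynomials\<close>

text \<open>Polynomials in finitely many coordinates and their conjugates. Building them by single
  multiplications lets continuity, differentiability, growth and membership in the Hermite span each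
  follow by one induction.\<close>

inductive poly_fun :: "(cseq \<Rightarrow> complex) \<Rightarrow> bool" where
  const: "poly_fun (\<lambda>z. c)"
| add: "poly_fun p \<Longrightarrow> poly_fun q \<Longrightarrow> poly_fun (\<lambda>z. p z + q z)"
| mult_coord: "poly_fun p \<Longrightarrow> poly_fun (\<lambda>z. z i * p z)"
| mult_cnj: "poly_fun p \<Longrightarrow> poly_fun (\<lambda>z. cnj (z i) * p z)"

lemma poly_fun_mult:
  assumes "poly_fun p" "poly_fun q"
  shows "poly_fun (\<lambda>z. p z * q z)"
  using assms(1)
proof induction
  case (const c)
  show ?case using assms(2)
  proof induction
    case (add p q)
    thus ?case using poly_fun.add[of "\<lambda>z. c * p z" "\<lambda>z. c * q z"] by (simp add: distrib_left)
  next
    case (mult_coord p i)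
    thus ?case using poly_fun.mult_coord[of "\<lambda>z. c * p z" i] by (simp add: mult_ac)
  next
    case (mult_cnj p i)
    thus ?case using poly_fun.mult_cnj[of "\<lambda>z. c * p z" i] by (simp add: mult_ac)
  qed (rule poly_fun.const)
next
  case (add p1 p2)
  thus ?case using poly_fun.add[of "\<lambda>z. p1 z * q z" "\<lambda>z. p2 z * q z"] by (simp add: distrib_right)
next
  case (mult_coord p i)
  thus ?case using poly_fun.mult_coord[of "\<lambda>z. p z * q z" i] by (simp add: mult_ac)
next
  case (mult_cnj p i)
  thus ?case using poly_fun.mult_cnj[of "\<lambda>z. p z * q z" i] by (simp add: mult_ac)
qed

lemma poly_fun_scale: "poly_fun p \<Longrightarrow> poly_fun (\<lambda>z. c * p z)"
  using poly_fun_mult[OF poly_fun.const] .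

lemma poly_fun_diff: "poly_fun p \<Longrightarrow> poly_fun q \<Longrightarrow> poly_fun (\<lambda>z. p z - q z)"
  using poly_fun.add[OF _ poly_fun_scale[of q "-1"]] by simp

lemma poly_fun_cnj: "poly_fun p \<Longrightarrow> poly_fun (\<lambda>z. cnj (p z))"
  by (induction rule: poly_fun.induct) (auto intro: poly_fun.intros)

lemma poly_fun_coord: "poly_fun (\<lambda>z. z i)" "poly_fun (\<lambda>z. cnj (z i))"
  using poly_fun.mult_coord[OF poly_fun.const[of 1], of i] poly_fun.mult_cnj[OF poly_fun.const[of 1], of i]
  by simp_all

lemma poly_fun_Re: "poly_fun p \<Longrightarrow> poly_fun (\<lambda>z. of_real (Re (z i)) * p z)"
proof -
  assume p: "poly_fun p"
  have "poly_fun (\<lambda>z. (1/2) * (z i * p z + cnj (z i) * p z))"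
    using p by (intro poly_fun_scale poly_fun.intros)
  also have "(\<lambda>z. (1/2) * (z i * p z + cnj (z i) * p z)) = (\<lambda>z. of_real (Re (z i)) * p z)"
    by (auto simp: fun_eq_iff complex_add_cnj simp flip: distrib_right)
  finally show ?thesis .
qed

lemma poly_fun_Im: "poly_fun p \<Longrightarrow> poly_fun (\<lambda>z. of_real (Im (z i)) * p z)"
proof -
  assume p: "poly_fun p"
  have "poly_fun (\<lambda>z. (1 / (2 * \<i>)) * (z i * p z - cnj (z i) * p z))"
    using p by (intro poly_fun_scale poly_fun_diff poly_fun.intros)
  also have "(\<lambda>z. (1 / (2 * \<i>)) * (z i * p z - cnj (z i) * p z)) = (\<lambda>z. of_real (Im (z i)) * p z)"
  proof
    fix z :: cseq
    have "(1 / (2 * \<i>)) * (z i - cnj (z i)) = of_real (Im (z i))" by (simp add: complex_eq_iff)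
    thus "(1 / (2 * \<i>)) * (z i * p z - cnj (z i) * p z) = of_real (Im (z i)) * p z"
      by (metis left_diff_distrib mult.assoc)
  qed
  finally show ?thesis .
qed

lemma poly_fun_cont: "poly_fun p \<Longrightarrow> continuous_on UNIV p"
  by (induction rule: poly_fun.induct)
    (auto intro!: continuous_intros continuous_on_product_coordinates)

lemma has_vector_derivative_cnj:
  "(f has_vector_derivative f') F \<Longrightarrow> ((\<lambda>x. cnj (f x)) has_vector_derivative cnj f') F"
  by (rule bounded_linear.has_vector_derivative[OF bounded_linear_cnj])

text \<open>A complex direction \<open>d\<close> treats the derivatives in \<open>x\<close>
  (\<open>d = 1\<close>) and in \<open>y\<close> (\<open>d = \<i>\<close>) together.\<close>

lemma poly_fun_deriv:
  assumes "poly_fun p"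
  shows "\<exists>q. poly_fun q \<and> (\<forall>z. ((\<lambda>h. p (z(i := z i + d * of_real h))) has_vector_derivative q z) (at 0))"
  using assms
proof induction
  case (const e)
  show ?case by (rule exI[of _ "\<lambda>z. 0"]) (auto intro: poly_fun.const)
next
  case (add p1 p2)
  then obtain q1 q2 where "poly_fun q1" "poly_fun q2"
    "\<And>z. ((\<lambda>h. p1 (z(i := z i + d * of_real h))) has_vector_derivative q1 z) (at 0)"
    "\<And>z. ((\<lambda>h. p2 (z(i := z i + d * of_real h))) has_vector_derivative q2 z) (at 0)" by blast
  thus ?case
    by (intro exI[of _ "\<lambda>z. q1 z + q2 z"] conjI poly_fun.add allI has_vector_derivative_add)
next
  case (mult_coord p j)
  then obtain q where q: "poly_fun q"
    "\<And>z. ((\<lambda>h. p (z(i := z i + d * of_real h))) has_vector_derivative q z) (at 0)" by blast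
  have "((\<lambda>h. (z(i := z i + d * of_real h)) j) has_vector_derivative (if j = i then d else 0)) (at 0)" for z
    by (auto intro!: derivative_eq_intros simp: has_vector_derivative_def scaleR_conv_of_real mult.commute)
  from has_vector_derivative_mult[OF this q(2)]
  have "((\<lambda>h. (z(i := z i + d * of_real h)) j * p (z(i := z i + d * of_real h))) has_vector_derivative
      z j * q z + (if j = i then d else 0) * p z) (at 0)" for z by simp
  moreover have "poly_fun (\<lambda>z. z j * q z + (if j = i then d else 0) * p z)"
    by (intro poly_fun.intros q poly_fun_scale mult_coord)
  ultimately show ?case by blast
next
  case (mult_cnj p j)
  then obtain q where q: "poly_fun q"
    "\<And>z. ((\<lambda>h. p (z(i := z i + d * of_real h))) has_vector_derivative q z) (at 0)" by blast
  have "((\<lambda>h. (z(i := z i + d * of_real h)) j) has_vector_derivative (if j = i then d else 0)) (at 0)" for z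
    by (auto intro!: derivative_eq_intros simp: has_vector_derivative_def scaleR_conv_of_real mult.commute)
  from has_vector_derivative_mult[OF has_vector_derivative_cnj[OF this] q(2)]
  have "((\<lambda>h. cnj ((z(i := z i + d * of_real h)) j) * p (z(i := z i + d * of_real h))) has_vector_derivative
      cnj (z j) * q z + cnj (if j = i then d else 0) * p z) (at 0)" for z by simp
  moreover have "poly_fun (\<lambda>z. cnj (z j) * q z + cnj (if j = i then d else 0) * p z)"
    by (intro poly_fun.intros q poly_fun_scale mult_cnj)
  ultimately show ?case by blast
qed

lemma poly_fun_cylinder:
  assumes "poly_fun p"
  shows "\<exists>n. \<forall>z w. (\<forall>i<n. z i = w i) \<longrightarrow> p z = p w"
  using assms
proof induction
  case (add p q)
  then obtain m n where m: "\<And>z w. \<forall>i<m. z i = w i \<Longrightarrow> p z = p w"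
    and n: "\<And>z w. \<forall>i<n. z i = w i \<Longrightarrow> q z = q w" by blast
  show ?case
    by (intro exI[of _ "max m n"] allI impI arg_cong2[where f = "(+)"] m n) auto
next
  case (mult_coord p i)
  then obtain n where "\<forall>z w. (\<forall>i<n. z i = w i) \<longrightarrow> p z = p w" by blast
  thus ?case by (intro exI[of _ "max n (Suc i)"]) (auto simp: less_max_iff_disj)
next
  case (mult_cnj p i)
  then obtain n where "\<forall>z w. (\<forall>i<n. z i = w i) \<longrightarrow> p z = p w" by blast
  thus ?case by (intro exI[of _ "max n (Suc i)"]) (auto simp: less_max_iff_disj)
qed auto

subsection \<open>Complex Hermite polynomials\<close>

text \<open>\<open>herm c m n\<close> is \<open>R\<^sup>n z\<^sup>m\<close> for the raising operator \<open>R = c \<cdot> cnj z - \<partial>\<close>.\<close>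

fun herm :: "real \<Rightarrow> nat \<Rightarrow> nat \<Rightarrow> complex \<Rightarrow> complex" where
  "herm c m 0 z = z ^ m"
| "herm c m (Suc n) z = of_real c * cnj z * herm c m n z - of_nat m * herm c (m - 1) n z"

text \<open>The commutator of \<open>z\<close> with the raising operator \<open>R\<close> is 1,
  hence z R^n = R^n z + n R^(n-1).\<close>

lemma herm_mult_coord: "z * herm c m n z = herm c (Suc m) n z + of_nat n * herm c m (n - 1) z"
proof (induction n arbitrary: m rule: less_induct)
  case (less n)
  show ?case
  proof (cases n)
    case (Suc k)
    have k: "z * herm c m k z = herm c (Suc m) k z + of_nat k * herm c m (k - 1) z" for m
      using less.IH[of k] Suc by simp
    have m: "of_nat m * (z * herm c (m - 1) k z) = of_nat m * (herm c m k z + of_nat k * herm c (m - 1) (k - 1) z)"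
    proof (cases m)
      case (Suc l)
      thus ?thesis using k[of l] by (simp del: herm.simps)
    qed simp
    \<comment> \<open>The recursion for \<open>herm\<close> read backwards; the factor
      \<open>of_nat k\<close> covers \<open>k = 0\<close>, where there is nothing to unfold.\<close>
    have kk: "of_nat k * herm c m k z
        = of_nat k * (of_real c * cnj z * herm c m (k - 1) z - of_nat m * herm c (m - 1) (k - 1) z)"
      by (cases k) auto
    have "z * herm c m (Suc k) z = of_real c * cnj z * (z * herm c m k z) - of_nat m * (z * herm c (m - 1) k z)"
      by (simp add: algebra_simps)
    also have "\<dots> = of_real c * cnj z * herm c (Suc m) k z - of_nat m * herm c m k z
        + of_nat k * (of_real c * cnj z * herm c m (k - 1) z - of_nat m * herm c (m - 1) (k - 1) z)"
      unfolding m unfolding k by (simp add: algebra_simps)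
    also have "\<dots> = herm c (Suc m) (Suc k) z + of_nat (Suc k) * herm c m k z"
      unfolding kk[symmetric] by (simp add: algebra_simps)
    finally show ?thesis using Suc by simp
  qed simp
qed

text \<open>The derivative in direction \<open>d\<close> is \<open>d\<close> times the holomorphic
  plus \<open>cnj d\<close> times the antiholomorphic derivative. The former commutes with
  \<open>R\<close> and acts on \<open>z ^ m\<close>; the latter has commutator \<open>c\<close> with
  \<open>R\<close> and kills \<open>z ^ m\<close>.\<close>

lemma herm_has_vector_derivative:
  "((\<lambda>h. herm c m n (z + d * of_real h)) has_vector_derivative
     d * (of_nat m * herm c (m - 1) n z) + cnj d * (of_real c * of_nat n * herm c m (n - 1) z)) (at 0)"
proof (induction n arbitrary: m)
  case 0
  have "((\<lambda>h. z + d * of_real h) has_vector_derivative d) (at 0)"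
    by (auto intro!: derivative_eq_intros simp: has_vector_derivative_def scaleR_conv_of_real mult.commute)
  moreover have "((\<lambda>w. w ^ m) has_field_derivative of_nat m * z ^ (m - 1)) (at (z + d * of_real 0))"
    by (auto intro!: derivative_eq_intros)
  ultimately show ?case
    using field_vector_diff_chain_at by (fastforce simp: o_def mult_ac)
next
  case (Suc n)
  have cn: "((\<lambda>h. cnj (z + d * of_real h)) has_vector_derivative cnj d) (at 0)"
    by (auto intro!: derivative_eq_intros simp: has_vector_derivative_def scaleR_conv_of_real mult.commute)
  let ?D = "\<lambda>m. d * (of_nat m * herm c (m - 1) n z) + cnj d * (of_real c * of_nat n * herm c m (n - 1) z)"
  have "((\<lambda>h. of_real c * (cnj (z + d * of_real h) * herm c m n (z + d * of_real h))
        - of_nat m * herm c (m - 1) n (z + d * of_real h)) has_vector_derivative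
      of_real c * (cnj z * ?D m + cnj d * herm c m n z) - of_nat m * ?D (m - 1)) (at 0)"
  proof (intro has_vector_derivative_diff has_vector_derivative_mult_right)
    show "((\<lambda>h. cnj (z + d * of_real h) * herm c m n (z + d * of_real h)) has_vector_derivative
        cnj z * ?D m + cnj d * herm c m n z) (at 0)"
      using has_vector_derivative_mult[OF cn Suc.IH[of m]] by simp
  qed (rule Suc.IH)
  moreover have "of_real c * (cnj z * ?D m + cnj d * herm c m n z) - of_nat m * ?D (m - 1)
     = d * (of_nat m * herm c (m - 1) (Suc n) z) + cnj d * (of_real c * of_nat (Suc n) * herm c m n z)"
  proof -
    have n: "of_nat n * herm c m n z = of_nat n * (of_real c * cnj z * herm c m (n - 1) z - of_nat m * herm c (m - 1) (n - 1) z)"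
      by (cases n) auto
    have "of_real c * (cnj z * ?D m + cnj d * herm c m n z) - of_nat m * ?D (m - 1)
      = d * (of_nat m * (of_real c * cnj z * herm c (m - 1) n z - of_nat (m - 1) * herm c (m - 1 - 1) n z))
        + cnj d * of_real c * (herm c m n z
          + of_nat n * (of_real c * cnj z * herm c m (n - 1) z - of_nat m * herm c (m - 1) (n - 1) z))"
      by (simp add: algebra_simps)
    thus ?thesis unfolding n[symmetric] by (simp add: algebra_simps)
  qed
  ultimately show ?case by (simp add: mult_ac)
qed

text \<open>Multisets serve as finitely supported degrees, \<open>A\<close> holomorphic and
  \<open>B\<close> antiholomorphic. Coordinates outside the support would contribute
  \<open>herm (c i) 0 0 = 1\<close>.\<close>

definition hermite :: "(nat \<Rightarrow> real) \<Rightarrow> nat multiset \<Rightarrow> nat multiset \<Rightarrow> cseq \<Rightarrow> complex" where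
  "hermite c A B z = (\<Prod>i\<in>set_mset (A + B). herm (c i) (count A i) (count B i) (z i))"

lemma hermite_eq_prod:
  assumes "finite S" "set_mset (A + B) \<subseteq> S"
  shows "hermite c A B z = (\<Prod>i\<in>S. herm (c i) (count A i) (count B i) (z i))"
  unfolding hermite_def
  by (rule prod.mono_neutral_left) (use assms in \<open>auto simp: not_in_iff\<close>)

lemma hermite_split:
  assumes "finite S" "set_mset A \<subseteq> S" "set_mset B \<subseteq> S" "i \<in> S"
  shows "hermite c A B z = herm (c i) (count A i) (count B i) (z i) *
    (\<Prod>j\<in>S - {i}. herm (c j) (count A j) (count B j) (z j))"
  using assms by (subst hermite_eq_prod[of S]) (auto simp: prod.remove)

lemma hermite_empty[simp]: "hermite c {#} {#} z = 1"
  by (simp add: hermite_def)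

text \<open>If \<open>i\<close> is not in \<open>A\<close>, the difference \<open>A - {#i#}\<close>
  is not a lowered degree, but its coefficient \<open>count A i\<close> is then 0. The same holds
  wherever a degree is lowered below.\<close>

lemma hermite_add_right:
  "hermite c A (add_mset i B) z
    = of_real (c i) * cnj (z i) * hermite c A B z - of_nat (count A i) * hermite c (A - {#i#}) B z"
proof -
  define S where "S = insert i (set_mset A \<union> set_mset B)"
  have S: "finite S" "i \<in> S" by (auto simp: S_def)
  have 1: "hermite c A (add_mset i B) z = herm (c i) (count A i) (Suc (count B i)) (z i) *
    (\<Prod>j\<in>S - {i}. herm (c j) (count A j) (count B j) (z j))"
    by (subst hermite_split[of S _ _ i]) (auto simp: S_def intro!: prod.cong)
  have 2: "hermite c (A - {#i#}) B z = herm (c i) (count A i - 1) (count B i) (z i) *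
    (\<Prod>j\<in>S - {i}. herm (c j) (count A j) (count B j) (z j))"
    by (subst hermite_split[of S _ _ i]) (auto simp: S_def dest: in_diffD intro!: prod.cong)
  have 3: "hermite c A B z = herm (c i) (count A i) (count B i) (z i) *
    (\<Prod>j\<in>S - {i}. herm (c j) (count A j) (count B j) (z j))"
    by (subst hermite_split[of S _ _ i]) (auto simp: S_def)
  show ?thesis unfolding 1 2 3 by (simp add: algebra_simps)
qed

lemma hermite_mult_coord:
  "z i * hermite c A B z = hermite c (add_mset i A) B z + of_nat (count B i) * hermite c A (B - {#i#}) z"
proof -
  define S where "S = insert i (set_mset A \<union> set_mset B)"
  have S: "finite S" "i \<in> S" by (auto simp: S_def)
  have 1: "hermite c (add_mset i A) B z = herm (c i) (Suc (count A i)) (count B i) (z i) *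
    (\<Prod>j\<in>S - {i}. herm (c j) (count A j) (count B j) (z j))"
    by (subst hermite_split[of S _ _ i]) (auto simp: S_def intro!: prod.cong)
  have 2: "hermite c A (B - {#i#}) z = herm (c i) (count A i) (count B i - 1) (z i) *
    (\<Prod>j\<in>S - {i}. herm (c j) (count A j) (count B j) (z j))"
    by (subst hermite_split[of S _ _ i]) (auto simp: S_def dest: in_diffD intro!: prod.cong)
  have 3: "hermite c A B z = herm (c i) (count A i) (count B i) (z i) *
    (\<Prod>j\<in>S - {i}. herm (c j) (count A j) (count B j) (z j))"
    by (subst hermite_split[of S _ _ i]) (auto simp: S_def)
  show ?thesis
    unfolding 1 2 3 mult.assoc[symmetric] herm_mult_coord by (simp add: algebra_simps)
qed

lemma hermite_has_vector_derivative:
  "((\<lambda>h. hermite c A B (z(i := z i + d * of_real h))) has_vector_derivative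
     d * (of_nat (count A i) * hermite c (A - {#i#}) B z)
     + cnj d * (of_real (c i) * of_nat (count B i) * hermite c A (B - {#i#}) z)) (at 0)"
proof -
  define S where "S = insert i (set_mset A \<union> set_mset B)"
  have S: "finite S" "i \<in> S" by (auto simp: S_def)
  let ?r = "\<Prod>j\<in>S - {i}. herm (c j) (count A j) (count B j) (z j)"
  have 1: "hermite c A B (z(i := z i + d * of_real h))
      = herm (c i) (count A i) (count B i) (z i + d * of_real h) * ?r" for h
    by (subst hermite_split[of S _ _ i]) (auto simp: S_def intro!: prod.cong)
  have 2: "hermite c A (B - {#i#}) z = herm (c i) (count A i) (count B i - 1) (z i) * ?r"
    by (subst hermite_split[of S _ _ i]) (auto simp: S_def dest: in_diffD intro!: prod.cong)
  have 3: "hermite c (A - {#i#}) B z = herm (c i) (count A i - 1) (count B i) (z i) * ?r"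
    by (subst hermite_split[of S _ _ i]) (auto simp: S_def dest: in_diffD intro!: prod.cong)
  show ?thesis unfolding 1 2 3
    using has_vector_derivative_mult_left[OF herm_has_vector_derivative[of "c i" "count A i" "count B i" "z i" d], of ?r]
    by (simp add: algebra_simps)
qed

lemma D_x_hermite:
  "D_x i (hermite c A B) z = of_nat (count A i) * hermite c (A - {#i#}) B z
     + of_real (c i) * of_nat (count B i) * hermite c A (B - {#i#}) z"
  unfolding D_x_def using hermite_has_vector_derivative[of c A B z i 1]
  by (intro vector_derivative_at) simp

lemma D_y_hermite:
  "D_y i (hermite c A B) z = \<i> * (of_nat (count A i) * hermite c (A - {#i#}) B z)
     - \<i> * (of_real (c i) * of_nat (count B i) * hermite c A (B - {#i#}) z)"
  unfolding D_y_def using hermite_has_vector_derivative[of c A B z i \<i>]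
  by (intro vector_derivative_at) simp

lemma poly_fun_hermite: "poly_fun (hermite c A B)"
proof (induction B arbitrary: A)
  case empty
  show ?case
  proof (induction A)
    case empty
    have "hermite c {#} {#} = (\<lambda>z. 1)" by (rule ext) simp
    thus ?case by (simp add: poly_fun.const)
  next
    case (add i A)
    have "hermite c (add_mset i A) {#} = (\<lambda>z. z i * hermite c A {#} z)"
      by (rule ext) (simp add: hermite_mult_coord)
    thus ?case using add by (simp add: poly_fun.mult_coord)
  qed
next
  case (add i B)
  have "hermite c A (add_mset i B)
      = (\<lambda>z. of_real (c i) * (cnj (z i) * hermite c A B z) - of_nat (count A i) * hermite c (A - {#i#}) B z)"
    by (rule ext) (simp add: hermite_add_right mult_ac)
  thus ?case using add by (simp add: poly_fun_diff poly_fun_scale poly_fun.mult_cnj)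
qed

subsection \<open>The Gaussian measure\<close>

abbreviation gauss :: "real \<Rightarrow> real measure" where
  "gauss \<sigma> \<equiv> density lborel (\<lambda>x. ennreal (normal_density 0 \<sigma> x))"

text \<open>Completing the square makes the density times \<open>exp (l * x)\<close> a multiple of a
  shifted normal density; the two signs of \<open>l\<close> together dominate the absolute
  value.\<close>

lemma gauss_exp_integrable:
  assumes "\<sigma> > 0" shows "integrable (gauss \<sigma>) (\<lambda>x. exp (k * \<bar>x\<bar>))"
proof -
  have shift: "normal_density 0 \<sigma> x * exp (l * x) = exp (l\<^sup>2 * \<sigma>\<^sup>2 / 2) * normal_density (l * \<sigma>\<^sup>2) \<sigma> x" for l x
  proof -
    have "- (x\<^sup>2) / (2 * \<sigma>\<^sup>2) + l * x = l\<^sup>2 * \<sigma>\<^sup>2 / 2 + (- ((x - l * \<sigma>\<^sup>2)\<^sup>2) / (2 * \<sigma>\<^sup>2))"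
      using assms by (simp add: field_simps power2_eq_square)
    thus ?thesis by (simp add: normal_density_def flip: exp_add)
  qed
  have i: "integrable (gauss \<sigma>) (\<lambda>x. exp (l * x))" for l
    using assms by (subst integrable_density) (auto simp: shift)
  show ?thesis
  proof (rule Bochner_Integration.integrable_bound)
    show "integrable (gauss \<sigma>) (\<lambda>x. exp (k * x) + exp ((- k) * x))"
      using i by (intro Bochner_Integration.integrable_add)
    show "AE x in gauss \<sigma>. norm (exp (k * \<bar>x\<bar>)) \<le> norm (exp (k * x) + exp ((- k) * x))"
    proof (intro AE_I2)
      fix x :: real
      have "exp (k * \<bar>x\<bar>) \<le> exp (k * x) + exp ((- k) * x)" by (simp add: abs_if)
      thus "norm (exp (k * \<bar>x\<bar>)) \<le> norm (exp (k * x) + exp ((- k) * x))" by simp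
    qed
  qed measurable
qed

lemma gauss_square:
  assumes "\<sigma> > 0"
  shows "integrable (gauss \<sigma>) (\<lambda>x. x\<^sup>2)" "(\<integral>x. x\<^sup>2 \<partial>gauss \<sigma>) = \<sigma>\<^sup>2"
proof -
  have "has_bochner_integral lborel (\<lambda>x. normal_density 0 \<sigma> x * (x - 0) ^ (2 * 1)) (fact (2 * 1) / ((2 / \<sigma>\<^sup>2) ^ 1 * fact 1))"
    by (rule normal_moment_even[OF assms])
  hence *: "has_bochner_integral lborel (\<lambda>x. normal_density 0 \<sigma> x * x\<^sup>2) (\<sigma>\<^sup>2)" by (simp add: numeral_2_eq_2)
  show "integrable (gauss \<sigma>) (\<lambda>x. x\<^sup>2)"
    using * by (subst integrable_density) (auto simp: has_bochner_integral_iff)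
  show "(\<integral>x. x\<^sup>2 \<partial>gauss \<sigma>) = \<sigma>\<^sup>2"
    using * by (subst integral_density) (auto simp: has_bochner_integral_iff)
qed

lemma Complex_conv_of_real: "(\<lambda>(x, y). Complex x y) = (\<lambda>p. of_real (fst p) + \<i> * of_real (snd p))"
  by (auto simp: fun_eq_iff complex_eq_iff)

lemma Complex_measurable[measurable]:
  "(\<lambda>(x, y). Complex x y) \<in> borel_measurable (gauss \<sigma> \<Otimes>\<^sub>M gauss \<tau>)"
  unfolding Complex_conv_of_real by measurable

lemma prob_space_gauss: "\<sigma> > 0 \<Longrightarrow> prob_space (gauss \<sigma>)"
  by (rule prob_space_normal_density)

lemma prob_space_complex_gauss:
  assumes "\<sigma> > 0" shows "prob_space (complex_gauss \<sigma>)"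
proof -
  interpret prob_space "gauss \<sigma>" by (rule prob_space_gauss[OF assms])
  interpret pair_prob_space "gauss \<sigma>" "gauss \<sigma>" ..
  show ?thesis unfolding complex_gauss_def
    by (rule prob_space_distr) measurable
qed

lemma sets_complex_gauss[simp, measurable_cong]: "sets (complex_gauss \<sigma>) = sets borel"
  by (simp add: complex_gauss_def)

lemma space_complex_gauss[simp]: "space (complex_gauss \<sigma>) = UNIV"
  by (simp add: complex_gauss_def)

lemma nn_integral_complex_gauss:
  assumes "\<sigma> > 0" "f \<in> borel_measurable borel"
  shows "(\<integral>\<^sup>+w. f w \<partial>complex_gauss \<sigma>) = (\<integral>\<^sup>+y. \<integral>\<^sup>+x. f (Complex x y) \<partial>gauss \<sigma> \<partial>gauss \<sigma>)"
proof -
  interpret prob_space "gauss \<sigma>" by (rule prob_space_gauss) fact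
  interpret pair_prob_space "gauss \<sigma>" "gauss \<sigma>" ..
  have "(\<integral>\<^sup>+w. f w \<partial>complex_gauss \<sigma>) = (\<integral>\<^sup>+p. f (case p of (x, y) \<Rightarrow> Complex x y) \<partial>(gauss \<sigma> \<Otimes>\<^sub>M gauss \<sigma>))"
    unfolding complex_gauss_def using assms by (subst nn_integral_distr) auto
  also have "\<dots> = (\<integral>\<^sup>+y. \<integral>\<^sup>+x. f (case (x, y) of (x, y) \<Rightarrow> Complex x y) \<partial>gauss \<sigma> \<partial>gauss \<sigma>)"
    by (rule nn_integral_snd[symmetric])
      (rule measurable_compose[OF Complex_measurable assms(2)])
  finally show ?thesis by simp
qed

lemma complex_gauss_exp_finite:
  assumes "\<sigma> > 0"
  shows "(\<integral>\<^sup>+w. ennreal (exp (k * (\<bar>Re w\<bar> + \<bar>Im w\<bar>))) \<partial>complex_gauss \<sigma>) < \<infinity>"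
proof -
  have "(\<integral>\<^sup>+w. ennreal (exp (k * (\<bar>Re w\<bar> + \<bar>Im w\<bar>))) \<partial>complex_gauss \<sigma>)
      = (\<integral>\<^sup>+y. \<integral>\<^sup>+x. ennreal (exp (k * \<bar>y\<bar>)) * ennreal (exp (k * \<bar>x\<bar>)) \<partial>gauss \<sigma> \<partial>gauss \<sigma>)"
    by (subst nn_integral_complex_gauss[OF assms])
      (auto simp: distrib_left exp_add mult.commute simp flip: ennreal_mult)
  also have "\<dots> = (\<integral>\<^sup>+y. ennreal (exp (k * \<bar>y\<bar>)) \<partial>gauss \<sigma>) * (\<integral>\<^sup>+x. ennreal (exp (k * \<bar>x\<bar>)) \<partial>gauss \<sigma>)"
    by (simp add: nn_integral_cmult nn_integral_multc)
  also have "\<dots> = ennreal ((\<integral>x. exp (k * \<bar>x\<bar>) \<partial>gauss \<sigma>) * (\<integral>x. exp (k * \<bar>x\<bar>) \<partial>gauss \<sigma>))"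
    using gauss_exp_integrable[OF assms, of k] by (simp add: nn_integral_eq_integral ennreal_mult)
  finally show ?thesis by simp
qed

text \<open>The normal density has derivative -x/\<sigma>^2 times itself, and its decay beats
  exponential growth, so the boundary terms at both infinities vanish.\<close>

lemma gauss_ibp:
  fixes F F' :: "real \<Rightarrow> complex"
  assumes \<sigma>: "\<sigma> > 0" and k: "k > 0"
    and F: "\<And>x. (F has_vector_derivative F' x) (at x)" and F': "continuous_on UNIV F'"
    and bound: "\<And>x. cmod (F x) \<le> C * exp (k * \<bar>x\<bar>)" "\<And>x. cmod (F' x) \<le> C * exp (k * \<bar>x\<bar>)"
  shows "(\<integral>x. F' x \<partial>gauss \<sigma>) = (\<integral>x. of_real (x / \<sigma>\<^sup>2) * F x \<partial>gauss \<sigma>)"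
proof -
  define n where "n = normal_density 0 \<sigma>"
  have contF: "continuous_on UNIV F"
    using F by (auto intro: has_vector_derivative_continuous continuous_at_imp_continuous_on)
  have [measurable]: "F \<in> borel_measurable borel" "F' \<in> borel_measurable borel"
    using contF F' by (auto intro: borel_measurable_continuous_onI)
  have C: "C \<ge> 0" using order_trans[OF norm_ge_zero bound(1)[of 0]] by simp
  have n': "(n has_real_derivative (- (x / \<sigma>\<^sup>2) * n x)) (at x)" for x
    unfolding n_def normal_density_def using \<sigma>
    by (auto intro!: derivative_eq_intros simp: field_simps power2_eq_square)
  define G where "G = (\<lambda>x. n x *\<^sub>R F x)"
  define G' where "G' = (\<lambda>x. n x *\<^sub>R F' x - n x *\<^sub>R (of_real (x / \<sigma>\<^sup>2) * F x))"
  have G: "(G has_vector_derivative G' x) (at x)" for x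
  proof -
    have "(G has_vector_derivative n x *\<^sub>R F' x + (- (x / \<sigma>\<^sup>2) * n x) *\<^sub>R F x) (at x)"
      unfolding G_def by (rule has_vector_derivative_scaleR[OF n' F])
    thus ?thesis by (simp add: G'_def scaleR_conv_of_real mult_ac)
  qed
  have i1: "integrable (gauss \<sigma>) F'"
  proof (rule Bochner_Integration.integrable_bound)
    show "integrable (gauss \<sigma>) (\<lambda>x. C * exp (k * \<bar>x\<bar>))"
      using gauss_exp_integrable[OF \<sigma>] by simp
    show "AE x in gauss \<sigma>. norm (F' x) \<le> norm (C * exp (k * \<bar>x\<bar>))"
      using bound(2) C by (auto simp: abs_mult)
  qed simp
  \<comment> \<open>The extra factor is absorbed by
    \<open>\<bar>x\<bar> \<le> exp \<bar>x\<bar>\<close>, which raises the growth rate from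
    \<open>k\<close> to \<open>k + 1\<close>.\<close>
  have i2: "integrable (gauss \<sigma>) (\<lambda>x. of_real (x / \<sigma>\<^sup>2) * F x)"
  proof (rule Bochner_Integration.integrable_bound)
    show "integrable (gauss \<sigma>) (\<lambda>x. C / \<sigma>\<^sup>2 * exp ((k + 1) * \<bar>x\<bar>))"
      using gauss_exp_integrable[OF \<sigma>] by simp
    show "AE x in gauss \<sigma>. norm (of_real (x / \<sigma>\<^sup>2) * F x) \<le> norm (C / \<sigma>\<^sup>2 * exp ((k + 1) * \<bar>x\<bar>))"
    proof (intro AE_I2)
      fix x :: real
      have "\<bar>x\<bar> \<le> exp \<bar>x\<bar>" using exp_ge_add_one_self[of "\<bar>x\<bar>"] by linarith
      hence "\<bar>x\<bar> / \<sigma>\<^sup>2 * cmod (F x) \<le> exp \<bar>x\<bar> / \<sigma>\<^sup>2 * (C * exp (k * \<bar>x\<bar>))"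
        using bound(1) by (intro mult_mono divide_right_mono) auto
      also have "\<dots> = C / \<sigma>\<^sup>2 * exp ((k + 1) * \<bar>x\<bar>)" by (simp add: distrib_right exp_add)
      finally show "norm (of_real (x / \<sigma>\<^sup>2) * F x) \<le> norm (C / \<sigma>\<^sup>2 * exp ((k + 1) * \<bar>x\<bar>))"
        using C by (simp add: norm_mult norm_divide abs_mult norm_power)
    qed
  qed measurable
  have j: "integrable lborel (\<lambda>x. n x *\<^sub>R F' x)" "integrable lborel (\<lambda>x. n x *\<^sub>R (of_real (x / \<sigma>\<^sup>2) * F x))"
    using i1 i2 by (auto simp: integrable_density n_def)
  have nexp: "n x * (C * exp (k * \<bar>x\<bar>)) = C / sqrt (2 * pi * \<sigma>\<^sup>2) * exp (k * \<bar>x\<bar> - x\<^sup>2 / (2 * \<sigma>\<^sup>2))" for x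
    by (simp add: n_def normal_density_def flip: exp_add)
  have "((\<lambda>x. exp (k * \<bar>x\<bar> - x\<^sup>2 / (2 * \<sigma>\<^sup>2))) \<longlongrightarrow> 0) at_top"
    using \<sigma> k by real_asymp
  from tendsto_mult_right_zero[OF this]
  have lim_aux1: "((\<lambda>x. n x * (C * exp (k * \<bar>x\<bar>))) \<longlongrightarrow> 0) at_top" by (simp only: nexp)
  have "((\<lambda>x. exp (k * \<bar>x\<bar> - x\<^sup>2 / (2 * \<sigma>\<^sup>2))) \<longlongrightarrow> 0) at_bot"
    using \<sigma> k by real_asymp
  from tendsto_mult_right_zero[OF this]
  have lim_aux2: "((\<lambda>x. n x * (C * exp (k * \<bar>x\<bar>))) \<longlongrightarrow> 0) at_bot" by (simp only: nexp)
  have lim: "(G \<longlongrightarrow> 0) F" if "((\<lambda>x. n x * (C * exp (k * \<bar>x\<bar>))) \<longlongrightarrow> 0) F" for F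
  proof (rule Lim_null_comparison[OF always_eventually that], rule allI)
    fix x :: real
    show "norm (G x) \<le> n x * (C * exp (k * \<bar>x\<bar>))"
      using bound(1)[of x] by (simp add: G_def n_def mult_left_mono)
  qed
  have "(LBINT x=-\<infinity>..\<infinity>. G' x) = 0 - 0"
  proof (rule interval_integral_FTC_integrable[where F = G])
    show "isCont G' x" for x
      unfolding G'_def n_def normal_density_def using contF F' \<sigma>
      by (intro continuous_intros) (auto simp: continuous_on_eq_continuous_at)
    show "set_integrable lborel (einterval (-\<infinity>) \<infinity>) G'"
      using j by (simp add: set_integrable_def G'_def)
    show "((G \<circ> real_of_ereal) \<longlongrightarrow> 0) (at_right (-\<infinity>))" "((G \<circ> real_of_ereal) \<longlongrightarrow> 0) (at_left \<infinity>)"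
      using lim[OF lim_aux1] lim[OF lim_aux2] by (auto simp: ereal_tendsto_simps)
  qed (use G in auto)
  hence "(\<integral>x. G' x \<partial>lborel) = 0"
    by (simp add: interval_lebesgue_integral_def set_lebesgue_integral_def)
  hence eq: "(\<integral>x. n x *\<^sub>R F' x \<partial>lborel) = (\<integral>x. n x *\<^sub>R (of_real (x / \<sigma>\<^sup>2) * F x) \<partial>lborel)"
    using j by (simp add: G'_def)
  have conv: "(\<integral>x. H x \<partial>gauss \<sigma>) = (\<integral>x. n x *\<^sub>R H x \<partial>lborel)"
    if "H \<in> borel_measurable borel" for H :: "real \<Rightarrow> complex"
    unfolding n_def by (rule integral_density) (use that in auto)
  have "(\<integral>x. F' x \<partial>gauss \<sigma>) = (\<integral>x. n x *\<^sub>R F' x \<partial>lborel)"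
    by (rule conv) measurable
  also note eq
  also have "(\<integral>x. n x *\<^sub>R (of_real (x / \<sigma>\<^sup>2) * F x) \<partial>lborel) = (\<integral>x. of_real (x / \<sigma>\<^sup>2) * F x \<partial>gauss \<sigma>)"
    by (rule conv[symmetric]) measurable
  finally show ?thesis .
qed

locale gauss_seq =
  fixes r :: real and a :: "nat \<Rightarrow> real"
  assumes r: "r > 0" and a: "\<And>i. a i > 0" and a_summable: "summable a"
begin

definition \<sigma> :: "nat \<Rightarrow> real" where "\<sigma> i = r * a i"

text \<open>The coefficient of \<open>cnj (z i)\<close> in \<open>delta r a i\<close>, hence the
  parameter of the Hermite polynomials in coordinate \<open>i\<close>.\<close>

definition c :: "nat \<Rightarrow> real" where "c i = 1 / (2 * (\<sigma> i)\<^sup>2)"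

text \<open>The measure before restriction to \<open>ell2\<close>. Its sigma-algebra is the Borel
  algebra of the product topology, so continuous functions of a sequence are measurable, and single
  coordinates can be integrated out.\<close>

definition Q :: "cseq measure" where "Q = (\<Pi>\<^sub>M i\<in>UNIV. complex_gauss (\<sigma> i))"

lemma \<sigma>_pos: "\<sigma> i > 0" using r a by (simp add: \<sigma>_def)

lemma c_pos: "c i > 0" using \<sigma>_pos[of i] by (simp add: c_def)

lemma prob_space_coord: "prob_space (complex_gauss (\<sigma> i))"
  by (rule prob_space_complex_gauss[OF \<sigma>_pos])

lemma sets_Q: "sets Q = sets borel"
proof -
  have "sets Q = sets (\<Pi>\<^sub>M i\<in>(UNIV :: nat set). (borel :: complex measure))"
    unfolding Q_def by (intro sets_PiM_cong) simp_all
  also have "\<dots> = sets borel" by (rule sets_PiM_equal_borel)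
  finally show ?thesis .
qed

lemma space_Q[simp]: "space Q = UNIV"
  by (simp add: Q_def space_PiM)

lemma measurable_Q_cont: "continuous_on UNIV f \<Longrightarrow> f \<in> borel_measurable Q"
  using measurable_cong_sets[OF sets_Q refl] borel_measurable_continuous_onI by blast

lemma coord_measurable[measurable]: "(\<lambda>z. z i) \<in> borel_measurable Q"
  by (rule measurable_Q_cont) (rule continuous_on_product_coordinates)

sublocale Q: prob_space Q
  unfolding Q_def by (intro prob_space_PiM prob_space_coord)

lemma update_measurable[measurable]:
  "(\<lambda>(w, z). z(i := w)) \<in> (complex_gauss (\<sigma> i) \<Otimes>\<^sub>M Q) \<rightarrow>\<^sub>M Q"
proof -
  have "(\<lambda>p. (snd p)(i := fst p)) \<in> (complex_gauss (\<sigma> i) \<Otimes>\<^sub>M Q) \<rightarrow>\<^sub>M (\<Pi>\<^sub>M i\<in>UNIV. complex_gauss (\<sigma> i))"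
  proof (rule measurable_PiM_single')
    fix j :: nat
    show "(\<lambda>p. ((snd p)(i := fst p)) j) \<in> (complex_gauss (\<sigma> i) \<Otimes>\<^sub>M Q) \<rightarrow>\<^sub>M complex_gauss (\<sigma> j)"
      by (cases "i = j") (auto simp: measurable_cong_sets[OF refl sets_complex_gauss])
  qed auto
  thus ?thesis by (simp add: Q_def case_prod_unfold)
qed

text \<open>Redrawing one coordinate independently does not change the distribution. In this form
  Fubini's theorem keeps \<open>z\<close> a full sequence and never splits the index set.\<close>

lemma Q_split: "distr (complex_gauss (\<sigma> i) \<Otimes>\<^sub>M Q) Q (\<lambda>(w, z). z(i := w)) = Q"
  using distr_pair_PiM_eq_PiM[of UNIV "\<lambda>i. complex_gauss (\<sigma> i)" i] prob_space_coord
  by (simp add: Q_def)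

lemma nn_integral_Q_split:
  assumes f: "f \<in> borel_measurable Q"
  shows "(\<integral>\<^sup>+z. f z \<partial>Q) = (\<integral>\<^sup>+z. \<integral>\<^sup>+w. f (z(i := w)) \<partial>complex_gauss (\<sigma> i) \<partial>Q)"
proof -
  interpret G: prob_space "complex_gauss (\<sigma> i)" by (rule prob_space_coord)
  interpret pair_prob_space "complex_gauss (\<sigma> i)" Q ..
  have "(\<integral>\<^sup>+z. f z \<partial>Q) = (\<integral>\<^sup>+p. f (case p of (w, z) \<Rightarrow> z(i := w)) \<partial>(complex_gauss (\<sigma> i) \<Otimes>\<^sub>M Q))"
    by (subst Q_split[of i, symmetric], subst nn_integral_distr) (use f in auto)
  also have "\<dots> = (\<integral>\<^sup>+z. \<integral>\<^sup>+w. f (case (w, z) of (w, z) \<Rightarrow> z(i := w)) \<partial>complex_gauss (\<sigma> i) \<partial>Q)"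
    by (rule nn_integral_snd[symmetric]) (rule measurable_compose[OF update_measurable f])
  finally show ?thesis by simp
qed

lemma integral_Q_split:
  fixes f :: "cseq \<Rightarrow> complex"
  assumes f: "integrable Q f"
  shows "(\<integral>z. f z \<partial>Q) = (\<integral>z. \<integral>w. f (z(i := w)) \<partial>complex_gauss (\<sigma> i) \<partial>Q)"
proof -
  interpret G: prob_space "complex_gauss (\<sigma> i)" by (rule prob_space_coord)
  interpret pair_prob_space "complex_gauss (\<sigma> i)" Q ..
  have "integrable (complex_gauss (\<sigma> i) \<Otimes>\<^sub>M Q) (\<lambda>p. f (case p of (w, z) \<Rightarrow> z(i := w)))"
    using f by (subst (asm) Q_split[of i, symmetric], subst (asm) integrable_distr_eq) auto
  hence i: "integrable (complex_gauss (\<sigma> i) \<Otimes>\<^sub>M Q) (\<lambda>(w, z). f (z(i := w)))"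
    by (simp add: case_prod_unfold)
  have "(\<integral>z. f z \<partial>Q) = (\<integral>p. f (case p of (w, z) \<Rightarrow> z(i := w)) \<partial>(complex_gauss (\<sigma> i) \<Otimes>\<^sub>M Q))"
    by (subst Q_split[of i, symmetric], subst integral_distr) (use f in auto)
  also have "\<dots> = (\<integral>p. (case p of (w, z) \<Rightarrow> f (z(i := w))) \<partial>(complex_gauss (\<sigma> i) \<Otimes>\<^sub>M Q))"
    by (simp add: case_prod_unfold)
  also have "\<dots> = (\<integral>z. \<integral>w. f (z(i := w)) \<partial>complex_gauss (\<sigma> i) \<partial>Q)"
    by (rule integral_snd[OF i, symmetric])
  finally show ?thesis .
qed

text \<open>The expectation of the squared norm is the sum of
  \<open>2 * r\<^sup>2 * (a i)\<^sup>2\<close>, which is finite, so the squared norm is finite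
  almost surely.\<close>

lemma AE_ell2: "ell2 \<in> sets Q" "AE z in Q. z \<in> ell2"
proof -
  let ?s = "\<lambda>z. \<Sum>i. ennreal ((cmod (z i))\<^sup>2)"
  have iff: "z \<in> ell2 \<longleftrightarrow> ?s z \<noteq> \<infinity>" for z
  proof
    assume "z \<in> ell2"
    hence "?s z = ennreal (\<Sum>i. (cmod (z i))\<^sup>2)"
      unfolding ell2_def by (intro suminf_ennreal2) auto
    thus "?s z \<noteq> \<infinity>" by simp
  next
    assume "?s z \<noteq> \<infinity>"
    thus "z \<in> ell2" unfolding ell2_def by (auto intro: summable_suminf_not_top)
  qed
  have "ell2 = {z \<in> space Q. ?s z \<noteq> \<infinity>}" using iff by auto
  also have "\<dots> \<in> sets Q" by measurable
  finally show "ell2 \<in> sets Q" .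
  have coord: "(\<integral>\<^sup>+z. ennreal ((cmod (z i))\<^sup>2) \<partial>Q) = ennreal (2 * r\<^sup>2 * (a i)\<^sup>2)" for i
  proof -
    interpret prob_space "gauss (\<sigma> i)" by (rule prob_space_gauss[OF \<sigma>_pos])
    have "(\<integral>\<^sup>+z. ennreal ((cmod (z i))\<^sup>2) \<partial>Q) = (\<integral>\<^sup>+z. \<integral>\<^sup>+w. ennreal ((cmod w)\<^sup>2) \<partial>complex_gauss (\<sigma> i) \<partial>Q)"
      by (subst nn_integral_Q_split[of _ i]) auto
    also have "\<dots> = (\<integral>\<^sup>+w. ennreal ((cmod w)\<^sup>2) \<partial>complex_gauss (\<sigma> i))"
      by (simp add: Q.emeasure_space_1[simplified])
    also have "\<dots> = (\<integral>\<^sup>+y. \<integral>\<^sup>+x. ennreal (x\<^sup>2) + ennreal (y\<^sup>2) \<partial>gauss (\<sigma> i) \<partial>gauss (\<sigma> i))"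
      by (subst nn_integral_complex_gauss[OF \<sigma>_pos]) (auto simp: cmod_def simp flip: ennreal_plus)
    also have "\<dots> = ennreal ((\<sigma> i)\<^sup>2) + ennreal ((\<sigma> i)\<^sup>2)"
      using gauss_square[OF \<sigma>_pos[of i]] emeasure_space_1
      by (simp add: nn_integral_add nn_integral_eq_integral del: space_density)
    also have "\<dots> = ennreal (2 * r\<^sup>2 * (a i)\<^sup>2)" by (simp add: \<sigma>_def power_mult_distrib flip: ennreal_plus)
    finally show ?thesis .
  qed
  \<comment> \<open>Eventually \<open>a i < 1\<close>, and then the square is below
    \<open>a i\<close>.\<close>
  have "summable (\<lambda>i. (a i)\<^sup>2)"
  proof (rule summable_comparison_test_ev[OF _ a_summable])
    have "a \<longlonglongrightarrow> 0" by (rule summable_LIMSEQ_zero[OF a_summable])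
    hence "eventually (\<lambda>i. a i < 1) sequentially" by (rule order_tendstoD) simp
    thus "eventually (\<lambda>i. norm ((a i)\<^sup>2) \<le> a i) sequentially"
      by (rule eventually_mono) (use a in \<open>auto simp: power2_eq_square intro!: mult_left_le less_imp_le\<close>)
  qed
  hence s: "summable (\<lambda>i. 2 * r\<^sup>2 * (a i)\<^sup>2)" by (rule summable_mult)
  have "(\<integral>\<^sup>+z. ?s z \<partial>Q) = (\<Sum>i. ennreal (2 * r\<^sup>2 * (a i)\<^sup>2))"
    by (subst nn_integral_suminf) (auto simp: coord)
  also have "\<dots> < \<infinity>" by (subst suminf_ennreal2[OF _ s]) auto
  finally have "AE z in Q. ?s z \<noteq> \<infinity>" by (intro nn_integral_PInf_AE) auto
  thus "AE z in Q. z \<in> ell2" by (simp add: iff)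
qed

lemma P_eq: "P r a = restrict_space Q ell2"
  by (simp add: P_def Q_def \<sigma>_def)

lemma space_P[simp]: "space (P r a) = ell2"
  by (simp add: P_eq space_restrict_space)

sublocale P: prob_space "P r a"
proof -
  have "emeasure Q ell2 = 1" using AE_ell2 by (simp add: Q.emeasure_eq_1_AE)
  thus "prob_space (P r a)" unfolding P_eq
    by (rule prob_space_restrict_space[OF AE_ell2(1)])
qed

lemma measurable_P: "f \<in> borel_measurable Q \<Longrightarrow> f \<in> borel_measurable (P r a)"
  by (simp add: P_eq measurable_restrict_space1)

lemma integral_P:
  fixes f :: "cseq \<Rightarrow> complex"
  assumes "f \<in> borel_measurable Q"
  shows "integral\<^sup>L (P r a) f = integral\<^sup>L Q f"
proof -
  have "integral\<^sup>L (P r a) f = (\<integral>z. indicator ell2 z *\<^sub>R f z \<partial>Q)"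
    unfolding P_eq using AE_ell2(1) by (subst integral_restrict_space) (auto simp: set_lebesgue_integral_def)
  also have "\<dots> = integral\<^sup>L Q f"
  proof (rule integral_cong_AE)
    show "AE z in Q. indicator ell2 z *\<^sub>R f z = f z" using AE_ell2(2) by eventually_elim simp
  qed (use assms AE_ell2(1) in measurable)
  finally show ?thesis .
qed

lemma integrable_P:
  fixes f :: "cseq \<Rightarrow> 'b :: {banach, second_countable_topology}"
  assumes "integrable Q f"
  shows "integrable (P r a) f"
proof -
  have "integrable Q (\<lambda>z. indicator ell2 z *\<^sub>R f z)"
    by (rule integrable_mult_indicator[OF AE_ell2(1) assms])
  thus ?thesis unfolding P_eq
    using AE_ell2(1) by (subst integrable_restrict_space) (simp_all add: set_integrable_def)
qed

lemma sq_int_P: "f \<in> sq_int Q \<Longrightarrow> f \<in> sq_int (P r a)"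
  by (simp add: sq_int_def measurable_P integrable_P)

lemma ip_P: "f \<in> borel_measurable Q \<Longrightarrow> g \<in> borel_measurable Q \<Longrightarrow> ip (P r a) f g = ip Q f g"
  unfolding ip_def by (intro integral_P borel_measurable_times borel_measurable_cnj)

end

text \<open>Both orders of integration are provided because integration by parts needs the variable
  of differentiation innermost, which is \<open>x\<close> in one case and \<open>y\<close> in the
  other.\<close>

lemma integral_complex_gauss:
  fixes F :: "complex \<Rightarrow> complex"
  assumes \<sigma>: "\<sigma> > 0" and F: "continuous_on UNIV F" and bound: "\<And>w. cmod (F w) \<le> C * exp (k * (\<bar>Re w\<bar> + \<bar>Im w\<bar>))"
  shows "(\<integral>w. F w \<partial>complex_gauss \<sigma>) = (\<integral>y. \<integral>x. F (Complex x y) \<partial>gauss \<sigma> \<partial>gauss \<sigma>)"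
    and "(\<integral>w. F w \<partial>complex_gauss \<sigma>) = (\<integral>x. \<integral>y. F (Complex x y) \<partial>gauss \<sigma> \<partial>gauss \<sigma>)"
proof -
  let ?G = "gauss \<sigma>"
  interpret prob_space ?G by (rule prob_space_gauss[OF \<sigma>])
  interpret pair_prob_space ?G ?G ..
  have [measurable]: "F \<in> borel_measurable borel" using F by (rule borel_measurable_continuous_onI)
  have C: "C \<ge> 0" using order_trans[OF norm_ge_zero bound[of 0]] by simp
  have "integrable (complex_gauss \<sigma>) (\<lambda>w. C * exp (k * (\<bar>Re w\<bar> + \<bar>Im w\<bar>)))"
    using complex_gauss_exp_finite[OF \<sigma>, of k]
    by (intro integrable_mult_right integrableI_bounded) (auto simp: less_top)
  hence "integrable (complex_gauss \<sigma>) F"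
    by (rule Bochner_Integration.integrable_bound) (use bound C in \<open>auto simp: abs_mult\<close>)
  hence "integrable (?G \<Otimes>\<^sub>M ?G) (\<lambda>p. F (case p of (x, y) \<Rightarrow> Complex x y))"
    unfolding complex_gauss_def by (subst (asm) integrable_distr_eq) auto
  hence i: "integrable (?G \<Otimes>\<^sub>M ?G) (\<lambda>(x, y). F (Complex x y))" by (simp add: case_prod_unfold)
  have "(\<integral>w. F w \<partial>complex_gauss \<sigma>) = (\<integral>p. F (case p of (x, y) \<Rightarrow> Complex x y) \<partial>(?G \<Otimes>\<^sub>M ?G))"
    unfolding complex_gauss_def by (subst integral_distr) auto
  hence *: "(\<integral>w. F w \<partial>complex_gauss \<sigma>) = (\<integral>(x, y). F (Complex x y) \<partial>(?G \<Otimes>\<^sub>M ?G))"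
    by (simp add: case_prod_unfold)
  show "(\<integral>w. F w \<partial>complex_gauss \<sigma>) = (\<integral>y. \<integral>x. F (Complex x y) \<partial>?G \<partial>?G)"
    unfolding * by (rule integral_snd[OF i, symmetric])
  show "(\<integral>w. F w \<partial>complex_gauss \<sigma>) = (\<integral>x. \<integral>y. F (Complex x y) \<partial>?G \<partial>?G)"
    unfolding * by (rule integral_fst'[OF i, symmetric, simplified])
qed

lemma exp_abs_measurable:
  "(\<lambda>w. ennreal (exp (k * (\<bar>Re w\<bar> + \<bar>Im w\<bar>)))) \<in> borel_measurable (complex_gauss \<sigma>)"
  by measurable

context gauss_seq
begin

subsection \<open>Exponential growth and integration by parts\<close>

definition ewt :: "nat \<Rightarrow> nat \<Rightarrow> cseq \<Rightarrow> real" where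
  "ewt n k z = exp (real k * (\<Sum>i<n. \<bar>Re (z i)\<bar> + \<bar>Im (z i)\<bar>))"

text \<open>A class that contains polynomials, bounded functions and exponentials of real
  coordinates, is closed under sums and products, and consists of functions square-integrable for
  \<open>Q\<close> as soon as they are measurable.\<close>

definition egrow :: "(cseq \<Rightarrow> complex) \<Rightarrow> bool" where
  "egrow f \<longleftrightarrow> (\<exists>C n k. \<forall>z. cmod (f z) \<le> C * ewt n k z)"

lemma ewt_pos[simp]: "ewt n k z > 0"
  by (simp add: ewt_def)

lemma ewt_nonneg[simp]: "0 \<le> ewt n k z"
  by (simp add: ewt_def)

lemma ewt_mono: "n \<le> m \<Longrightarrow> k \<le> l \<Longrightarrow> ewt n k z \<le> ewt m l z"
  unfolding ewt_def by (auto intro!: mult_mono sum_mono2 sum_nonneg)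

lemma ewt_mult: "ewt n k z * ewt n l z = ewt n (k + l) z"
  by (simp add: ewt_def distrib_right flip: exp_add)

lemma ewt_measurable[measurable]: "ewt n k \<in> borel_measurable Q"
  unfolding ewt_def by measurable

lemma ewt_integrable: "integrable Q (ewt n k)"
proof -
  have "(\<integral>\<^sup>+z. ennreal (ewt n k z) \<partial>Q) < \<infinity>"
  proof (induction n)
    case 0
    show ?case by (simp add: ewt_def Q.emeasure_space_1[simplified])
  next
    case (Suc n)
    have split: "ewt (Suc n) k (z(n := w)) = ewt n k z * exp (real k * (\<bar>Re w\<bar> + \<bar>Im w\<bar>))" for z w
      by (simp add: ewt_def algebra_simps flip: exp_add)
    have "(\<integral>\<^sup>+z. ennreal (ewt (Suc n) k z) \<partial>Q)
        = (\<integral>\<^sup>+z. \<integral>\<^sup>+w. ennreal (ewt n k z) * ennreal (exp (real k * (\<bar>Re w\<bar> + \<bar>Im w\<bar>))) \<partial>complex_gauss (\<sigma> n) \<partial>Q)"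
      by (subst nn_integral_Q_split[of _ n]) (auto simp: split ennreal_mult)
    also have "\<dots> = (\<integral>\<^sup>+z. ennreal (ewt n k z) \<partial>Q) * (\<integral>\<^sup>+w. ennreal (exp (real k * (\<bar>Re w\<bar> + \<bar>Im w\<bar>))) \<partial>complex_gauss (\<sigma> n))"
    proof -
      show ?thesis unfolding nn_integral_cmult[OF exp_abs_measurable] by (rule nn_integral_multc) measurable
    qed
    also have "\<dots> < \<infinity>"
      using Suc complex_gauss_exp_finite[OF \<sigma>_pos, of n "real k"] by (simp add: ennreal_mult_less_top)
    finally show ?case .
  qed
  thus ?thesis by (intro integrableI_bounded) (auto simp: less_imp_le)
qed

lemma egrowI: "(\<And>z. cmod (f z) \<le> C * ewt n k z) \<Longrightarrow> egrow f"
  unfolding egrow_def by blast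

lemma egrowE:
  assumes "egrow f"
  obtains C n k where "C \<ge> 0" "\<And>z m l. n \<le> m \<Longrightarrow> k \<le> l \<Longrightarrow> cmod (f z) \<le> C * ewt m l z"
proof -
  obtain C n k where *: "\<And>z. cmod (f z) \<le> C * ewt n k z" using assms unfolding egrow_def by blast
  have "0 \<le> C * ewt n k (\<lambda>_. 0)" using order_trans[OF norm_ge_zero *] .
  hence C: "C \<ge> 0" using ewt_pos[of n k "\<lambda>_. 0"] by (simp add: zero_le_mult_iff)
  show ?thesis
    by (rule that[OF C, of n k]) (use * C ewt_mono in \<open>blast intro: order_trans mult_left_mono\<close>)
qed

lemma egrow_const: "egrow (\<lambda>z. d)"
  by (rule egrowI[of _ "cmod d" 0 0]) (simp add: ewt_def)

lemma egrow_bounded: "(\<And>z. cmod (f z) \<le> C) \<Longrightarrow> egrow f"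
  by (rule egrowI[of _ C 0 0]) (simp add: ewt_def)

lemma egrow_add:
  assumes "egrow f" "egrow g" shows "egrow (\<lambda>z. f z + g z)"
proof -
  obtain C n k where f: "C \<ge> 0" "\<And>z m l. n \<le> m \<Longrightarrow> k \<le> l \<Longrightarrow> cmod (f z) \<le> C * ewt m l z"
    using assms(1) by (rule egrowE) blast
  obtain D m l where g: "D \<ge> 0" "\<And>z m' l'. m \<le> m' \<Longrightarrow> l \<le> l' \<Longrightarrow> cmod (g z) \<le> D * ewt m' l' z"
    using assms(2) by (rule egrowE) blast
  show ?thesis
  proof (rule egrowI[of _ "C + D" "max n m" "max k l"])
    fix z
    show "cmod (f z + g z) \<le> (C + D) * ewt (max n m) (max k l) z"
      using f(2)[of "max n m" "max k l" z] g(2)[of "max n m" "max k l" z] norm_triangle_ineq[of "f z" "g z"]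
      by (simp add: distrib_right)
  qed
qed

lemma egrow_mult:
  assumes "egrow f" "egrow g" shows "egrow (\<lambda>z. f z * g z)"
proof -
  obtain C n k where f: "C \<ge> 0" "\<And>z m l. n \<le> m \<Longrightarrow> k \<le> l \<Longrightarrow> cmod (f z) \<le> C * ewt m l z"
    using assms(1) by (rule egrowE) blast
  obtain D m l where g: "D \<ge> 0" "\<And>z m' l'. m \<le> m' \<Longrightarrow> l \<le> l' \<Longrightarrow> cmod (g z) \<le> D * ewt m' l' z"
    using assms(2) by (rule egrowE) blast
  show ?thesis
  proof (rule egrowI[of _ "C * D" "max n m" "k + l"])
    fix z
    have "cmod (f z * g z) \<le> (C * ewt (max n m) k z) * (D * ewt (max n m) l z)"
      unfolding norm_mult using f(2)[of "max n m" k z] g(2)[of "max n m" l z] f(1)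
      by (intro mult_mono) (auto intro!: mult_nonneg_nonneg)
    thus "cmod (f z * g z) \<le> C * D * ewt (max n m) (k + l) z"
      by (simp add: mult_ac flip: ewt_mult)
  qed
qed

lemma egrow_cnj: "egrow f \<Longrightarrow> egrow (\<lambda>z. cnj (f z))"
  by (simp add: egrow_def)

lemma egrow_coord: "egrow (\<lambda>z. z i)"
proof (rule egrowI[of _ 1 "Suc i" 1])
  fix z :: cseq
  have "cmod (z i) \<le> \<bar>Re (z i)\<bar> + \<bar>Im (z i)\<bar>" by (rule cmod_le)
  also have "\<dots> \<le> (\<Sum>j<Suc i. \<bar>Re (z j)\<bar> + \<bar>Im (z j)\<bar>)" by (simp add: sum_nonneg)
  also have "\<dots> \<le> exp (\<Sum>j<Suc i. \<bar>Re (z j)\<bar> + \<bar>Im (z j)\<bar>)"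
    using exp_ge_add_one_self[of "\<Sum>j<Suc i. \<bar>Re (z j)\<bar> + \<bar>Im (z j)\<bar>"] by linarith
  finally show "cmod (z i) \<le> 1 * ewt (Suc i) 1 z" by (simp add: ewt_def)
qed

lemma egrow_poly: "poly_fun p \<Longrightarrow> egrow p"
proof (induction rule: poly_fun.induct)
  case (mult_cnj p i)
  thus ?case using egrow_mult[OF egrow_cnj[OF egrow_coord[of i]]] by blast
qed (auto intro: egrow_const egrow_add egrow_mult egrow_coord)

lemma egrow_sq_int:
  assumes [measurable]: "f \<in> borel_measurable Q" and "egrow f"
  shows "f \<in> sq_int Q"
proof -
  obtain C n k where f: "C \<ge> 0" "\<And>z m l. n \<le> m \<Longrightarrow> k \<le> l \<Longrightarrow> cmod (f z) \<le> C * ewt m l z"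
    using assms(2) by (rule egrowE) blast
  show ?thesis
  proof (rule sq_int_bounded_by)
    show "integrable Q (\<lambda>z. C\<^sup>2 * ewt n (k + k) z)" using ewt_integrable by simp
    fix z
    have "(cmod (f z))\<^sup>2 \<le> (C * ewt n k z)\<^sup>2"
      using f by (intro power_mono) auto
    thus "(cmod (f z))\<^sup>2 \<le> C\<^sup>2 * ewt n (k + k) z"
      by (simp add: power2_eq_square mult_ac flip: ewt_mult)
  qed measurable
qed

lemma poly_fun_measurable: "poly_fun p \<Longrightarrow> p \<in> borel_measurable Q"
  by (intro measurable_Q_cont poly_fun_cont)

lemma ewt_update: "ewt n k (z(i := w)) \<le> ewt n k z * exp (real k * (\<bar>Re w\<bar> + \<bar>Im w\<bar>))"
proof -
  have "(\<Sum>j<n. \<bar>Re ((z(i := w)) j)\<bar> + \<bar>Im ((z(i := w)) j)\<bar>)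
      \<le> (\<Sum>j<n. (\<bar>Re (z j)\<bar> + \<bar>Im (z j)\<bar>) + (if j = i then \<bar>Re w\<bar> + \<bar>Im w\<bar> else 0))"
    by (rule sum_mono) auto
  also have "\<dots> \<le> (\<Sum>j<n. \<bar>Re (z j)\<bar> + \<bar>Im (z j)\<bar>) + (\<bar>Re w\<bar> + \<bar>Im w\<bar>)"
    by (simp add: sum.distrib[of "\<lambda>j. \<bar>Re (z j)\<bar> + \<bar>Im (z j)\<bar>"])
  finally have "real k * (\<Sum>j<n. \<bar>Re ((z(i := w)) j)\<bar> + \<bar>Im ((z(i := w)) j)\<bar>)
      \<le> real k * ((\<Sum>j<n. \<bar>Re (z j)\<bar> + \<bar>Im (z j)\<bar>) + (\<bar>Re w\<bar> + \<bar>Im w\<bar>))"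
    by (rule mult_left_mono) simp
  thus ?thesis by (simp add: ewt_def distrib_left flip: exp_add)
qed

lemma update_cont: "continuous_on UNIV (\<lambda>w. (z(i := w)) j)" for z :: cseq
  by (cases "i = j") auto

lemma section_cont:
  fixes f :: "cseq \<Rightarrow> complex"
  assumes "continuous_on UNIV f" shows "continuous_on UNIV (\<lambda>w. f (z(i := w)))"
proof -
  have "continuous_on UNIV (\<lambda>w. z(i := w))"
    by (rule continuous_on_coordinatewise_then_product) (rule update_cont)
  from continuous_on_compose2[OF assms this] show ?thesis by simp
qed

text \<open>For \<open>d = 1\<close> and \<open>d = \<i>\<close> this is integration by parts in \<open>x\<^sub>i\<close> and \<open>y\<^sub>i\<close>.\<close>

lemma integration_by_parts:
  assumes d: "d = 1 \<or> d = \<i>"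
    and f: "continuous_on UNIV f" "egrow f" and f': "continuous_on UNIV f'" "egrow f'"
    and deriv: "\<And>z. ((\<lambda>h. f (z(i := z i + d * of_real h))) has_vector_derivative f' z) (at 0)"
  shows "(\<integral>z. f' z \<partial>Q) = (\<integral>z. of_real (Re (cnj d * z i) / (\<sigma> i)\<^sup>2) * f z \<partial>Q)"
proof -
  define g where "g = (\<lambda>z. of_real (Re (cnj d * z i) / (\<sigma> i)\<^sup>2) * f z)"
  \<comment> \<open>Written with \<open>z i\<close> and its conjugate, so that continuity and growth
    follow from the closure rules.\<close>
  have g_eq: "g = (\<lambda>z. of_real (1 / (\<sigma> i)\<^sup>2) * ((1/2) * (cnj d * z i + cnj (cnj d * z i)) * f z))"
  proof
    fix z
    have "complex_of_real (Re w / s) = of_real (1 / s) * ((1/2) * (w + cnj w))" for w s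
      by (simp add: complex_eq_iff)
    thus "g z = of_real (1 / (\<sigma> i)\<^sup>2) * ((1/2) * (cnj d * z i + cnj (cnj d * z i)) * f z)"
      by (simp only: g_def mult.assoc)
  qed
  have g: "continuous_on UNIV g" "egrow g"
  proof -
    show "continuous_on UNIV g" unfolding g_eq
      by (intro continuous_intros continuous_on_product_coordinates f)
    show "egrow g" unfolding g_eq complex_cnj_mult
      by (intro egrow_mult egrow_add egrow_const egrow_coord f egrow_cnj)
  qed
  have int: "integrable Q h" if "continuous_on UNIV h" "egrow h" for h
    using that by (intro Q.sq_int_integrable1 egrow_sq_int measurable_Q_cont)
  \<comment> \<open>The rate is taken as \<open>Suc k\<close> because \<open>gauss_ibp\<close> wants
    a positive one.\<close>
  have section_bound: "\<exists>C k. k > 0 \<and> (\<forall>w. cmod (h (z(i := w))) \<le> C * exp (k * (\<bar>Re w\<bar> + \<bar>Im w\<bar>)))"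
    if eh: "egrow h" for h z
  proof -
    obtain C n k where h: "C \<ge> 0" "\<And>z m l. n \<le> m \<Longrightarrow> k \<le> l \<Longrightarrow> cmod (h z) \<le> C * ewt m l z"
      using eh by (rule egrowE) blast
    have "cmod (h (z(i := w))) \<le> (C * ewt n (Suc k) z) * exp (real (Suc k) * (\<bar>Re w\<bar> + \<bar>Im w\<bar>))" for w
    proof -
      have "cmod (h (z(i := w))) \<le> C * ewt n (Suc k) (z(i := w))" by (rule h) auto
      also have "\<dots> \<le> C * (ewt n (Suc k) z * exp (real (Suc k) * (\<bar>Re w\<bar> + \<bar>Im w\<bar>)))"
        using h(1) by (intro mult_left_mono ewt_update)
      finally show ?thesis by simp
    qed
    thus ?thesis by (intro exI[of _ "C * ewt n (Suc k) z"] exI[of _ "real (Suc k)"]) auto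
  qed
  have inner: "(\<integral>w. f' (z(i := w)) \<partial>complex_gauss (\<sigma> i)) = (\<integral>w. g (z(i := w)) \<partial>complex_gauss (\<sigma> i))" for z
  proof -
    obtain C1 k1 where b1: "k1 > 0" "\<And>w. cmod (f (z(i := w))) \<le> C1 * exp (k1 * (\<bar>Re w\<bar> + \<bar>Im w\<bar>))"
      using section_bound[OF f(2), of z] by blast
    obtain C2 k2 where b2: "k2 > 0" "\<And>w. cmod (f' (z(i := w))) \<le> C2 * exp (k2 * (\<bar>Re w\<bar> + \<bar>Im w\<bar>))"
      using section_bound[OF f'(2), of z] by blast
    obtain C3 k3 where b3: "\<And>w. cmod (g (z(i := w))) \<le> C3 * exp (k3 * (\<bar>Re w\<bar> + \<bar>Im w\<bar>))"
      using section_bound[OF g(2), of z] by blast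
    define k where "k = max k1 k2"
    define C where "C = max 0 (max C1 C2)"
    have weaken: "C' * exp (k' * (\<bar>x\<bar> + \<bar>y\<bar>)) \<le> (C * exp (k * \<bar>y\<bar>)) * exp (k * \<bar>x\<bar>)"
      if "C' \<le> C" "k' \<le> k" for C' k' x y :: real
    proof -
      have "C' * exp (k' * (\<bar>x\<bar> + \<bar>y\<bar>)) \<le> C * exp (k * (\<bar>x\<bar> + \<bar>y\<bar>))"
        using that by (intro mult_mono) (auto simp: C_def intro!: mult_right_mono)
      thus ?thesis by (simp add: distrib_left exp_add mult_ac)
    qed
    have fb: "cmod (f (z(i := Complex x y))) \<le> (C * exp (k * \<bar>y\<bar>)) * exp (k * \<bar>x\<bar>)" for x y
      using order_trans[OF b1(2)[of "Complex x y"], unfolded complex.sel, OF weaken] by (auto simp: C_def k_def)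
    have fb': "cmod (f' (z(i := Complex x y))) \<le> (C * exp (k * \<bar>y\<bar>)) * exp (k * \<bar>x\<bar>)" for x y
      using order_trans[OF b2(2)[of "Complex x y"], unfolded complex.sel, OF weaken] by (auto simp: C_def k_def)
    have fb2: "cmod (f (z(i := Complex x y))) \<le> (C * exp (k * \<bar>x\<bar>)) * exp (k * \<bar>y\<bar>)"
      and fb2': "cmod (f' (z(i := Complex x y))) \<le> (C * exp (k * \<bar>x\<bar>)) * exp (k * \<bar>y\<bar>)" for x y
      using fb[of x y] fb'[of x y] by (simp_all add: mult_ac)
    have kpos: "k > 0" using b1 by (simp add: k_def)
    \<comment> \<open>The hypothesis differentiates at step 0 from an arbitrary base point; moving
      the base point along the line yields the derivative of the section everywhere.\<close>
    have shift: "((\<lambda>h. F (h - x)) has_vector_derivative F') (at x)"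
      if "(F has_vector_derivative F') (at 0)" for F :: "real \<Rightarrow> complex" and F' x
    proof -
      have "((\<lambda>h. h - x) has_vector_derivative 1) (at x)" by (auto intro!: derivative_eq_intros)
      from vector_diff_chain_at[OF this, of F F'] that show ?thesis by (simp add: o_def)
    qed
    have cont: "continuous_on UNIV (\<lambda>x. f' (z(i := Complex x y)))" "continuous_on UNIV (\<lambda>x. f' (z(i := Complex y x)))" for y
      by (auto intro!: continuous_on_compose2[OF section_cont[OF f'(1)]] continuous_intros simp: Complex_eq)
    show ?thesis
    proof (cases "d = 1")
      case True
      have "((\<lambda>h. f (z(i := Complex h y))) has_vector_derivative f' (z(i := Complex x y))) (at x)" for x y
      proof -
        have "Complex x y + 1 * of_real (h - x) = Complex h y" for h by (simp add: complex_eq_iff)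
        thus ?thesis using shift[OF deriv[of "z(i := Complex x y)"], of x]
          by (simp only: True fun_upd_upd fun_upd_same)
      qed
      hence "(\<integral>x. f' (z(i := Complex x y)) \<partial>gauss (\<sigma> i))
          = (\<integral>x. of_real (x / (\<sigma> i)\<^sup>2) * f (z(i := Complex x y)) \<partial>gauss (\<sigma> i))" for y
        by (rule gauss_ibp[OF \<sigma>_pos kpos _ cont(1) fb fb'])
      thus ?thesis
        unfolding integral_complex_gauss(1)[OF \<sigma>_pos section_cont[OF f'(1)] b2(2)]
          integral_complex_gauss(1)[OF \<sigma>_pos section_cont[OF g(1)] b3]
        by (simp add: g_def True)
    next
      case False
      hence d: "d = \<i>" using d by simp
      have "((\<lambda>h. f (z(i := Complex x h))) has_vector_derivative f' (z(i := Complex x y))) (at y)" for x y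
      proof -
        have "Complex x y + \<i> * of_real (h - y) = Complex x h" for h by (simp add: complex_eq_iff)
        thus ?thesis using shift[OF deriv[of "z(i := Complex x y)"], of y]
          by (simp only: d fun_upd_upd fun_upd_same)
      qed
      hence "(\<integral>y. f' (z(i := Complex x y)) \<partial>gauss (\<sigma> i))
          = (\<integral>y. of_real (y / (\<sigma> i)\<^sup>2) * f (z(i := Complex x y)) \<partial>gauss (\<sigma> i))" for x
        by (rule gauss_ibp[OF \<sigma>_pos kpos _ cont(2) fb2 fb2'])
      thus ?thesis
        unfolding integral_complex_gauss(2)[OF \<sigma>_pos section_cont[OF f'(1)] b2(2)]
          integral_complex_gauss(2)[OF \<sigma>_pos section_cont[OF g(1)] b3]
        by (simp add: g_def d)
    qed
  qed
  have "(\<integral>z. f' z \<partial>Q) = (\<integral>z. \<integral>w. f' (z(i := w)) \<partial>complex_gauss (\<sigma> i) \<partial>Q)"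
    by (rule integral_Q_split[OF int[OF f']])
  also have "\<dots> = (\<integral>z. g z \<partial>Q)"
    unfolding inner by (rule integral_Q_split[OF int[OF g], symmetric])
  finally show ?thesis by (simp add: g_def)
qed


section \<open>Adjoints of the complex derivatives\<close>

definition dbar_i :: "nat \<Rightarrow> (cseq \<Rightarrow> complex) \<Rightarrow> cseq \<Rightarrow> complex" where
  "dbar_i i f z = (D_x i f z + \<i> * D_y i f z) / 2"

text \<open>The common setting of test functions and polynomials in which integration by parts is
  legitimate. Differentiability is demanded explicitly because \<open>D_x\<close> and
  \<open>D_y\<close> have a value even where no derivative exists.\<close>

definition tame :: "(cseq \<Rightarrow> complex) \<Rightarrow> bool" where
  "tame f \<longleftrightarrow> continuous_on UNIV f \<and> egrow f \<and>
     (\<forall>i. continuous_on UNIV (D_x i f) \<and> egrow (D_x i f) \<and> continuous_on UNIV (D_y i f) \<and> egrow (D_y i f) \<and>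
       (\<forall>z. ((\<lambda>h. f (z(i := z i + of_real h))) has_vector_derivative D_x i f z) (at 0) \<and>
            ((\<lambda>h. f (z(i := z i + \<i> * of_real h))) has_vector_derivative D_y i f z) (at 0)))"

lemma tame_sq_int:
  assumes "tame f"
  shows "f \<in> sq_int Q" "D_x i f \<in> sq_int Q" "D_y i f \<in> sq_int Q" "(\<lambda>z. z i * f z) \<in> sq_int Q"
    "(\<lambda>z. cnj (z i) * f z) \<in> sq_int Q"
  using assms unfolding tame_def
  by (auto intro!: egrow_sq_int measurable_Q_cont egrow_mult egrow_coord egrow_cnj[OF egrow_coord]
      continuous_intros continuous_on_product_coordinates)

lemma tame_ibp:
  assumes f: "tame f" and g: "tame g"
  shows "ip Q (D_x i f) g + ip Q f (D_x i g) = (\<integral>z. of_real (Re (z i)) * (f z * cnj (g z)) \<partial>Q) / of_real ((\<sigma> i)\<^sup>2)"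
    and "ip Q (D_y i f) g + ip Q f (D_y i g) = (\<integral>z. of_real (Im (z i)) * (f z * cnj (g z)) \<partial>Q) / of_real ((\<sigma> i)\<^sup>2)"
proof -
  have c: "continuous_on UNIV (\<lambda>z. f z * cnj (g z))" "egrow (\<lambda>z. f z * cnj (g z))"
    using f g unfolding tame_def by (auto intro!: continuous_intros egrow_mult egrow_cnj)
  have "(\<integral>z. (f z * cnj (D_x i g z) + D_x i f z * cnj (g z)) \<partial>Q)
      = (\<integral>z. of_real (Re (cnj 1 * z i) / (\<sigma> i)\<^sup>2) * (f z * cnj (g z)) \<partial>Q)"
  proof (rule integration_by_parts[OF _ c])
    show "continuous_on UNIV (\<lambda>z. f z * cnj (D_x i g z) + D_x i f z * cnj (g z))"
      "egrow (\<lambda>z. f z * cnj (D_x i g z) + D_x i f z * cnj (g z))"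
      using f g unfolding tame_def by (auto intro!: continuous_intros egrow_add egrow_mult egrow_cnj)
    show "((\<lambda>h. f (z(i := z i + 1 * of_real h)) * cnj (g (z(i := z i + 1 * of_real h))))
        has_vector_derivative f z * cnj (D_x i g z) + D_x i f z * cnj (g z)) (at 0)" for z
    proof -
      have "((\<lambda>h. f (z(i := z i + of_real h))) has_vector_derivative D_x i f z) (at 0)"
        "((\<lambda>h. g (z(i := z i + of_real h))) has_vector_derivative D_x i g z) (at 0)"
        using f g unfolding tame_def by auto
      from has_vector_derivative_mult[OF this(1) has_vector_derivative_cnj[OF this(2)]]
      show ?thesis by simp
    qed
  qed simp
  thus "ip Q (D_x i f) g + ip Q f (D_x i g) = (\<integral>z. of_real (Re (z i)) * (f z * cnj (g z)) \<partial>Q) / of_real ((\<sigma> i)\<^sup>2)"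
    using sq_int_ip_integrable[OF tame_sq_int(1)[OF f] tame_sq_int(2)[OF g, of i]]
      sq_int_ip_integrable[OF tame_sq_int(2)[OF f, of i] tame_sq_int(1)[OF g]]
    by (simp add: ip_def add.commute)
  have "(\<integral>z. (f z * cnj (D_y i g z) + D_y i f z * cnj (g z)) \<partial>Q)
      = (\<integral>z. of_real (Re (cnj \<i> * z i) / (\<sigma> i)\<^sup>2) * (f z * cnj (g z)) \<partial>Q)"
  proof (rule integration_by_parts[OF _ c])
    show "continuous_on UNIV (\<lambda>z. f z * cnj (D_y i g z) + D_y i f z * cnj (g z))"
      "egrow (\<lambda>z. f z * cnj (D_y i g z) + D_y i f z * cnj (g z))"
      using f g unfolding tame_def by (auto intro!: continuous_intros egrow_add egrow_mult egrow_cnj)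
    show "((\<lambda>h. f (z(i := z i + \<i> * of_real h)) * cnj (g (z(i := z i + \<i> * of_real h))))
        has_vector_derivative f z * cnj (D_y i g z) + D_y i f z * cnj (g z)) (at 0)" for z
    proof -
      have "((\<lambda>h. f (z(i := z i + \<i> * of_real h))) has_vector_derivative D_y i f z) (at 0)"
        "((\<lambda>h. g (z(i := z i + \<i> * of_real h))) has_vector_derivative D_y i g z) (at 0)"
        using f g unfolding tame_def by auto
      from has_vector_derivative_mult[OF this(1) has_vector_derivative_cnj[OF this(2)]]
      show ?thesis by simp
    qed
  qed simp
  thus "ip Q (D_y i f) g + ip Q f (D_y i g) = (\<integral>z. of_real (Im (z i)) * (f z * cnj (g z)) \<partial>Q) / of_real ((\<sigma> i)\<^sup>2)"
    using sq_int_ip_integrable[OF tame_sq_int(1)[OF f] tame_sq_int(3)[OF g, of i]]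
      sq_int_ip_integrable[OF tame_sq_int(3)[OF f, of i] tame_sq_int(1)[OF g]]
    by (simp add: ip_def add.commute)
qed

lemma ip_coord:
  assumes f: "tame f" and g: "tame g"
  shows "ip Q (\<lambda>z. cnj (z i) * f z) g = (\<integral>z. of_real (Re (z i)) * (f z * cnj (g z)) \<partial>Q)
      - \<i> * (\<integral>z. of_real (Im (z i)) * (f z * cnj (g z)) \<partial>Q)"
proof -
  have eq: "of_real (Re w) * x = (1/2) * (w * x + cnj w * x)" "of_real (Im w) * x = (1/(2*\<i>)) * (w * x - cnj w * x)"
    for w x
    unfolding distrib_right[symmetric] left_diff_distrib[symmetric] complex_add_cnj complex_diff_cnj
    by (simp_all add: complex_eq_iff)
  have i: "integrable Q (\<lambda>z. z i * (f z * cnj (g z)))" "integrable Q (\<lambda>z. cnj (z i) * (f z * cnj (g z)))"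
    using sq_int_ip_integrable[OF tame_sq_int(4)[OF f, of i] tame_sq_int(1)[OF g]]
      sq_int_ip_integrable[OF tame_sq_int(5)[OF f, of i] tame_sq_int(1)[OF g]]
    by (simp_all add: mult.assoc)
  show ?thesis unfolding eq
    using i by (simp add: ip_def mult.assoc algebra_simps)
qed

lemma delta_eq: "delta r a i f z = (D_x i f z - \<i> * D_y i f z) / 2 - of_real (c i) * (cnj (z i) * f z)"
  by (simp add: delta_def del_def c_def \<sigma>_def power_mult_distrib)

lemma delta_sq_int: "tame f \<Longrightarrow> delta r a i f \<in> sq_int Q"
proof -
  assume f: "tame f"
  have "(\<lambda>z. (1/2) * (D_x i f z - \<i> * D_y i f z) - of_real (c i) * (cnj (z i) * f z)) \<in> sq_int Q"
    by (intro sq_int_diff sq_int_scale tame_sq_int f)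
  thus ?thesis by (simp add: delta_eq[abs_def] cong: sq_int_def)
qed

text \<open>Integration by parts in \<open>x\<close> and \<open>y\<close> leaves the factors
  x/\<sigma>^2 and y/\<sigma>^2; half of their combination x - iy is exactly
  \<open>c i * cnj (z i)\<close>, the zeroth-order term of \<open>delta\<close>.\<close>

lemma ip_delta:
  assumes f: "tame f" and g: "tame g"
  shows "ip Q f (dbar_i i g) = - ip Q (delta r a i f) g"
proof -
  note sq = tame_sq_int[OF f] tame_sq_int[OF g]
  have 1: "ip Q (delta r a i f) g = (1/2) * (ip Q (D_x i f) g - \<i> * ip Q (D_y i f) g) - of_real (c i) * ip Q (\<lambda>z. cnj (z i) * f z) g"
  proof -
    have "delta r a i f = (\<lambda>z. (1/2) * (D_x i f z - \<i> * D_y i f z) - of_real (c i) * (cnj (z i) * f z))"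
      by (rule ext) (simp add: delta_eq)
    thus ?thesis using sq by (simp only: ip_diff_left ip_scale_left sq_int_scale sq_int_diff)
  qed
  have 2: "ip Q f (dbar_i i g) = (1/2) * (ip Q f (D_x i g) - \<i> * ip Q f (D_y i g))"
  proof -
    have "dbar_i i g = (\<lambda>z. (1/2) * (D_x i g z + \<i> * D_y i g z))"
      by (rule ext) (simp add: dbar_i_def)
    hence "ip Q (dbar_i i g) f = (1/2) * (ip Q (D_x i g) f + \<i> * ip Q (D_y i g) f)"
      using sq by (simp only: ip_add_left ip_scale_left sq_int_scale)
    from arg_cong[OF this, of cnj] show ?thesis by (simp add: ip_cnj[of Q f])
  qed
  have c: "of_real (c i) = (1/2) * (1 / complex_of_real ((\<sigma> i)\<^sup>2))" by (simp add: c_def)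
  define X where "X = (\<integral>z. of_real (Re (z i)) * (f z * cnj (g z)) \<partial>Q)"
  define Y where "Y = (\<integral>z. of_real (Im (z i)) * (f z * cnj (g z)) \<partial>Q)"
  have x: "ip Q f (D_x i g) = X / of_real ((\<sigma> i)\<^sup>2) - ip Q (D_x i f) g"
    and y: "ip Q f (D_y i g) = Y / of_real ((\<sigma> i)\<^sup>2) - ip Q (D_y i f) g"
    using tame_ibp[OF f g, of i] by (simp_all add: X_def Y_def algebra_simps)
  have z: "ip Q (\<lambda>z. cnj (z i) * f z) g = X - \<i> * Y"
    unfolding X_def Y_def by (rule ip_coord[OF f g])
  have "(1/2) * ((X / s - p) - \<i> * (Y / s - q)) = - ((1/2) * (p - \<i> * q) - (1/2) * (1 / s) * (X - \<i> * Y))" for p q s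
    by (simp add: algebra_simps diff_divide_distrib)
  thus ?thesis unfolding 1 2 x y z c by blast
qed

text \<open>The companion of \<open>ip_delta\<close> for the holomorphic derivative, used to compare
  Hermite polynomials of antiholomorphic degree zero.\<close>

lemma ip_del:
  assumes f: "tame f" and g: "tame g"
  shows "ip Q (del i f) g = cnj (of_real (c i) * ip Q (\<lambda>z. z i * g z) f - ip Q (dbar_i i g) f)"
proof -
  note sq = tame_sq_int[OF f] tame_sq_int[OF g]
  have "del i f = (\<lambda>z. delta r a i f z + of_real (c i) * (cnj (z i) * f z))"
    by (rule ext) (simp add: delta_eq del_def)
  hence "ip Q (del i f) g = ip Q (delta r a i f) g + of_real (c i) * ip Q (\<lambda>z. cnj (z i) * f z) g"
    using sq delta_sq_int[OF f, of i] by (simp only: ip_add_left ip_scale_left sq_int_scale)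
  moreover have "ip Q (\<lambda>z. cnj (z i) * f z) g = cnj (ip Q (\<lambda>z. z i * g z) f)"
    unfolding ip_def Bochner_Integration.integral_cnj[symmetric] by (simp add: mult_ac)
  ultimately show ?thesis
    using ip_delta[OF f g, of i] by (simp add: ip_cnj[of Q f "dbar_i i g"])
qed

lemma tame_poly:
  assumes p: "poly_fun p" shows "tame p" "poly_fun (D_x i p)" "poly_fun (D_y i p)"
proof -
  have x: "poly_fun (D_x i p) \<and> (\<forall>z. ((\<lambda>h. p (z(i := z i + of_real h))) has_vector_derivative D_x i p z) (at 0))" for i
  proof -
    obtain q where q: "poly_fun q" "\<And>z. ((\<lambda>h. p (z(i := z i + 1 * of_real h))) has_vector_derivative q z) (at 0)"
      using poly_fun_deriv[OF p, of i 1] by blast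
    have "D_x i p = q" unfolding D_x_def using vector_derivative_at[OF q(2)] by auto
    thus ?thesis using q by simp
  qed
  have y: "poly_fun (D_y i p) \<and> (\<forall>z. ((\<lambda>h. p (z(i := z i + \<i> * of_real h))) has_vector_derivative D_y i p z) (at 0))" for i
  proof -
    obtain q where q: "poly_fun q" "\<And>z. ((\<lambda>h. p (z(i := z i + \<i> * of_real h))) has_vector_derivative q z) (at 0)"
      using poly_fun_deriv[OF p, of i "\<i>"] by blast
    have "D_y i p = q" unfolding D_y_def using vector_derivative_at[OF q(2)] by auto
    thus ?thesis using q by simp
  qed
  show "tame p" unfolding tame_def using x y p by (auto intro: poly_fun_cont egrow_poly)
  show "poly_fun (D_x i p)" "poly_fun (D_y i p)" using x y by auto
qed

subsection \<open>Orthogonality of the Hermite polynomials\<close>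

abbreviation hm :: "nat multiset \<Rightarrow> nat multiset \<Rightarrow> cseq \<Rightarrow> complex" where
  "hm \<equiv> hermite c"

lemma tame_hm: "tame (hm A B)"
  by (rule tame_poly[OF poly_fun_hermite])

lemma hm_sq_int: "hm A B \<in> sq_int Q"
  by (rule tame_sq_int[OF tame_hm])

lemma dbar_i_hm: "dbar_i i (hm A B) = (\<lambda>z. of_real (c i * real (count B i)) * hm A (B - {#i#}) z)"
  by (rule ext) (simp add: dbar_i_def D_x_hermite D_y_hermite algebra_simps)

lemma del_hm: "del i (hm A B) = (\<lambda>z. of_nat (count A i) * hm (A - {#i#}) B z)"
  by (rule ext) (simp add: del_def D_x_hermite D_y_hermite algebra_simps)

text \<open>\<open>delta r a i\<close> is minus the raising operator. Testing a weak equation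
  against Hermite polynomials therefore shifts \<open>B\<close> by \<open>i\<close> and introduces
  no constant besides the sign.\<close>

lemma delta_hm: "delta r a i (hm A B) = (\<lambda>z. - hm A (add_mset i B) z)"
proof
  fix z
  have "delta r a i (hm A B) z = del i (hm A B) z - of_real (c i) * (cnj (z i) * hm A B z)"
    by (simp add: delta_eq del_def)
  thus "delta r a i (hm A B) z = - hm A (add_mset i B) z"
    by (simp add: del_hm hermite_add_right)
qed

text \<open>Raising on one side of the inner product is lowering on the other.\<close>

lemma ip_hm_add_right:
  "ip Q (hm A (add_mset i B)) (hm A' B') = of_real (c i * real (count B' i)) * ip Q (hm A B) (hm A' (B' - {#i#}))"
proof -
  have "ip Q (hm A B) (dbar_i i (hm A' B')) = - ip Q (delta r a i (hm A B)) (hm A' B')"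
    by (rule ip_delta[OF tame_hm tame_hm])
  also have "\<dots> = ip Q (hm A (add_mset i B)) (hm A' B')"
    by (simp add: delta_hm ip_def)
  also have "ip Q (hm A B) (dbar_i i (hm A' B')) = of_real (c i * real (count B' i)) * ip Q (hm A B) (hm A' (B' - {#i#}))"
    unfolding dbar_i_hm by (simp add: ip_cnj[of Q "hm A B"] ip_scale_left)
  finally show ?thesis by simp
qed

lemma ip_hm_add_left:
  "of_real (c i) * ip Q (hm (add_mset i A) {#}) (hm A' {#}) = of_nat (count A' i) * ip Q (hm A {#}) (hm (A' - {#i#}) {#})"
proof -
  have "ip Q (del i (hm A' {#})) (hm A {#})
      = cnj (of_real (c i) * ip Q (\<lambda>z. z i * hm A {#} z) (hm A' {#}) - ip Q (dbar_i i (hm A {#})) (hm A' {#}))"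
    by (rule ip_del[OF tame_hm tame_hm])
  also have "ip Q (dbar_i i (hm A {#})) (hm A' {#}) = 0" by (simp add: dbar_i_hm ip_def)
  also have "(\<lambda>z. z i * hm A {#} z) = hm (add_mset i A) {#}"
    by (rule ext) (simp add: hermite_mult_coord)
  finally have "cnj (ip Q (del i (hm A' {#})) (hm A {#})) = of_real (c i) * ip Q (hm (add_mset i A) {#}) (hm A' {#})"
    by simp
  thus ?thesis by (simp add: del_hm ip_scale_left ip_cnj[of Q "hm A {#}" "hm (A' - {#i#}) {#}"])
qed

lemma ip_hm_empty: "ip Q (hm A {#}) (hm A' {#}) = 0" if "A \<noteq> A'"
  using that
proof (induction A arbitrary: A')
  case empty
  then obtain i B where A': "A' = add_mset i B" by (cases A') auto
  have "of_real (c i) * ip Q (hm A' {#}) (hm {#} {#}) = 0"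
    unfolding A' by (simp add: ip_hm_add_left)
  hence "ip Q (hm A' {#}) (hm {#} {#}) = 0" using c_pos[of i] by simp
  thus ?case using ip_cnj[of Q "hm {#} {#}" "hm A' {#}"] by (simp del: hermite_empty)
next
  case (add i A)
  have "of_real (c i) * ip Q (hm (add_mset i A) {#}) (hm A' {#}) = 0"
  proof (cases "i \<in># A'")
    case True
    then obtain B where "A' = add_mset i B" by (blast dest: multi_member_split)
    thus ?thesis using add by (simp add: ip_hm_add_left)
  next
    case False
    thus ?thesis by (simp add: ip_hm_add_left not_in_iff)
  qed
  thus ?case using c_pos[of i] by simp
qed

text \<open>Common indices of \<open>B\<close> and \<open>B'\<close> are stripped from both sides at
  once. Either an index of one is missing in the other and the lowered side vanishes, or both become
  empty and the holomorphic degrees decide.\<close>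

lemma ip_hm_neq: "ip Q (hm A B) (hm A' B') = 0" if "(A, B) \<noteq> (A', B')"
  using that
proof (induction B arbitrary: B')
  case empty
  show ?case
  proof (cases B')
    case empty
    thus ?thesis using \<open>(A, {#}) \<noteq> (A', B')\<close> by (auto intro: ip_hm_empty)
  next
    case (add i B1)
    thus ?thesis by (simp add: ip_cnj[of Q "hm A {#}"] ip_hm_add_right)
  qed
next
  case (add i B)
  show ?case
  proof (cases "i \<in># B'")
    case True
    then obtain B1 where "B' = add_mset i B1" by (blast dest: multi_member_split)
    thus ?thesis using add by (simp add: ip_hm_add_right)
  next
    case False
    thus ?thesis by (simp add: ip_hm_add_right not_in_iff)
  qed
qed

section \<open>Norms and the orthonormal basis\<close>

definition N :: "nat multiset \<Rightarrow> nat multiset \<Rightarrow> real" where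
  "N A B = nsq Q (hm A B)"

text \<open>The ratio that \<open>homotopy_norm\<close> asks of its norms, for fixed
  \<open>A\<close>.\<close>

lemma N_add_right: "N A (add_mset i B) = N A B * (c i * (real (count B i) + 1))"
proof -
  have "ip Q (hm A (add_mset i B)) (hm A (add_mset i B))
      = of_real (c i * (real (count B i) + 1)) * ip Q (hm A B) (hm A B)"
    by (simp add: ip_hm_add_right add.commute)
  hence "complex_of_real (N A (add_mset i B)) = of_real (c i * (real (count B i) + 1) * N A B)"
    by (simp only: ip_self N_def of_real_mult)
  thus ?thesis by (simp only: of_real_eq_iff mult_ac)
qed

lemma N_pos: "N A B > 0"
proof (induction B)
  case empty
  show ?case
  proof (induction A)
    case empty
    have "hm {#} {#} = (\<lambda>z. 1)" by (rule ext) simp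
    thus ?case by (simp add: N_def nsq_def Q.prob_space[simplified])
  next
    case (add i A)
    have "of_real (c i) * ip Q (hm (add_mset i A) {#}) (hm (add_mset i A) {#})
        = of_real (real (count A i) + 1) * ip Q (hm A {#}) (hm A {#})"
      by (simp add: ip_hm_add_left add.commute)
    hence "complex_of_real (c i * N (add_mset i A) {#}) = of_real ((real (count A i) + 1) * N A {#})"
      by (simp only: ip_self N_def of_real_mult)
    hence "c i * N (add_mset i A) {#} = (real (count A i) + 1) * N A {#}" by (simp only: of_real_eq_iff)
    hence "c i * N (add_mset i A) {#} > 0" using add by simp
    thus ?case using c_pos[of i] by (simp add: zero_less_mult_iff)
  qed
next
  case (add i B)
  thus ?case using c_pos[of i] by (simp add: N_add_right)
qed

definition e :: "nat multiset \<times> nat multiset \<Rightarrow> cseq \<Rightarrow> complex" where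
  "e = (\<lambda>(A, B) z. of_real (1 / sqrt (N A B)) * hm A B z)"

lemma countable_multisets: "countable (UNIV :: nat multiset set)"
proof -
  have "countable (range (mset :: nat list \<Rightarrow> nat multiset))" by simp
  thus ?thesis unfolding surj_mset .
qed

lemma ip_e_right: "ip M f (e (A, B)) = of_real (1 / sqrt (N A B)) * ip M f (hm A B)"
  unfolding ip_cnj[of M f "e (A, B)"] ip_cnj[of M f "hm A B"]
  by (simp only: e_def prod.case ip_scale_left complex_cnj_mult complex_cnj_complex_of_real)

sublocale E: ortho "P r a" e
proof
  have "countable ((UNIV :: nat multiset set) \<times> (UNIV :: nat multiset set))"
    by (rule countable_SIGMA) (rule countable_multisets)+
  thus "countable (UNIV :: (nat multiset \<times> nat multiset) set)" by simp
  have "infinite (range (\<lambda>n. (replicate_mset n (0::nat), {#} :: nat multiset)))"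
  proof (rule range_inj_infinite, rule injI)
    fix m n assume "(replicate_mset m (0::nat), {#} :: nat multiset) = (replicate_mset n 0, {#})"
    hence "size (replicate_mset m (0::nat)) = size (replicate_mset n (0::nat))" by simp
    thus "m = n" by simp
  qed
  thus "infinite (UNIV :: (nat multiset \<times> nat multiset) set)"
    by (rule infinite_super[OF subset_UNIV])
  show "e i \<in> sq_int (P r a)" for i
    by (cases i) (simp only: e_def prod.case sq_int_P sq_int_scale hm_sq_int)
  show "ip (P r a) (e i) (e j) = (if i = j then 1 else 0)" for i j
  proof -
    obtain A B A' B' where ij: "i = (A, B)" "j = (A', B')" by (cases i; cases j)
    have m: "hm A B \<in> borel_measurable Q" for A B using hm_sq_int by auto
    have "ip (P r a) (e i) (e j) = of_real (1 / sqrt (N A B)) * (of_real (1 / sqrt (N A' B')) * ip Q (hm A B) (hm A' B'))"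
      unfolding ij ip_e_right by (simp only: e_def prod.case ip_scale_left ip_P m mult.left_commute)
    moreover have "1 / sqrt (N A B) * (1 / sqrt (N A B) * N A B) = 1"
      using N_pos[of A B] by simp
    hence "of_real (1 / sqrt (N A B)) * (of_real (1 / sqrt (N A B)) * ip Q (hm A B) (hm A B)) = 1"
      unfolding ip_self N_def[symmetric] of_real_mult[symmetric] by simp
    ultimately show ?thesis using ip_hm_neq[of A B A' B'] by (auto simp: ij)
  qed
qed

end

subsection \<open>Completeness\<close>

lemma exp_partial_sum_bound:
  fixes w :: complex
  shows "cmod (\<Sum>k<n. w ^ k /\<^sub>R fact k) \<le> exp (cmod w)"
proof -
  have "cmod (\<Sum>k<n. w ^ k /\<^sub>R fact k) \<le> (\<Sum>k<n. cmod w ^ k /\<^sub>R fact k)"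
    by (rule sum_norm_le) (simp add: norm_power divide_inverse)
  also have "\<dots> \<le> exp (cmod w)"
    using sum_le_suminf[OF summable_exp_generic[of "cmod w"], of "{..<n}"] by (simp add: exp_def)
  finally show ?thesis .
qed

lemma moment_integrable:
  fixes G :: "'a \<Rightarrow> 'b :: {real_normed_field, banach, second_countable_topology}" and X :: "'a \<Rightarrow> real"
  assumes [measurable]: "G \<in> borel_measurable M" "X \<in> borel_measurable M"
    and int: "integrable M (\<lambda>z. G z * of_real (exp \<bar>X z\<bar>))"
  shows "integrable M (\<lambda>z. G z * of_real (X z ^ k))"
proof (rule Bochner_Integration.integrable_bound)
  show "integrable M (\<lambda>z. fact k * (G z * of_real (exp \<bar>X z\<bar>)))" using int by (intro integrable_mult_right)
  show "AE z in M. norm (G z * of_real (X z ^ k)) \<le> norm (fact k * (G z * of_real (exp \<bar>X z\<bar>)))"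
  proof (intro AE_I2)
    fix z
    have "\<bar>X z\<bar> ^ k /\<^sub>R fact k \<le> exp \<bar>X z\<bar>"
      using sum_le_suminf[OF summable_exp_generic[of "\<bar>X z\<bar>"], of "{k}"] by (simp add: exp_def)
    hence "\<bar>X z\<bar> ^ k \<le> fact k * exp \<bar>X z\<bar>" by (simp add: field_simps)
    thus "norm (G z * of_real (X z ^ k)) \<le> norm (fact k * (G z * of_real (exp \<bar>X z\<bar>)))"
      by (simp add: norm_mult norm_power power_abs mult.left_commute[of "fact k"] mult_left_mono)
  qed
qed measurable

text \<open>Exponential moments let the characteristic integral of \<open>G\<close> along
  \<open>X\<close> be expanded into moments, so it vanishes identically. The positive and negative
  parts of \<open>G\<close>, normalised, then push forward along \<open>X\<close> to two
  distributions with the same characteristic function, which coincide by Levy's uniqueness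
  theorem.\<close>

lemma moments_determine_real:
  fixes G X :: "'a \<Rightarrow> real"
  assumes [measurable]: "G \<in> borel_measurable M" "X \<in> borel_measurable M"
    and int: "\<And>c. integrable M (\<lambda>z. G z * exp (c * \<bar>X z\<bar>))"
    and mom: "\<And>k. (\<integral>z. G z * X z ^ k \<partial>M) = 0"
    and A[measurable]: "A \<in> sets borel"
  shows "(\<integral>z. G z * indicator A (X z) \<partial>M) = 0"
proof -
  have intG: "integrable M G" using int[of 0] by simp
  \<comment> \<open>The exponential series is integrated term by term; its partial sums are
    dominated by the exponential of the absolute value.\<close>
  have char0: "(\<integral>z. of_real (G z) * iexp (t * X z) \<partial>M) = 0" for t
  proof -
    let ?w = "\<lambda>z. \<i> * complex_of_real (t * X z)"
    define s where "s = (\<lambda>n z. of_real (G z) * (\<Sum>k<n. ?w z ^ k /\<^sub>R fact k))"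
    have "(\<lambda>n. \<integral>z. s n z \<partial>M) \<longlonglongrightarrow> (\<integral>z. of_real (G z) * iexp (t * X z) \<partial>M)"
    proof (rule integral_dominated_convergence)
      show "integrable M (\<lambda>z. \<bar>G z * exp (\<bar>t\<bar> * \<bar>X z\<bar>)\<bar>)" using int[of "\<bar>t\<bar>"] by simp
      show "AE z in M. (\<lambda>n. s n z) \<longlonglongrightarrow> of_real (G z) * iexp (t * X z)"
      proof (intro AE_I2)
        fix z
        have "(\<lambda>n. \<Sum>k<n. ?w z ^ k /\<^sub>R fact k) \<longlonglongrightarrow> exp (?w z)"
          using exp_converges[of "?w z"] by (simp add: sums_def)
        thus "(\<lambda>n. s n z) \<longlonglongrightarrow> of_real (G z) * iexp (t * X z)"
          unfolding s_def by (intro tendsto_intros)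
      qed
      show "AE z in M. norm (s n z) \<le> \<bar>G z * exp (\<bar>t\<bar> * \<bar>X z\<bar>)\<bar>" for n
      proof (intro AE_I2)
        fix z
        have "norm (\<Sum>k<n. ?w z ^ k /\<^sub>R fact k) \<le> exp (\<bar>t\<bar> * \<bar>X z\<bar>)"
          using exp_partial_sum_bound[where w = "?w z" and n = n] by (simp add: norm_mult abs_mult)
        thus "norm (s n z) \<le> \<bar>G z * exp (\<bar>t\<bar> * \<bar>X z\<bar>)\<bar>"
          by (simp add: s_def norm_mult abs_mult mult_left_mono)
      qed
    qed (auto simp: s_def)
    moreover have "(\<integral>z. s n z \<partial>M) = 0" for n
    proof -
      have ik: "integrable M (\<lambda>z. G z * X z ^ k)" for k
        using moment_integrable[of G M X k] int[of 1] by simp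
      have "s n = (\<lambda>z. \<Sum>k<n. ((\<i> * of_real t) ^ k /\<^sub>R fact k) * of_real (G z * X z ^ k))"
        by (rule ext) (simp add: s_def sum_distrib_left power_mult_distrib mult_ac)
      hence "(\<integral>z. s n z \<partial>M) = (\<Sum>k<n. ((\<i> * of_real t) ^ k /\<^sub>R fact k) * of_real (\<integral>z. G z * X z ^ k \<partial>M))"
        using ik by (simp only: Bochner_Integration.integral_sum integrable_mult_right integrable_of_real
            integral_mult_right_zero integral_complex_of_real)
      thus ?thesis by (simp add: mom)
    qed
    ultimately show ?thesis by (simp add: LIMSEQ_const_iff)
  qed
  define p where "p = (\<lambda>z. max 0 (G z))"
  define q where "q = (\<lambda>z. max 0 (- G z))"
  have [measurable]: "p \<in> borel_measurable M" "q \<in> borel_measurable M" by (auto simp: p_def q_def)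
  have ip: "integrable M p" and iq: "integrable M q"
    using intG by (auto simp: p_def q_def)
  have G: "G z = p z - q z" and pos: "p z \<ge> 0" "q z \<ge> 0" for z by (auto simp: p_def q_def)
  have "(\<integral>z. G z \<partial>M) = 0" using mom[of 0] by simp
  hence eq: "(\<integral>z. p z \<partial>M) = (\<integral>z. q z \<partial>M)" using ip iq by (simp add: G)
  \<comment> \<open>Both parts have this mass because the zeroth moment vanishes. For mass 0 there
    is nothing to normalise, but then \<open>G\<close> is 0 almost everywhere.\<close>
  define m where "m = (\<integral>z. p z \<partial>M)"
  show ?thesis
  proof (cases "m = 0")
    case True
    have "AE z in M. p z = 0" "AE z in M. q z = 0"
      using integral_nonneg_eq_0_iff_AE[OF ip] integral_nonneg_eq_0_iff_AE[OF iq] True eq pos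
      by (simp_all add: m_def)
    hence "AE z in M. G z * indicator A (X z) = 0" by eventually_elim (simp add: G)
    thus ?thesis by (rule integral_eq_zero_AE)
  next
    case False
    have mpos: "m > 0" using False pos by (simp add: m_def less_le)
    define D where "D = (\<lambda>h. distr (density M (\<lambda>z. ennreal (h z / m))) borel X)"
    have real_dist: "real_distribution (D h)"
      if [measurable]: "h \<in> borel_measurable M" and "integrable M h" "\<And>z. h z \<ge> 0" "(\<integral>z. h z \<partial>M) = m" for h
    proof -
      have "emeasure (density M (\<lambda>z. ennreal (h z / m))) (space M) = (\<integral>\<^sup>+z. ennreal (h z / m) \<partial>M)"
        by (subst emeasure_density) (auto intro!: nn_integral_cong)
      also have "\<dots> = ennreal (\<integral>z. h z / m \<partial>M)"
        using that mpos by (intro nn_integral_eq_integral) auto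
      also have "\<dots> = 1" using that mpos by simp
      finally interpret prob_space "density M (\<lambda>z. ennreal (h z / m))"
        by (intro prob_spaceI) simp
      have "prob_space (D h)" unfolding D_def by (rule prob_space_distr) simp
      thus ?thesis by (simp add: real_distribution_def real_distribution_axioms_def D_def)
    qed
    have char_D: "char (D h) t = (\<integral>z. of_real (h z) * iexp (t * X z) \<partial>M) / of_real m"
      if [measurable]: "h \<in> borel_measurable M" and "\<And>z. h z \<ge> 0" for h t
    proof -
      have "char (D h) t = (\<integral>z. iexp (t * X z) \<partial>density M (\<lambda>z. ennreal (h z / m)))"
        unfolding char_def D_def by (subst integral_distr) auto
      also have "\<dots> = (\<integral>z. (h z / m) *\<^sub>R iexp (t * X z) \<partial>M)"
        using that mpos by (subst integral_density) auto
      also have "(\<lambda>z. (h z / m) *\<^sub>R iexp (t * X z)) = (\<lambda>z. of_real (h z) * iexp (t * X z) / of_real m)"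
        by (simp add: scaleR_conv_of_real)
      finally show ?thesis by simp
    qed
    have "char (D p) = char (D q)"
    proof
      fix t
      have i: "integrable M (\<lambda>z. of_real (h z) * iexp (t * X z))" if "integrable M h" for h :: "'a \<Rightarrow> real"
      proof (rule Bochner_Integration.integrable_bound[OF that])
        have [measurable]: "h \<in> borel_measurable M" using that by auto
        show "(\<lambda>z. of_real (h z) * iexp (t * X z)) \<in> borel_measurable M" by measurable
      qed (auto simp: norm_mult)
      have "(\<integral>z. of_real (p z) * iexp (t * X z) \<partial>M) - (\<integral>z. of_real (q z) * iexp (t * X z) \<partial>M) = 0"
        using char0[of t] i[OF ip] i[OF iq] by (simp add: G left_diff_distrib)
      thus "char (D p) t = char (D q) t" using pos by (simp add: char_D)
    qed
    hence D: "D p = D q"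
      using real_dist ip iq pos eq by (intro Levy_uniqueness) (auto simp: m_def)
    have mD: "measure (D h) A = (\<integral>z. h z * indicator A (X z) \<partial>M) / m"
      if [measurable]: "h \<in> borel_measurable M" and "\<And>z. h z \<ge> 0" for h
    proof -
      have "measure (D h) A = (\<integral>x. indicator A x \<partial>D h)" by (simp add: D_def)
      also have "\<dots> = (\<integral>z. indicator A (X z) \<partial>density M (\<lambda>z. ennreal (h z / m)))"
        unfolding D_def by (subst integral_distr) auto
      also have "\<dots> = (\<integral>z. (h z / m) *\<^sub>R indicator A (X z) \<partial>M)"
        using that mpos by (subst integral_density) auto
      finally show ?thesis by simp
    qed
    have *: "(\<integral>z. p z * indicator A (X z) \<partial>M) = (\<integral>z. q z * indicator A (X z) \<partial>M)"
      using mD[of p] mD[of q] pos mpos D by simp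
    have "integrable M (\<lambda>z. h z * indicator A (X z))" if "integrable M h" for h :: "'a \<Rightarrow> real"
    proof (rule Bochner_Integration.integrable_bound[OF that])
      have [measurable]: "h \<in> borel_measurable M" using that by auto
      show "(\<lambda>z. h z * indicator A (X z)) \<in> borel_measurable M" by measurable
    qed (auto simp: indicator_def)
    from this[OF ip] this[OF iq] * show ?thesis by (simp add: G left_diff_distrib)
  qed
qed

lemma moments_determine:
  fixes G :: "'a \<Rightarrow> complex" and X :: "'a \<Rightarrow> real"
  assumes [measurable]: "G \<in> borel_measurable M" "X \<in> borel_measurable M"
    and int: "\<And>c. integrable M (\<lambda>z. G z * of_real (exp (c * \<bar>X z\<bar>)))"
    and mom: "\<And>k. (\<integral>z. G z * of_real (X z ^ k) \<partial>M) = 0"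
    and A[measurable]: "A \<in> sets borel"
  shows "(\<integral>z. G z * indicator A (X z) \<partial>M) = 0"
proof -
  have ik: "integrable M (\<lambda>z. G z * of_real (X z ^ k))" for k
    using int[of 1] by (intro moment_integrable) simp_all
  have G: "integrable M G" using int[of 0] by simp
  have iA: "integrable M (\<lambda>z. G z * indicator A (X z))"
    by (rule Bochner_Integration.integrable_bound[OF G]) (auto simp: indicator_def)
  have "(\<integral>z. Re (G z) * indicator A (X z) \<partial>M) = 0"
  proof (rule moments_determine_real)
    show "integrable M (\<lambda>z. Re (G z) * exp (c * \<bar>X z\<bar>))" for c using integrable_Re[OF int[of c]] by simp
    show "(\<integral>z. Re (G z) * X z ^ k \<partial>M) = 0" for k
      using integral_Re[OF ik[of k]] mom[of k] by (simp del: of_real_power)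
  qed (use A in measurable)
  moreover have "(\<integral>z. Im (G z) * indicator A (X z) \<partial>M) = 0"
  proof (rule moments_determine_real)
    show "integrable M (\<lambda>z. Im (G z) * exp (c * \<bar>X z\<bar>))" for c using integrable_Im[OF int[of c]] by simp
    show "(\<integral>z. Im (G z) * X z ^ k \<partial>M) = 0" for k
      using integral_Im[OF ik[of k]] mom[of k] by (simp del: of_real_power)
  qed (use A in measurable)
  moreover have "Re (G z * indicator A (X z)) = Re (G z) * indicator A (X z)"
    "Im (G z * indicator A (X z)) = Im (G z) * indicator A (X z)" for z
    by (auto simp: indicator_def)
  ultimately show ?thesis
    using integral_Re[OF iA] integral_Im[OF iA] by (simp add: complex_eq_iff)
qed


section \<open>From Hermite polynomials to cylinder sets\<close>

context gauss_seq
begin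

inductive hermite_span :: "(cseq \<Rightarrow> complex) \<Rightarrow> bool" where
  zero: "hermite_span (\<lambda>z. 0)"
| step: "hermite_span p \<Longrightarrow> hermite_span (\<lambda>z. p z + w * hm A B z)"

lemma hermite_span_add:
  assumes "hermite_span p" "hermite_span q"
  shows "hermite_span (\<lambda>z. p z + q z)"
  using assms(2)
proof induction
  case (step q w A B)
  thus ?case using hermite_span.step[of "\<lambda>z. p z + q z" w A B] by (simp add: add.assoc)
qed (use assms(1) in simp)

lemma hermite_span_hm: "hermite_span (\<lambda>z. w * hm A B z)"
  using hermite_span.step[OF hermite_span.zero, of w A B] by simp

lemma hermite_span_coord:
  assumes "hermite_span p" shows "hermite_span (\<lambda>z. z i * p z)"
  using assms
proof induction
  case (step p w A B)
  have "(\<lambda>z. z i * (p z + w * hm A B z))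
      = (\<lambda>z. z i * p z + (w * hm (add_mset i A) B z + (w * of_nat (count B i)) * hm A (B - {#i#}) z))"
  proof
    fix z
    have "z i * (p z + w * hm A B z) = z i * p z + w * (z i * hm A B z)" by (simp add: algebra_simps)
    also have "\<dots> = z i * p z + (w * hm (add_mset i A) B z + (w * of_nat (count B i)) * hm A (B - {#i#}) z)"
      unfolding hermite_mult_coord by (simp add: algebra_simps)
    finally show "z i * (p z + w * hm A B z) = \<dots>" .
  qed
  thus ?case using step by (auto intro!: hermite_span_add hermite_span_hm)
qed (simp add: hermite_span.zero)

text \<open>The raising relation solved for \<open>cnj (z i)\<close>, which is possible because
  \<open>c i > 0\<close>.\<close>

lemma hermite_span_cnj:
  assumes "hermite_span p" shows "hermite_span (\<lambda>z. cnj (z i) * p z)"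
  using assms
proof induction
  case (step p w A B)
  have eq: "(\<lambda>z. cnj (z i) * (p z + w * hm A B z))
      = (\<lambda>z. cnj (z i) * p z + ((w / of_real (c i)) * hm A (add_mset i B) z + (w / of_real (c i) * of_nat (count A i)) * hm (A - {#i#}) B z))"
    using c_pos[of i] by (auto simp: fun_eq_iff hermite_add_right field_simps)
  show ?case unfolding eq by (intro hermite_span_add hermite_span_hm step.IH)
qed (simp add: hermite_span.zero)

lemma hermite_span_poly: "poly_fun p \<Longrightarrow> hermite_span p"
proof (induction rule: poly_fun.induct)
  case (const d)
  show ?case using hermite_span_hm[of d "{#}" "{#}"] by simp
qed (auto intro: hermite_span_add hermite_span_coord hermite_span_cnj)

lemma ip_poly_eq_0:
  assumes g: "g \<in> sq_int Q" "\<And>A B. ip Q g (hm A B) = 0" and p: "poly_fun p"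
  shows "ip Q g p = 0"
proof -
  have "ip Q p g = 0 \<and> p \<in> sq_int Q" using hermite_span_poly[OF p]
  proof induction
    case (step p w A B)
    have "ip Q (hm A B) g = 0" using g(2)[of A B] by (simp add: ip_cnj[of Q "hm A B"])
    thus ?case using step g(1) by (simp add: ip_add_left ip_scale_left sq_int_scale sq_int_add hm_sq_int)
  qed (simp add: ip_def)
  thus ?thesis by (simp add: ip_cnj[of Q g])
qed

text \<open>The flag selects real or imaginary part, so that the moment argument, which is
  one-dimensional, treats both kinds of coordinate alike.\<close>

definition real_coord :: "bool \<times> nat \<Rightarrow> cseq \<Rightarrow> real" where
  "real_coord k z = (if fst k then Re (z (snd k)) else Im (z (snd k)))"

lemma real_coord_cont: "continuous_on UNIV (real_coord k)"
proof (cases "fst k")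
  case True
  have "continuous_on UNIV (\<lambda>z :: cseq. Re (z (snd k)))"
    by (intro continuous_on_Re continuous_on_product_coordinates)
  thus ?thesis using True by (simp add: real_coord_def[abs_def])
next
  case False
  have "continuous_on UNIV (\<lambda>z :: cseq. Im (z (snd k)))"
    by (intro continuous_on_Im continuous_on_product_coordinates)
  thus ?thesis using False by (simp add: real_coord_def[abs_def])
qed

lemma real_coord_measurable[measurable]: "real_coord k \<in> borel_measurable Q"
  by (rule measurable_Q_cont[OF real_coord_cont])

lemma poly_fun_real_coord: "poly_fun p \<Longrightarrow> poly_fun (\<lambda>z. of_real (real_coord k z) * p z)"
  by (cases "fst k") (auto simp: real_coord_def intro: poly_fun_Re poly_fun_Im)

lemma egrow_exp_real_coord: "egrow (\<lambda>z. of_real (exp (d * \<bar>real_coord k z\<bar>)))"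
proof (rule egrowI[of _ 1 "Suc (snd k)" "nat \<lceil>\<bar>d\<bar>\<rceil>"])
  fix z
  let ?s = "\<Sum>i<Suc (snd k). \<bar>Re (z i)\<bar> + \<bar>Im (z i)\<bar>"
  have "\<bar>real_coord k z\<bar> \<le> \<bar>Re (z (snd k))\<bar> + \<bar>Im (z (snd k))\<bar>" by (simp add: real_coord_def)
  also have "\<dots> \<le> ?s" by (simp add: sum_nonneg)
  finally have "\<bar>d\<bar> * \<bar>real_coord k z\<bar> \<le> real (nat \<lceil>\<bar>d\<bar>\<rceil>) * ?s"
    by (intro mult_mono real_nat_ceiling_ge) auto
  moreover have "d * \<bar>real_coord k z\<bar> \<le> \<bar>d\<bar> * \<bar>real_coord k z\<bar>" by (intro mult_right_mono) auto
  ultimately show "cmod (of_real (exp (d * \<bar>real_coord k z\<bar>))) \<le> 1 * ewt (Suc (snd k)) (nat \<lceil>\<bar>d\<bar>\<rceil>) z"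
    by (simp add: ewt_def)
qed

definition cyl :: "((bool \<times> nat) \<times> real set) list \<Rightarrow> cseq set" where
  "cyl xs = {z. \<forall>(k, A)\<in>set xs. real_coord k z \<in> A}"

lemma cyl_measurable:
  assumes "\<And>k A. (k, A) \<in> set xs \<Longrightarrow> A \<in> sets borel"
  shows "cyl xs \<in> sets Q"
  using assms
proof (induction xs)
  case Nil
  show ?case using sets.top[of Q] by (simp add: cyl_def)
next
  case (Cons x xs)
  obtain k A where x: "x = (k, A)" by (cases x)
  have A: "A \<in> sets borel" using Cons.prems[of k A] by (simp add: x)
  have "cyl (x # xs) = (real_coord k -` A \<inter> space Q) \<inter> cyl xs" by (auto simp: cyl_def x)
  moreover have "A \<in> sets borel" if "(k, A) \<in> set xs" for k A using Cons.prems[of k A] that by simp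
  hence "cyl xs \<in> sets Q" by (rule Cons.IH)
  ultimately show ?case using measurable_sets[OF real_coord_measurable A] by simp
qed

text \<open>Polynomial factors are traded for indicators, one real coordinate at a time.\<close>

lemma integral_cyl_eq_0:
  assumes g: "g \<in> sq_int Q" "\<And>A B. ip Q g (hm A B) = 0"
    and xs: "\<And>k A. (k, A) \<in> set xs \<Longrightarrow> A \<in> sets borel" and p: "poly_fun p"
  shows "(\<integral>z. g z * indicator (cyl xs) z * p z \<partial>Q) = 0"
  using xs p
proof (induction xs arbitrary: p)
  case Nil
  have "ip Q g (\<lambda>z. cnj (p z)) = 0" by (rule ip_poly_eq_0[OF g poly_fun_cnj[OF Nil(2)]])
  thus ?case by (simp add: ip_def cyl_def)
next
  case (Cons x xs)
  obtain k A where x: "x = (k, A)" by (cases x)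
  have A: "A \<in> sets borel" using Cons.prems(1)[of k A] by (simp add: x)
  have xs: "A \<in> sets borel" if "(k, A) \<in> set xs" for k A using Cons.prems(1)[of k A] that by simp
  have cyl: "cyl xs \<in> sets Q" by (rule cyl_measurable) (erule xs)
  have gm: "g \<in> borel_measurable Q" using g(1) by (rule sq_int_measurable)
  have pm: "p \<in> borel_measurable Q" by (rule poly_fun_measurable[OF Cons.prems(2)])
  have meas: "(\<lambda>z. g z * indicator (cyl xs) z * p z) \<in> borel_measurable Q"
    by (intro borel_measurable_times gm pm borel_measurable_indicator cyl)
  have em: "(\<lambda>z. complex_of_real (exp (d * \<bar>real_coord k z\<bar>))) \<in> borel_measurable Q" for d
    by (intro measurable_Q_cont continuous_intros real_coord_cont)
  have pk: "poly_fun (\<lambda>z. of_real (real_coord k z ^ n) * p z)" for n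
  proof (induction n)
    case (Suc n)
    from poly_fun_real_coord[OF this, of k] show ?case by (simp add: mult.assoc)
  qed (use Cons.prems in simp)
  \<comment> \<open>The whole product in front plays the role of the density in
    \<open>moments_determine\<close>. Its moments vanish by the induction hypothesis for
    \<open>p\<close> times a power of the new coordinate, which is why \<open>p\<close> is kept
    arbitrary.\<close>
  have "(\<integral>z. (g z * indicator (cyl xs) z * p z) * indicator A (real_coord k z) \<partial>Q) = 0"
  proof (rule moments_determine)
    fix d
    have "(\<lambda>z. of_real (exp (d * \<bar>real_coord k z\<bar>)) * p z) \<in> sq_int Q"
      by (intro egrow_sq_int borel_measurable_times em pm egrow_mult egrow_exp_real_coord egrow_poly Cons.prems)
    hence i: "integrable Q (\<lambda>z. g z * (of_real (exp (d * \<bar>real_coord k z\<bar>)) * p z))"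
      by (rule sq_int_mult_integrable[OF g(1)])
    show "integrable Q (\<lambda>z. g z * indicator (cyl xs) z * p z * of_real (exp (d * \<bar>real_coord k z\<bar>)))"
    proof (rule Bochner_Integration.integrable_bound[OF i])
      show "(\<lambda>z. g z * indicator (cyl xs) z * p z * of_real (exp (d * \<bar>real_coord k z\<bar>))) \<in> borel_measurable Q"
        by (intro borel_measurable_times[OF meas em])
      show "AE z in Q. norm (g z * indicator (cyl xs) z * p z * of_real (exp (d * \<bar>real_coord k z\<bar>)))
          \<le> norm (g z * (of_real (exp (d * \<bar>real_coord k z\<bar>)) * p z))"
        by (intro AE_I2) (simp add: indicator_def norm_mult mult_ac)
    qed
  next
    fix n
    have "(\<integral>z. g z * indicator (cyl xs) z * (of_real (real_coord k z ^ n) * p z) \<partial>Q) = 0"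
      by (rule Cons.IH[OF _ pk]) (erule xs)
    moreover have "(\<lambda>z. g z * indicator (cyl xs) z * p z * complex_of_real (real_coord k z ^ n))
        = (\<lambda>z. g z * indicator (cyl xs) z * (of_real (real_coord k z ^ n) * p z))"
      by (rule ext) (simp only: mult_ac)
    ultimately show "(\<integral>z. g z * indicator (cyl xs) z * p z * of_real (real_coord k z ^ n) \<partial>Q) = 0"
      by (simp only:)
  qed (rule meas real_coord_measurable A)+
  moreover have "g z * indicator (cyl xs) z * p z * indicator A (real_coord k z) = g z * indicator (cyl (x # xs)) z * p z" for z
    by (auto simp: cyl_def x indicator_def)
  ultimately show ?case by simp
qed

definition cyls :: "cseq set set" where
  "cyls = {cyl xs | xs. \<forall>(k, A)\<in>set xs. A \<in> sets borel}"

lemma cyls_Int_stable: "Int_stable cyls"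
proof (rule Int_stableI)
  fix X Y assume "X \<in> cyls" "Y \<in> cyls"
  then obtain xs ys where *: "X = cyl xs" "Y = cyl ys" "\<forall>(k, A)\<in>set xs. A \<in> sets borel" "\<forall>(k, A)\<in>set ys. A \<in> sets borel"
    by (auto simp: cyls_def)
  have "X \<inter> Y = cyl (xs @ ys)" by (auto simp: * cyl_def)
  moreover have "\<forall>(k, A)\<in>set (xs @ ys). A \<in> sets borel" using * by auto
  ultimately show "X \<inter> Y \<in> cyls" unfolding cyls_def by blast
qed

lemma sets_Q_cyls: "sets Q = sigma_sets UNIV cyls"
proof
  have "cyls \<subseteq> sets Q" by (auto simp: cyls_def intro!: cyl_measurable)
  thus "sigma_sets UNIV cyls \<subseteq> sets Q" using sets.sigma_sets_subset[of cyls Q] by simp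
  let ?S = "sigma UNIV cyls"
  have "(\<lambda>z. z) \<in> ?S \<rightarrow>\<^sub>M (\<Pi>\<^sub>M i\<in>UNIV. complex_gauss (\<sigma> i))"
  proof (rule measurable_PiM_single')
    fix i :: nat
    have rc: "real_coord k \<in> borel_measurable ?S" for k
    proof (rule measurableI)
      fix A :: "real set" assume A: "A \<in> sets borel"
      have "real_coord k -` A \<inter> space ?S = cyl [(k, A)]" by (auto simp: cyl_def)
      moreover have "cyl [(k, A)] \<in> cyls" using A unfolding cyls_def by (intro CollectI exI[of _ "[(k, A)]"]) auto
      ultimately show "real_coord k -` A \<inter> space ?S \<in> sets ?S" by (auto intro: sigma_sets.Basic)
    qed simp
    have "(\<lambda>z. of_real (real_coord (True, i) z) + \<i> * of_real (real_coord (False, i) z)) \<in> borel_measurable ?S"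
      using rc by measurable
    also have "(\<lambda>z. of_real (real_coord (True, i) z) + \<i> * of_real (real_coord (False, i) z)) = (\<lambda>z. z i)"
      by (auto simp: real_coord_def complex_eq_iff fun_eq_iff)
    finally show "(\<lambda>z. z i) \<in> ?S \<rightarrow>\<^sub>M complex_gauss (\<sigma> i)"
      by (simp add: measurable_cong_sets[OF refl sets_complex_gauss])
  qed auto
  hence *: "(\<lambda>z. z) \<in> ?S \<rightarrow>\<^sub>M Q" by (simp add: Q_def)
  show "sets Q \<subseteq> sigma_sets UNIV cyls"
  proof
    fix A assume "A \<in> sets Q"
    from measurable_sets[OF * this] show "A \<in> sigma_sets UNIV cyls" by simp
  qed
qed

text \<open>Cylinder sets are stable under intersection and generate the sigma-algebra, so by
  Dynkin's argument \<open>g\<close> integrates to 0 over every measurable set.\<close>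

lemma complete_Q:
  assumes g: "g \<in> sq_int Q" "\<And>A B. ip Q g (hm A B) = 0"
  shows "AE z in Q. g z = 0"
proof -
  have ig: "integrable Q g" by (rule Q.sq_int_integrable1[OF g(1)])
  have si: "set_integrable Q S g" if "S \<in> sets Q" for S
    unfolding set_integrable_def by (rule integrable_mult_indicator[OF that ig])
  have cyls_Pow: "cyls \<subseteq> Pow UNIV" by simp
  have zero: "(LINT z:S|Q. g z) = 0" if S: "S \<in> sets Q" for S
    using cyls_Int_stable cyls_Pow S[unfolded sets_Q_cyls]
  proof (induction rule: sigma_sets_induct_disjoint)
    case (basic S)
    then obtain xs where xs: "S = cyl xs" "\<And>k A. (k, A) \<in> set xs \<Longrightarrow> A \<in> sets borel" by (auto simp: cyls_def)
    have "(\<integral>z. g z * indicator (cyl xs) z * 1 \<partial>Q) = 0"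
      by (rule integral_cyl_eq_0[OF g xs(2) poly_fun.const])
    moreover have "indicat_real S z *\<^sub>R g z = g z * indicator (cyl xs) z * 1" for z
      by (simp add: xs(1) indicator_def)
    ultimately show ?case by (simp add: set_lebesgue_integral_def)
  next
    case (compl S)
    hence S: "S \<in> sets Q" by (simp add: sets_Q_cyls)
    have "(\<integral>z. g z \<partial>Q) = 0"
      using integral_cyl_eq_0[OF g, of "[]" "\<lambda>z. 1"] by (simp add: cyl_def poly_fun.const)
    moreover have "(LINT z:UNIV - S|Q. g z) = (\<integral>z. g z \<partial>Q) - (LINT z:S|Q. g z)"
    proof -
      have "(LINT z:UNIV - S|Q. g z) = (\<integral>z. g z - indicat_real S z *\<^sub>R g z \<partial>Q)"
        unfolding set_lebesgue_integral_def
        by (rule Bochner_Integration.integral_cong) (auto simp: indicator_def)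
      thus ?thesis using si[OF S] ig by (simp only: Bochner_Integration.integral_diff set_integrable_def set_lebesgue_integral_def)
    qed
    ultimately show ?case using compl by simp
  next
    case (union S)
    hence S: "S i \<in> sets Q" for i by (auto simp: sets_Q_cyls)
    have "(LINT z:(\<Union>i. S i)|Q. g z) = (\<Sum>i. LINT z:S i|Q. g z)"
      using S union(1) by (intro lebesgue_integral_countable_add si) (auto simp: disjoint_family_on_def)
    thus ?case using union by simp
  qed (auto simp: set_lebesgue_integral_def)
  have "AE z in Q. Re (g z) = 0"
  proof (rule density_unique_real)
    fix S assume S: "S \<in> sets Q"
    have "(LINT z:S|Q. Re (g z)) = Re (LINT z:S|Q. g z)"
      using integral_Re[OF si[OF S, unfolded set_integrable_def]] by (simp add: set_lebesgue_integral_def)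
    thus "(LINT z:S|Q. Re (g z)) = (LINT z:S|Q. 0)" using zero[OF S] by simp
  qed (use ig in auto)
  moreover have "AE z in Q. Im (g z) = 0"
  proof (rule density_unique_real)
    fix S assume S: "S \<in> sets Q"
    have "(LINT z:S|Q. Im (g z)) = Im (LINT z:S|Q. g z)"
      using integral_Im[OF si[OF S, unfolded set_integrable_def]] by (simp add: set_lebesgue_integral_def)
    thus "(LINT z:S|Q. Im (g z)) = (LINT z:S|Q. 0)" using zero[OF S] by simp
  qed (use ig in auto)
  ultimately show ?thesis by eventually_elim (simp add: complex_eq_iff)
qed

text \<open>Extending \<open>g\<close> by 0 outside \<open>ell2\<close> preserves
  square-integrability and the inner products, which reduces the claim to \<open>Q\<close>.\<close>

lemma complete_P:
  assumes g: "g \<in> sq_int (P r a)" "\<And>A B. ip (P r a) g (hm A B) = 0"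
  shows "AE z in P r a. g z = 0"
proof -
  define g' where "g' = (\<lambda>z. indicat_real ell2 z *\<^sub>R g z)"
  have "g \<in> borel_measurable (restrict_space Q ell2)" using g(1) by (simp add: sq_int_def P_eq)
  hence m: "g' \<in> borel_measurable Q"
    using AE_ell2(1) by (simp add: g'_def borel_measurable_restrict_space_iff)
  have "integrable (restrict_space Q ell2) (\<lambda>z. (cmod (g z))\<^sup>2)" using g(1) by (simp add: sq_int_def P_eq)
  hence "integrable Q (\<lambda>z. indicat_real ell2 z *\<^sub>R (cmod (g z))\<^sup>2)"
    using AE_ell2(1) by (simp add: integrable_restrict_space set_integrable_def)
  moreover have "indicat_real ell2 z *\<^sub>R (cmod (g z))\<^sup>2 = (cmod (g' z))\<^sup>2" for z
    by (simp add: g'_def indicator_def)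
  ultimately have "g' \<in> sq_int Q" using m by (simp add: sq_int_def)
  moreover have "ip Q g' (hm A B) = 0" for A B
  proof -
    have "ip (P r a) g (hm A B) = (\<integral>z. indicat_real ell2 z *\<^sub>R (g z * cnj (hm A B z)) \<partial>Q)"
      unfolding P_eq ip_def using AE_ell2(1)
      by (subst integral_restrict_space) (auto simp: set_lebesgue_integral_def)
    thus ?thesis using g(2)[of A B] by (simp add: ip_def g'_def)
  qed
  ultimately have "AE z in Q. g' z = 0" by (rule complete_Q)
  hence "AE z in Q. z \<in> ell2 \<longrightarrow> g z = 0" by eventually_elim (auto simp: g'_def indicator_def)
  thus ?thesis unfolding P_eq using AE_ell2(1) by (subst AE_restrict_space_iff) auto
qed

end

subsection \<open>Smooth functions\<close>

text \<open>Both real derivatives in one operator, so that every smoothness argument is carried out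
  once for \<open>d \<in> {1, \<i>}\<close>.\<close>

definition D_dir :: "complex \<Rightarrow> nat \<Rightarrow> (cseq \<Rightarrow> complex) \<Rightarrow> cseq \<Rightarrow> complex" where
  "D_dir d i f z = vector_derivative (\<lambda>h::real. f (z(i := z i + d * of_real h))) (at 0)"

lemma D_dir: "D_x i f = D_dir 1 i f" "D_y i f = D_dir \<i> i f"
  by (auto simp: fun_eq_iff D_dir_def D_x_def D_y_def)

lemma D_dir_eqI:
  "(\<And>z. ((\<lambda>h. f (z(i := z i + d * of_real h))) has_vector_derivative f' z) (at 0)) \<Longrightarrow> D_dir d i f = f'"
  unfolding D_dir_def[abs_def] by (rule ext) (rule vector_derivative_at)

lemma C_k_SucI:
  assumes "continuous_on UNIV f"
    and "\<And>d i z. d \<in> {1, \<i>} \<Longrightarrow> ((\<lambda>h. f (z(i := z i + d * of_real h))) has_vector_derivative f' d i z) (at 0)"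
    and "\<And>d i. d \<in> {1, \<i>} \<Longrightarrow> C_k k (f' d i)"
  shows "C_k (Suc k) f"
proof -
  have "D_dir d i f = f' d i" if "d \<in> {1, \<i>}" for d i
    by (rule D_dir_eqI) (rule assms(2)[OF that])
  moreover have "(\<lambda>h. f (z(i := z i + d * of_real h))) differentiable at 0" if "d \<in> {1, \<i>}" for d i z
    using assms(2)[OF that] by (rule differentiableI_vector)
  from this[of 1] this[of "\<i>"]
  have "(\<lambda>h. f (z(i := z i + of_real h))) differentiable at 0"
    "(\<lambda>h. f (z(i := z i + \<i> * of_real h))) differentiable at 0" for i z by simp_all
  ultimately show ?thesis using assms by (simp add: D_dir)
qed

lemma C_k_SucD:
  assumes "C_k (Suc k) f"
  shows "continuous_on UNIV f"
    and "d \<in> {1, \<i>} \<Longrightarrow> ((\<lambda>h. f (z(i := z i + d * of_real h))) has_vector_derivative D_dir d i f z) (at 0)"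
    and "d \<in> {1, \<i>} \<Longrightarrow> C_k k (D_dir d i f)"
  using assms by (auto simp: D_dir D_dir_def vector_derivative_works)

lemma C_k_cont: "C_k k f \<Longrightarrow> continuous_on UNIV f"
  by (cases k) auto

text \<open>Used in the product rule, where one factor remains undifferentiated.\<close>

lemma C_k_mono: "C_k (Suc k) f \<Longrightarrow> C_k k f"
proof (induction k arbitrary: f)
  case 0
  thus ?case by simp
next
  case (Suc k)
  show ?case
  proof (rule C_k_SucI)
    show "continuous_on UNIV f" by (rule C_k_cont[OF Suc.prems])
    show "((\<lambda>h. f (z(i := z i + d * of_real h))) has_vector_derivative D_dir d i f z) (at 0)" if "d \<in> {1, \<i>}" for d i z
      using C_k_SucD(2)[OF Suc.prems that] .
    show "C_k k (D_dir d i f)" if "d \<in> {1, \<i>}" for d i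
      using Suc.IH[OF C_k_SucD(3)[OF Suc.prems that]] .
  qed
qed

lemma C_k_add:
  assumes "C_k k f" "C_k k g"
  shows "C_k k (\<lambda>z. f z + g z)"
  using assms
proof (induction k arbitrary: f g)
  case 0
  thus ?case by (simp add: continuous_on_add)
next
  case (Suc k)
  show ?case
  proof (rule C_k_SucI)
    show "continuous_on UNIV (\<lambda>z. f z + g z)" using Suc.prems by (intro continuous_on_add C_k_cont)
    show "((\<lambda>h. f (z(i := z i + d * of_real h)) + g (z(i := z i + d * of_real h))) has_vector_derivative
        D_dir d i f z + D_dir d i g z) (at 0)" if "d \<in> {1, \<i>}" for d i z
      by (intro has_vector_derivative_add C_k_SucD(2)[OF Suc.prems(1) that] C_k_SucD(2)[OF Suc.prems(2) that])
    show "C_k k (\<lambda>z. D_dir d i f z + D_dir d i g z)" if "d \<in> {1, \<i>}" for d i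
      by (intro Suc.IH C_k_SucD(3)[OF Suc.prems(1) that] C_k_SucD(3)[OF Suc.prems(2) that])
  qed
qed

lemma C_k_mult:
  assumes "C_k k f" "C_k k g"
  shows "C_k k (\<lambda>z. f z * g z)"
  using assms
proof (induction k arbitrary: f g)
  case 0
  thus ?case by (simp add: continuous_on_mult)
next
  case (Suc k)
  show ?case
  proof (rule C_k_SucI)
    show "continuous_on UNIV (\<lambda>z. f z * g z)" using Suc.prems by (intro continuous_on_mult C_k_cont)
    show "((\<lambda>h. f (z(i := z i + d * of_real h)) * g (z(i := z i + d * of_real h))) has_vector_derivative
        f z * D_dir d i g z + D_dir d i f z * g z) (at 0)" if "d \<in> {1, \<i>}" for d i z
      using has_vector_derivative_mult[OF C_k_SucD(2)[OF Suc.prems(1) that, of z i] C_k_SucD(2)[OF Suc.prems(2) that, of z i]]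
      by (simp only: of_real_0 mult_zero_right add_0_right fun_upd_triv)
    show "C_k k (\<lambda>z. f z * D_dir d i g z + D_dir d i f z * g z)" if "d \<in> {1, \<i>}" for d i
      using Suc.IH[OF C_k_mono[OF Suc.prems(1)] C_k_SucD(3)[OF Suc.prems(2) that]]
        Suc.IH[OF C_k_SucD(3)[OF Suc.prems(1) that] C_k_mono[OF Suc.prems(2)]]
      by (rule C_k_add)
  qed
qed

lemma C_k_poly: "poly_fun p \<Longrightarrow> C_k k p"
proof (induction k arbitrary: p)
  case 0
  thus ?case by (simp add: poly_fun_cont)
next
  case (Suc k)
  have "\<forall>d i. \<exists>q. poly_fun q \<and> (\<forall>z. ((\<lambda>h. p (z(i := z i + d * of_real h))) has_vector_derivative q z) (at 0))"
    using poly_fun_deriv[OF Suc.prems] by blast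
  then obtain q where q: "\<And>d i. poly_fun (q d i)"
    "\<And>d i z. ((\<lambda>h. p (z(i := z i + d * of_real h))) has_vector_derivative q d i z) (at 0)"
    by metis
  show ?case
    by (rule C_k_SucI[where f' = q]) (rule poly_fun_cont[OF Suc.prems] q(2) Suc.IH[OF q(1)])+
qed

subsection \<open>Cutoff functions\<close>

text \<open>The functions \<open>p (1 / x) e\<^sup>-\<^sup>1\<^sup>/\<^sup>x\<close>, extended by \<open>0\<close>, are closed under differentiation.\<close>

definition exp_flat :: "real poly \<Rightarrow> real \<Rightarrow> real" where
  "exp_flat p x = (if x > 0 then poly p (1 / x) * exp (- (1 / x)) else 0)"

text \<open>With X = 1/x one has dX/dx = -X^2, so p(X) e^(-X) has derivative X^2 (p - p')(X) e^(-X);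
  the two leading zeros are the factor X^2.\<close>

definition exp_flat_diff :: "real poly \<Rightarrow> real poly" where
  "exp_flat_diff p = pCons 0 (pCons 0 (p - pderiv p))"

lemma poly_div_exp_tendsto_0: "((\<lambda>x. poly p x / exp x) \<longlongrightarrow> (0::real)) at_top"
proof -
  have "((\<lambda>x. \<Sum>i\<le>degree p. coeff p i * (x ^ i / exp x)) \<longlongrightarrow> (\<Sum>i\<le>degree p. coeff p i * 0)) at_top"
    by (intro tendsto_sum tendsto_mult tendsto_const tendsto_power_div_exp_0)
  thus ?thesis by (simp add: poly_altdef sum_divide_distrib)
qed

lemma exp_flat_has_derivative: "(exp_flat p has_real_derivative exp_flat (exp_flat_diff p) x) (at x)"
proof -
  consider "x > 0" | "x < 0" | "x = 0" by linarith
  thus ?thesis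
  proof cases
    case 1
    have "((\<lambda>x. poly p (1 / x) * exp (- (1 / x))) has_real_derivative exp_flat (exp_flat_diff p) x) (at x)"
    proof -
      have "((\<lambda>x. poly p (1 / x)) has_real_derivative poly (pderiv p) (1 / x) * (- (1 / x\<^sup>2))) (at x)"
        using 1 by (intro DERIV_chain2[OF poly_DERIV]) (auto intro!: derivative_eq_intros simp: power2_eq_square)
      moreover have "((\<lambda>x. exp (- (1 / x))) has_real_derivative exp (- (1 / x)) * (1 / x\<^sup>2)) (at x)"
        using 1 by (auto intro!: derivative_eq_intros simp: power2_eq_square)
      ultimately have "((\<lambda>x. poly p (1 / x) * exp (- (1 / x))) has_real_derivative
          poly (pderiv p) (1 / x) * (- (1 / x\<^sup>2)) * exp (- (1 / x)) + exp (- (1 / x)) * (1 / x\<^sup>2) * poly p (1 / x)) (at x)"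
        by (rule DERIV_mult)
      moreover have "poly (pderiv p) (1 / x) * (- (1 / x\<^sup>2)) * exp (- (1 / x)) + exp (- (1 / x)) * (1 / x\<^sup>2) * poly p (1 / x)
          = exp_flat (exp_flat_diff p) x"
        using 1 by (simp add: exp_flat_def exp_flat_diff_def power2_eq_square field_simps)
      ultimately show ?thesis by simp
    qed
    thus ?thesis
      by (rule has_field_derivative_transform_within_open[of _ _ _ "{0<..}"]) (use 1 in \<open>auto simp: exp_flat_def\<close>)
  next
    case 2
    have "((\<lambda>x. 0) has_real_derivative exp_flat (exp_flat_diff p) x) (at x)" using 2 by (simp add: exp_flat_def)
    thus ?thesis
      by (rule has_field_derivative_transform_within_open[of _ _ _ "{..<0}"]) (use 2 in \<open>auto simp: exp_flat_def\<close>)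
  next
    case 3
    have r: "((\<lambda>h. exp_flat p h / h) \<longlongrightarrow> 0) (at_right 0)"
    proof -
      \<comment> \<open>The factor 1/h of the difference quotient raises the polynomial by one
        degree, and the exponential still wins.\<close>
      have "((\<lambda>h. poly (pCons 0 p) (inverse h) / exp (inverse h)) \<longlongrightarrow> 0) (at_right (0::real))"
        by (rule filterlim_compose[OF poly_div_exp_tendsto_0 filterlim_inverse_at_top_right])
      moreover have "eventually (\<lambda>h. poly (pCons 0 p) (inverse h) / exp (inverse h) = exp_flat p h / h) (at_right (0::real))"
        using eventually_at_right_less[of "0::real"]
        by eventually_elim (simp add: exp_flat_def exp_minus field_simps)
      ultimately show ?thesis by (rule Lim_transform_eventually)
    qed
    have l: "((\<lambda>h. exp_flat p h / h) \<longlongrightarrow> 0) (at_left 0)"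
    proof (rule tendsto_eventually)
      show "eventually (\<lambda>h. exp_flat p h / h = 0) (at_left (0::real))"
        using eventually_at_left_real[of "-1" "0::real"] by (rule eventually_mono) (auto simp: exp_flat_def)
    qed
    have "((\<lambda>h. exp_flat p h / h) \<longlongrightarrow> 0) (at 0)" by (rule filterlim_split_at[OF l r])
    thus ?thesis using 3 by (simp add: has_field_derivative_iff exp_flat_def)
  qed
qed

lemma exp_flat_cont: "continuous_on S (exp_flat p)"
proof (rule continuous_at_imp_continuous_on, rule ballI)
  show "isCont (exp_flat p) x" for x by (rule DERIV_isCont[OF exp_flat_has_derivative])
qed

text \<open>The range \<open>x \<le> 1\<close> is the one that \<open>radial\<close> takes; there
  the function vanishes on the negative half-line and is continuous on the compact rest.\<close>

lemma exp_flat_bounded: obtains C where "C \<ge> 0" "\<And>x. x \<le> 1 \<Longrightarrow> \<bar>exp_flat p x\<bar> \<le> C"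
proof -
  have "compact (exp_flat p ` {0..1})" by (intro compact_continuous_image exp_flat_cont) simp
  hence "bounded (exp_flat p ` {0..1})" by (rule compact_imp_bounded)
  then obtain C where C: "\<And>y. y \<in> exp_flat p ` {0..1} \<Longrightarrow> norm y \<le> C"
    unfolding bounded_iff by blast
  show ?thesis
  proof (rule that[of "max 0 C"])
    fix x :: real assume "x \<le> 1"
    show "\<bar>exp_flat p x\<bar> \<le> max 0 C"
    proof (cases "x \<ge> 0")
      case True
      thus ?thesis using C[of "exp_flat p x"] \<open>x \<le> 1\<close> by auto
    qed (simp add: exp_flat_def)
  qed simp
qed

lemma exp_flat_compose_has_derivative:
  assumes "((\<lambda>h. complex_of_real (\<rho> h)) has_vector_derivative \<rho>') (at 0)"
  shows "((\<lambda>h. complex_of_real (exp_flat p (\<rho> h))) has_vector_derivative of_real (exp_flat (exp_flat_diff p) (\<rho> 0)) * \<rho>') (at 0)"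
proof -
  have re: "(\<rho> has_vector_derivative Re \<rho>') (at 0)"
    using bounded_linear.has_vector_derivative[OF bounded_linear_Re assms] by simp
  \<comment> \<open>The complex derivative of a real function is real, which allows the real chain
    rule.\<close>
  have "((\<lambda>h. 0) has_vector_derivative Im \<rho>') (at (0::real))"
    using bounded_linear.has_vector_derivative[OF bounded_linear_Im assms] by simp
  hence im: "Im \<rho>' = 0"
    using vector_derivative_unique_at[OF _ has_vector_derivative_const[of "0::real"]] by blast
  have "((\<lambda>h. exp_flat p (\<rho> h)) has_real_derivative exp_flat (exp_flat_diff p) (\<rho> 0) * Re \<rho>') (at 0)"
    using re by (intro DERIV_chain2[OF exp_flat_has_derivative]) (simp add: has_real_derivative_iff_has_vector_derivative)
  hence "((\<lambda>h. complex_of_real (exp_flat p (\<rho> h))) has_vector_derivative of_real (exp_flat (exp_flat_diff p) (\<rho> 0) * Re \<rho>')) (at 0)"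
    by (intro has_vector_derivative_of_real) (simp add: has_real_derivative_iff_has_vector_derivative)
  moreover have "complex_of_real (Re \<rho>') = \<rho>'" using im by (simp add: complex_eq_iff)
  ultimately show ?thesis by (simp only: of_real_mult)
qed

text \<open>The induction runs for all \<open>p\<close> at once, since differentiation replaces
  \<open>p\<close> by \<open>exp_flat_diff p\<close> and splits off a derivative of \<rho>.\<close>

lemma C_k_flat:
  assumes "\<And>k. C_k k (\<lambda>z. complex_of_real (\<rho> z))"
  shows "C_k k (\<lambda>z. complex_of_real (exp_flat p (\<rho> z)))"
proof (induction k arbitrary: p)
  have "continuous_on UNIV (\<lambda>z. Re (complex_of_real (\<rho> z)))"
    by (intro continuous_on_Re C_k_cont[OF assms[of 0]])
  hence "continuous_on UNIV \<rho>" by simp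
  hence cont: "continuous_on UNIV (\<lambda>z. complex_of_real (exp_flat p (\<rho> z)))" for p
    by (intro continuous_on_of_real continuous_on_compose2[OF exp_flat_cont[of UNIV p]]) auto
  {
    case 0
    show ?case using cont by simp
  next
    case (Suc k)
    show ?case
    proof (rule C_k_SucI)
      show "continuous_on UNIV (\<lambda>z. complex_of_real (exp_flat p (\<rho> z)))" by (rule cont)
      show "((\<lambda>h. complex_of_real (exp_flat p (\<rho> (z(i := z i + d * of_real h))))) has_vector_derivative
          of_real (exp_flat (exp_flat_diff p) (\<rho> z)) * D_dir d i (\<lambda>z. of_real (\<rho> z)) z) (at 0)" if "d \<in> {1, \<i>}" for d i z
        using exp_flat_compose_has_derivative[OF C_k_SucD(2)[OF assms[of "Suc 0"] that, of z i], of p] by simp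
      show "C_k k (\<lambda>z. of_real (exp_flat (exp_flat_diff p) (\<rho> z)) * D_dir d i (\<lambda>z. of_real (\<rho> z)) z)" if "d \<in> {1, \<i>}" for d i
        by (intro C_k_mult Suc C_k_SucD(3)[OF assms[of "Suc k"] that])
    qed
  }
qed

section \<open>Radial cutoffs\<close>

definition radial :: "nat \<Rightarrow> real \<Rightarrow> cseq \<Rightarrow> real" where
  "radial n R z = 1 - (\<Sum>i<n. (cmod (z i))\<^sup>2) / R\<^sup>2"

text \<open>The factor \<open>exp 1\<close> normalises the value at the origin to 1, because
  \<open>exp_flat 1 1 = exp (- 1)\<close>.\<close>

definition cutoff :: "nat \<Rightarrow> real \<Rightarrow> cseq \<Rightarrow> complex" where
  "cutoff n R z = of_real (exp 1 * exp_flat 1 (radial n R z))"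

lemma radial_le_1: "radial n R z \<le> 1"
  by (simp add: radial_def sum_nonneg)

lemma radial_poly: "poly_fun (\<lambda>z. of_real (radial n R z))"
proof -
  have s: "poly_fun (\<lambda>z. \<Sum>i<m. z i * cnj (z i))" for m
    unfolding atLeast0LessThan[symmetric]
    by (induction m) (simp_all add: poly_fun.const poly_fun.add poly_fun.mult_coord poly_fun_coord)
  have "poly_fun (\<lambda>z. 1 - of_real (1 / R\<^sup>2) * (\<Sum>i<n. z i * cnj (z i)))"
    by (intro poly_fun_diff poly_fun.const poly_fun_scale s)
  also have "(\<lambda>z. 1 - of_real (1 / R\<^sup>2) * (\<Sum>i<n. z i * cnj (z i))) = (\<lambda>z. complex_of_real (radial n R z))"
    by (rule ext) (simp add: radial_def complex_norm_square[symmetric])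
  finally show ?thesis .
qed

lemma radial_has_vector_derivative:
  "((\<lambda>h. complex_of_real (radial n R (z(i := z i + d * of_real h)))) has_vector_derivative
     (if i < n then - (d * cnj (z i) + cnj d * z i) / of_real (R\<^sup>2) else 0)) (at 0)"
proof (cases "i < n")
  case True
  have "complex_of_real (radial n R (z(i := z i + d * of_real h)))
      = (1 - (\<Sum>j\<in>{..<n} - {i}. of_real ((cmod (z j))\<^sup>2)) / of_real (R\<^sup>2))
        - ((z i + d * of_real h) * (cnj (z i) + cnj d * of_real h)) / of_real (R\<^sup>2)" for h
  proof -
    have "(\<Sum>j<n. (cmod ((z(i := z i + d * of_real h)) j))\<^sup>2)
        = (cmod (z i + d * of_real h))\<^sup>2 + (\<Sum>j\<in>{..<n} - {i}. (cmod (z j))\<^sup>2)"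
      using True by (subst sum.remove[of _ i]) auto
    moreover have "complex_of_real ((cmod (z i + d * of_real h))\<^sup>2) = (z i + d * of_real h) * (cnj (z i) + cnj d * of_real h)"
      unfolding complex_norm_square by simp
    ultimately show ?thesis unfolding radial_def by (simp add: add_divide_distrib del: of_real_power)
  qed
  moreover have "((\<lambda>h. (1 - (\<Sum>j\<in>{..<n} - {i}. of_real ((cmod (z j))\<^sup>2)) / of_real (R\<^sup>2))
        - ((z i + d * of_real h) * (cnj (z i) + cnj d * of_real h)) / of_real (R\<^sup>2)) has_vector_derivative
      - (d * cnj (z i) + cnj d * z i) / of_real (R\<^sup>2)) (at 0)"
  proof -
    have l: "((\<lambda>h. w + v * complex_of_real h) has_vector_derivative v) (at 0)" for w v
      by (auto intro!: derivative_eq_intros simp: has_vector_derivative_def scaleR_conv_of_real mult.commute)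
    from has_vector_derivative_mult[OF l[of "z i" d] l[of "cnj (z i)" "cnj d"]]
    have "((\<lambda>h. (z i + d * of_real h) * (cnj (z i) + cnj d * of_real h)) has_vector_derivative (z i * cnj d + d * cnj (z i))) (at 0)"
      by simp
    from has_vector_derivative_diff[OF has_vector_derivative_const has_vector_derivative_divide[OF this, of "of_real (R\<^sup>2)"]]
    show ?thesis
      by (rule has_vector_derivative_eq_rhs) (simp add: algebra_simps add_divide_distrib diff_divide_distrib)
  qed
  ultimately show ?thesis using True by simp
next
  case False
  hence "radial n R (z(i := w)) = radial n R z" for w by (auto simp: radial_def intro!: sum.cong)
  thus ?thesis using False by simp
qed

lemma cutoff_has_vector_derivative:
  "((\<lambda>h. cutoff n R (z(i := z i + d * of_real h))) has_vector_derivative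
     of_real (exp 1 * exp_flat (exp_flat_diff 1) (radial n R z)) *
     (if i < n then - (d * cnj (z i) + cnj d * z i) / of_real (R\<^sup>2) else 0)) (at 0)"
  unfolding cutoff_def of_real_mult mult.assoc
  using has_vector_derivative_mult_right[OF exp_flat_compose_has_derivative[OF radial_has_vector_derivative[of n R z i d], of 1], of "of_real (exp 1)"]
  by simp

lemma C_k_cutoff: "C_k k (cutoff n R)"
proof -
  have "C_k k (\<lambda>z. of_real (exp 1) * of_real (exp_flat 1 (radial n R z)))"
    by (intro C_k_mult C_k_flat C_k_poly radial_poly poly_fun.const)
  thus ?thesis by (simp add: cutoff_def[abs_def])
qed

lemma cutoff_bounds: "cmod (cutoff n R z) \<le> 1"
proof (cases "radial n R z > 0")
  case True
  have "1 \<le> 1 / radial n R z" using True radial_le_1[of n R z] by simp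
  hence "exp 1 * exp (- (1 / radial n R z)) \<le> 1" by (simp flip: exp_add)
  thus ?thesis using True by (simp add: cutoff_def exp_flat_def norm_mult)
qed (simp add: cutoff_def exp_flat_def)

lemma cutoff_tendsto: "(\<lambda>m. cutoff n (real (Suc m)) z) \<longlonglongrightarrow> 1"
proof -
  let ?s = "\<Sum>i<n. (cmod (z i))\<^sup>2"
  have "(\<lambda>m. 1 - ?s * (inverse (real (Suc m)))\<^sup>2) \<longlonglongrightarrow> 1 - ?s * 0\<^sup>2"
    by (intro tendsto_intros LIMSEQ_inverse_real_of_nat)
  moreover have "radial n (real (Suc m)) z = 1 - ?s * (inverse (real (Suc m)))\<^sup>2" for m
    by (simp only: radial_def divide_inverse power_inverse)
  ultimately have lim: "(\<lambda>m. radial n (real (Suc m)) z) \<longlonglongrightarrow> 1" by simp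
  have "(\<lambda>m. exp_flat 1 (radial n (real (Suc m)) z)) \<longlonglongrightarrow> exp_flat 1 1"
    by (rule isCont_tendsto_compose[OF DERIV_isCont[OF exp_flat_has_derivative] lim])
  hence "(\<lambda>m. cutoff n (real (Suc m)) z) \<longlonglongrightarrow> of_real (exp 1 * exp_flat 1 1)"
    unfolding cutoff_def by (intro tendsto_intros)
  thus ?thesis by (simp add: exp_flat_def flip: exp_add of_real_mult)
qed

lemma cutoff_poly_Cc_infty:
  assumes p: "poly_fun p" and n: "n \<ge> 1" "\<And>z w. \<forall>i<n. z i = w i \<Longrightarrow> p z = p w" and R: "R > 0"
  shows "(\<lambda>z. p z * cutoff n R z) \<in> Cc_infty"
proof -
  have "\<forall>z w. (\<forall>i<n. z i = w i) \<longrightarrow> p z * cutoff n R z = p w * cutoff n R w"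
  proof (intro allI impI)
    fix z w :: cseq assume *: "\<forall>i<n. z i = w i"
    have "cutoff n R z = cutoff n R w" using * by (simp add: cutoff_def radial_def)
    thus "p z * cutoff n R z = p w * cutoff n R w" using n(2)[OF *] by simp
  qed
  moreover have "\<forall>k. C_k k (\<lambda>z. p z * cutoff n R z)"
    using C_k_mult[OF C_k_poly[OF p] C_k_cutoff] by simp
  moreover have "\<forall>z. p z * cutoff n R z \<noteq> 0 \<longrightarrow> (\<forall>i<n. cmod (z i) \<le> R)"
  proof (intro allI impI)
    fix z i assume nz: "p z * cutoff n R z \<noteq> 0" and i: "i < n"
    have "radial n R z > 0"
    proof (rule ccontr)
      assume "\<not> radial n R z > 0"
      hence "cutoff n R z = 0" by (simp add: cutoff_def exp_flat_def)
      thus False using nz by simp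
    qed
    hence "(\<Sum>i<n. (cmod (z i))\<^sup>2) < R\<^sup>2" using R by (simp add: radial_def)
    moreover have "(cmod (z i))\<^sup>2 \<le> (\<Sum>i<n. (cmod (z i))\<^sup>2)" 
      using member_le_sum[of i "{..<n}" "\<lambda>i. (cmod (z i))\<^sup>2"] i by simp
    ultimately have "(cmod (z i))\<^sup>2 \<le> R\<^sup>2" by linarith
    thus "cmod (z i) \<le> R" by (rule power2_le_imp_le) (use R in simp)
  qed
  ultimately show ?thesis unfolding Cc_infty_def
    by (intro CollectI exI[of _ n] conjI n(1) exI[of _ R])
qed

context gauss_seq
begin

subsection \<open>Test functions\<close>

text \<open>The support is not compact in the space of sequences. As \<open>f\<close> ignores the
  coordinates from \<open>n\<close> on, these may be set to 0, and what remains ranges over a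
  compact product of discs and points.\<close>

lemma cylinder_bounded:
  fixes f :: "cseq \<Rightarrow> complex"
  assumes f: "continuous_on UNIV f" "\<And>z w. \<forall>i<n. z i = w i \<Longrightarrow> f z = f w"
    and R: "\<And>z i. f z \<noteq> 0 \<Longrightarrow> i < n \<Longrightarrow> cmod (z i) \<le> R"
  shows "\<exists>C. \<forall>z. cmod (f z) \<le> C"
proof -
  define K where "K = (PiE (UNIV :: nat set) (\<lambda>i. if i < n then cball (0 :: complex) R else {0}))"
  have "compactin (product_topology (\<lambda>i. euclidean) UNIV) K"
    unfolding K_def compactin_PiE by (simp add: compactin_euclidean_iff)
  hence "compact K" by (simp only: euclidean_product_topology compactin_euclidean_iff)
  hence "compact (f ` K)" by (rule compact_continuous_image[OF continuous_on_subset[OF f(1) subset_UNIV]])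
  hence "bounded (f ` K)" by (rule compact_imp_bounded)
  then obtain C where C: "\<And>y. y \<in> f ` K \<Longrightarrow> norm y \<le> C" unfolding bounded_iff by blast
  have "cmod (f z) \<le> max 0 C" for z
  proof (cases "f z = 0")
    case False
    define w where "w = (\<lambda>i. if i < n then z i else 0)"
    have "f z = f w" by (rule f(2)) (simp add: w_def)
    moreover have "w \<in> K" using R[OF False] by (auto simp: K_def w_def)
    ultimately show ?thesis using C[of "f z"] by auto
  qed simp
  thus ?thesis by blast
qed

text \<open>Derivatives of a test function depend on the same coordinates and have support in the
  same polydisc, so that \<open>cylinder_bounded\<close> bounds them as well.\<close>

lemma D_dir_support:
  assumes cyl: "\<And>z w. \<forall>i<n. z i = w i \<Longrightarrow> f z = f w"
    and R: "\<And>z i. f z \<noteq> 0 \<Longrightarrow> i < n \<Longrightarrow> cmod (z i) \<le> R"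
  shows "\<forall>i<n. z i = w i \<Longrightarrow> D_dir d i f z = D_dir d i f w"
    and "D_dir d i f z \<noteq> 0 \<Longrightarrow> j < n \<Longrightarrow> cmod (z j) \<le> R"
proof -
  assume *: "\<forall>i<n. z i = w i"
  have "f (z(i := z i + d * of_real h)) = f (w(i := w i + d * of_real h))" for h
  proof (cases "i < n")
    case True
    thus ?thesis using * by (intro cyl) simp
  next
    case False
    hence "f (z(i := z i + d * of_real h)) = f z" "f (w(i := w i + d * of_real h)) = f w" by (auto intro!: cyl)
    thus ?thesis using cyl[OF *] by simp
  qed
  thus "D_dir d i f z = D_dir d i f w" by (simp add: D_dir_def)
next
  assume nz: "D_dir d i f z \<noteq> 0" and j: "j < n"
  show "cmod (z j) \<le> R"
  proof (rule ccontr)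
    assume out: "\<not> cmod (z j) \<le> R"
    \<comment> \<open>For steps in this neighbourhood of 0 the point stays outside the polydisc,
      where \<open>f\<close> vanishes.\<close>
    define S where "S = {h::real. R < cmod ((z(i := z i + d * of_real h)) j)}"
    have "open S" unfolding S_def
      by (cases "i = j") (auto intro!: open_Collect_less continuous_intros)
    moreover have "0 \<in> S" using out by (auto simp: S_def not_le)
    moreover have "0 = f (z(i := z i + d * of_real h))" if "h \<in> S" for h
      using that R[of "z(i := z i + d * of_real h)" j] j by (force simp: S_def)
    ultimately have "((\<lambda>h. f (z(i := z i + d * of_real h))) has_vector_derivative 0) (at 0)"
      by (intro has_vector_derivative_transform_within_open[OF has_vector_derivative_const[of 0]])
    hence "D_dir d i f z = 0" unfolding D_dir_def by (rule vector_derivative_at)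
    thus False using nz by simp
  qed
qed

lemma tame_Cc_infty:
  assumes "f \<in> Cc_infty" shows "tame f"
proof -
  obtain n R where cyl: "\<And>z w. \<forall>i<n. z i = w i \<Longrightarrow> f z = f w" and C: "\<And>k. C_k k f"
    and R: "\<And>z i. f z \<noteq> 0 \<Longrightarrow> i < n \<Longrightarrow> cmod (z i) \<le> R"
    using assms unfolding Cc_infty_def by blast
  have grow: "egrow h" if h: "continuous_on UNIV h" "\<And>z w. \<forall>i<n. z i = w i \<Longrightarrow> h z = h w"
    "\<And>z i. h z \<noteq> 0 \<Longrightarrow> i < n \<Longrightarrow> cmod (z i) \<le> R" for h
  proof -
    obtain B where "\<And>z. cmod (h z) \<le> B" using cylinder_bounded[of h n R] h by blast
    thus ?thesis by (rule egrow_bounded)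
  qed
  have c: "continuous_on UNIV f" by (rule C_k_cont[OF C[of 0]])
  have gf: "egrow f" by (rule grow[OF c]) (fact cyl R)+
  have D: "continuous_on UNIV (D_dir d i f) \<and> egrow (D_dir d i f) \<and>
      (\<forall>z. ((\<lambda>h. f (z(i := z i + d * of_real h))) has_vector_derivative D_dir d i f z) (at 0))"
    if "d \<in> {1, \<i>}" for d i
  proof (intro conjI allI)
    show cD: "continuous_on UNIV (D_dir d i f)"
      by (rule C_k_cont[OF C_k_SucD(3)[OF C[of "Suc 0"] that]])
    show "egrow (D_dir d i f)"
    proof (rule grow[OF cD])
      show "D_dir d i f z = D_dir d i f w" if "\<forall>i<n. z i = w i" for z w
        by (rule D_dir_support(1)[where n = n and f = f and R = R]) (fact cyl R that)+
      show "cmod (z j) \<le> R" if "D_dir d i f z \<noteq> 0" "j < n" for z j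
        by (rule D_dir_support(2)[where n = n and f = f and R = R]) (fact cyl R that)+
    qed
    show "((\<lambda>h. f (z(i := z i + d * of_real h))) has_vector_derivative D_dir d i f z) (at 0)" for z
      by (rule C_k_SucD(2)[OF C[of "Suc 0"] that])
  qed
  show ?thesis unfolding tame_def D_dir
    using c gf D[of 1] D[of "\<i>"] by simp
qed

lemma del_cutoff:
  "del i (cutoff n R) z = of_real (exp 1 * exp_flat (exp_flat_diff 1) (radial n R z)) *
     (if i < n then - cnj (z i) / of_real (R\<^sup>2) else 0)"
proof -
  have "D_dir d i (cutoff n R) z = of_real (exp 1 * exp_flat (exp_flat_diff 1) (radial n R z)) *
     (if i < n then - (d * cnj (z i) + cnj d * z i) / of_real (R\<^sup>2) else 0)" for d
    unfolding D_dir_def by (rule vector_derivative_at[OF cutoff_has_vector_derivative])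
  thus ?thesis by (simp add: del_def D_dir add_divide_distrib diff_divide_distrib algebra_simps)
qed

lemma delta_mult_cutoff:
  assumes p: "poly_fun p"
  shows "delta r a i (\<lambda>z. p z * cutoff n R z) z = cutoff n R z * delta r a i p z + p z * del i (cutoff n R) z"
proof -
  have "D_dir d i (\<lambda>z. p z * cutoff n R z) z = p z * D_dir d i (cutoff n R) z + D_dir d i p z * cutoff n R z"
    if "d \<in> {1, \<i>}" for d
    unfolding D_dir_def[of d i "\<lambda>z. p z * cutoff n R z"]
    using has_vector_derivative_mult[OF C_k_SucD(2)[OF C_k_poly[OF p] that, of z i] C_k_SucD(2)[OF C_k_cutoff that, of n R z i]]
    by (intro vector_derivative_at) (simp only: of_real_0 mult_zero_right add_0_right fun_upd_triv)
  from this[of 1] this[of "\<i>"] show ?thesis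
    by (simp add: delta_def del_def D_dir add_divide_distrib diff_divide_distrib algebra_simps)
qed

lemma ip_tendsto_dominated:
  assumes g: "g \<in> sq_int M" and H: "H \<in> sq_int M" and h: "\<And>m. h m \<in> borel_measurable M"
    and lim: "\<And>z. (\<lambda>m. h m z) \<longlonglongrightarrow> h' z" and h': "h' \<in> borel_measurable M"
    and dom: "\<And>m z. cmod (h m z) \<le> cmod (H z)"
  shows "(\<lambda>m. ip M g (h m)) \<longlonglongrightarrow> ip M g h'"
  unfolding ip_def
proof (rule integral_dominated_convergence)
  show "integrable M (\<lambda>z. cmod (g z * H z))" by (intro integrable_norm sq_int_mult_integrable g H)
  show "AE z in M. (\<lambda>m. g z * cnj (h m z)) \<longlonglongrightarrow> g z * cnj (h' z)"
    by (intro AE_I2 tendsto_intros lim)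
  show "AE z in M. norm (g z * cnj (h m z)) \<le> cmod (g z * H z)" for m
    using dom by (intro AE_I2) (simp add: norm_mult mult_left_mono)
qed (use g h h' in measurable)

text \<open>The products of \<open>p\<close> with growing cutoffs are test functions. The derivative
  falling on the cutoff tends to 0, and everything is dominated by square-integrable functions, so
  both sides converge to their values at \<open>p\<close>.\<close>

lemma weak_identity_extends:
  assumes u: "\<And>i. i \<in> S \<Longrightarrow> u i \<in> sq_int (P r a)" and g: "g \<in> sq_int (P r a)"
    and weak: "\<And>\<phi>. \<phi> \<in> Cc_infty \<Longrightarrow> ip (P r a) g \<phi> = - (\<Sum>i\<in>S. w i * ip (P r a) (u i) (delta r a i \<phi>))"
    and p: "poly_fun p"
  shows "ip (P r a) g p = - (\<Sum>i\<in>S. w i * ip (P r a) (u i) (delta r a i p))"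
proof -
  obtain n0 where n0: "\<And>z w. \<forall>i<n0. z i = w i \<Longrightarrow> p z = p w"
    using poly_fun_cylinder[OF p] by blast
  \<comment> \<open>\<open>Cc_infty\<close> asks for at least one coordinate, also when
    \<open>p\<close> is constant.\<close>
  define n where "n = Suc n0"
  define \<phi> where "\<phi> = (\<lambda>m z. p z * cutoff n (real (Suc m)) z)"
  have \<phi>: "\<phi> m \<in> Cc_infty" for m
    unfolding \<phi>_def
  proof (rule cutoff_poly_Cc_infty[OF p])
    show "p z = p w" if "\<forall>i<n. z i = w i" for z w using that by (intro n0) (simp add: n_def)
  qed (simp_all add: n_def)
  have tp: "tame p" by (rule tame_poly[OF p])
  have lim1: "(\<lambda>m. ip (P r a) g (\<phi> m)) \<longlonglongrightarrow> ip (P r a) g p"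
  proof (rule ip_tendsto_dominated[OF g])
    show "p \<in> sq_int (P r a)" by (rule sq_int_P[OF tame_sq_int(1)[OF tp]])
    show "\<phi> m \<in> borel_measurable (P r a)" for m
      by (rule sq_int_measurable[OF sq_int_P[OF tame_sq_int(1)[OF tame_Cc_infty[OF \<phi>]]]])
    show "p \<in> borel_measurable (P r a)" by (rule sq_int_measurable[OF sq_int_P[OF tame_sq_int(1)[OF tp]]])
    show "(\<lambda>m. \<phi> m z) \<longlonglongrightarrow> p z" for z
      using tendsto_mult[OF tendsto_const[of "p z"] cutoff_tendsto[of n z]] by (simp add: \<phi>_def)
    show "cmod (\<phi> m z) \<le> cmod (p z)" for m z
      using cutoff_bounds[of n "real (Suc m)" z] by (simp add: \<phi>_def norm_mult mult_left_le)
  qed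
  obtain C where C: "C \<ge> 0" "\<And>x. x \<le> 1 \<Longrightarrow> \<bar>exp_flat (exp_flat_diff 1) x\<bar> \<le> C" by (rule exp_flat_bounded[of "exp_flat_diff 1"]) blast
  have lim2: "(\<lambda>m. ip (P r a) (u i) (delta r a i (\<phi> m))) \<longlonglongrightarrow> ip (P r a) (u i) (delta r a i p)" if i: "i \<in> S" for i
  proof (rule ip_tendsto_dominated[OF u[OF i]])
    define H where "H = (\<lambda>z. complex_of_real (cmod (delta r a i p z) + exp 1 * C * cmod (cnj (z i) * p z)))"
    have abs: "(\<lambda>z. complex_of_real (cmod (h z))) \<in> sq_int (P r a)" if "h \<in> sq_int Q" for h
      using sq_int_P[OF that] by (auto simp: sq_int_def)
    have "(\<lambda>z. of_real (cmod (delta r a i p z)) + of_real (exp 1 * C) * of_real (cmod (cnj (z i) * p z))) \<in> sq_int (P r a)"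
      by (intro sq_int_add sq_int_scale abs delta_sq_int tp tame_sq_int)
    thus "H \<in> sq_int (P r a)" by (simp add: H_def)
    show "delta r a i (\<phi> m) \<in> borel_measurable (P r a)" for m
      by (rule sq_int_measurable[OF sq_int_P[OF delta_sq_int[OF tame_Cc_infty[OF \<phi>]]]])
    show "delta r a i p \<in> borel_measurable (P r a)"
      by (rule sq_int_measurable[OF sq_int_P[OF delta_sq_int[OF tp]]])
    \<comment> \<open>With radius R the derivative carries \<open>cnj (z i)\<close> divided by R^2.
      One factor 1/R is kept for the limit; the other is bounded by 1.\<close>
    have del_bound: "cmod (del i (cutoff n (real (Suc m))) z) \<le> exp 1 * C * cmod (z i) * inverse (real (Suc m))" for m z
    proof -
      have "cmod (if i < n then - cnj (z i) / of_real ((real (Suc m))\<^sup>2) else 0) \<le> cmod (z i) * inverse (real (Suc m))"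
      proof -
        have "inverse ((real (Suc m))\<^sup>2) \<le> inverse (real (Suc m))"
          by (intro le_imp_inverse_le) (auto simp: power2_eq_square)
        hence "cmod (z i) * inverse ((real (Suc m))\<^sup>2) \<le> cmod (z i) * inverse (real (Suc m))" by (rule mult_left_mono) simp
        thus ?thesis by (simp add: norm_divide norm_mult norm_inverse norm_power divide_inverse del: of_nat_Suc)
      qed
      moreover have "cmod (of_real (exp 1 * exp_flat (exp_flat_diff 1) (radial n (real (Suc m)) z))) \<le> exp 1 * C"
        unfolding norm_of_real abs_mult abs_exp_cancel
        by (intro mult_left_mono C(2) radial_le_1) simp
      ultimately have "cmod (del i (cutoff n (real (Suc m))) z) \<le> (exp 1 * C) * (cmod (z i) * inverse (real (Suc m)))"
        unfolding del_cutoff norm_mult[of "of_real (exp 1 * exp_flat (exp_flat_diff 1) (radial n (real (Suc m)) z))"]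
        using C(1) by (intro mult_mono) auto
      thus ?thesis by (simp only: mult.assoc)
    qed
    show "(\<lambda>m. delta r a i (\<phi> m) z) \<longlonglongrightarrow> delta r a i p z" for z
    proof -
      have "(\<lambda>m. exp 1 * C * cmod (z i) * inverse (real (Suc m))) \<longlonglongrightarrow> 0"
        by (intro tendsto_mult_right_zero LIMSEQ_inverse_real_of_nat)
      hence "(\<lambda>m. del i (cutoff n (real (Suc m))) z) \<longlonglongrightarrow> 0"
        by (rule Lim_null_comparison[OF always_eventually, rotated]) (intro allI del_bound)
      hence "(\<lambda>m. cutoff n (real (Suc m)) z * delta r a i p z + p z * del i (cutoff n (real (Suc m))) z)
          \<longlonglongrightarrow> 1 * delta r a i p z + p z * 0"
        by (intro tendsto_add tendsto_mult tendsto_const cutoff_tendsto)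
      thus ?thesis by (simp add: \<phi>_def delta_mult_cutoff[OF p] del: of_nat_Suc)
    qed
    show "cmod (delta r a i (\<phi> m) z) \<le> cmod (H z)" for m z
    proof -
      have "cmod (delta r a i (\<phi> m) z)
          \<le> cmod (cutoff n (real (Suc m)) z) * cmod (delta r a i p z) + cmod (p z) * cmod (del i (cutoff n (real (Suc m))) z)"
        unfolding \<phi>_def delta_mult_cutoff[OF p] norm_mult[symmetric] by (rule norm_triangle_ineq)
      also have "\<dots> \<le> 1 * cmod (delta r a i p z) + cmod (p z) * (exp 1 * C * cmod (z i))"
      proof (intro add_mono mult_mono cutoff_bounds order_refl)
        have "inverse (real (Suc m)) \<le> 1" by (simp add: inverse_le_1_iff)
        hence "exp 1 * C * cmod (z i) * inverse (real (Suc m)) \<le> exp 1 * C * cmod (z i) * 1"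
          using C(1) by (intro mult_left_mono) auto
        thus "cmod (del i (cutoff n (real (Suc m))) z) \<le> exp 1 * C * cmod (z i)"
          using del_bound[of m z] by linarith
      qed auto
      also have "\<dots> = cmod (delta r a i p z) + exp 1 * C * cmod (cnj (z i) * p z)"
        by (simp add: norm_mult)
      also have "\<dots> \<le> cmod (H z)" unfolding H_def norm_of_real by (rule abs_ge_self)
      finally show ?thesis .
    qed
  qed
  have "(\<lambda>m. - (\<Sum>i\<in>S. w i * ip (P r a) (u i) (delta r a i (\<phi> m)))) \<longlonglongrightarrow> - (\<Sum>i\<in>S. w i * ip (P r a) (u i) (delta r a i p))"
    by (intro tendsto_minus tendsto_sum tendsto_mult tendsto_const lim2)
  hence "(\<lambda>m. ip (P r a) g (\<phi> m)) \<longlonglongrightarrow> - (\<Sum>i\<in>S. w i * ip (P r a) (u i) (delta r a i p))"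
    by (simp add: weak[OF \<phi>])
  from LIMSEQ_unique[OF lim1 this] show ?thesis .
qed


subsection \<open>The solution\<close>

lemma L2_eq: "L2 r a = sq_int (P r a)"
  by (simp add: L2_def sq_int_def)

lemma weak_rhs:
  assumes f: "\<And>J. J \<in> MI t \<Longrightarrow> f J \<in> sq_int (P r a)" and K: "K \<in> MI (t + 1)" and \<phi>: "tame \<phi>"
  shows "(\<integral>z. (\<Sum>\<^sub>\<infinity>i. \<Sum>\<^sub>\<infinity>J\<in>MI t. of_int (eps K i J) * f J z * cnj (delta r a i \<phi> z)) \<partial>P r a)
    = (\<Sum>i\<in>set K. of_int (sg i K) * ip (P r a) (f (remove1 i K)) (delta r a i \<phi>))"
proof -
  have K: "K \<in> MI (Suc t)" using K by simp
  have "(\<integral>z. (\<Sum>\<^sub>\<infinity>i. \<Sum>\<^sub>\<infinity>J\<in>MI t. of_int (eps K i J) * f J z * cnj (delta r a i \<phi> z)) \<partial>P r a)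
    = (\<integral>z. (\<Sum>i\<in>set K. of_int (sg i K) * (f (remove1 i K) z * cnj (delta r a i \<phi> z))) \<partial>P r a)"
    using infsum_eps[OF K, of "\<lambda>i J. f J _ * cnj (delta r a i \<phi> _)"] by (simp only: mult.assoc)
  also have "\<dots> = (\<Sum>i\<in>set K. \<integral>z. of_int (sg i K) * (f (remove1 i K) z * cnj (delta r a i \<phi> z)) \<partial>P r a)"
    by (intro Bochner_Integration.integral_sum integrable_mult_right sq_int_ip_integrable f MI_remove1[OF K]
        sq_int_P[OF delta_sq_int[OF \<phi>]])
  also have "\<dots> = (\<Sum>i\<in>set K. of_int (sg i K) * ip (P r a) (f (remove1 i K)) (delta r a i \<phi>))"
    by (simp only: integral_mult_right_zero ip_def)
  finally show ?thesis .
qed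

lemma complete_e:
  assumes "g \<in> sq_int (P r a)" "\<And>i. ip (P r a) g (e i) = 0"
  shows "AE z in P r a. g z = 0"
proof (rule complete_P[OF assms(1)])
  fix A B
  have "of_real (1 / sqrt (N A B)) * ip (P r a) g (hm A B) = 0"
    unfolding ip_e_right[symmetric] by (rule assms(2))
  moreover have "complex_of_real (1 / sqrt (N A B)) \<noteq> 0" using N_pos[of A B] by simp
  ultimately show "ip (P r a) g (hm A B) = 0" by (simp only: mult_eq_0_iff simp_thms)
qed

text \<open>With an empty index set \<open>weak_identity_extends\<close> says that orthogonality to
  the test functions implies orthogonality to the polynomials.\<close>

lemma complete_Cc_infty:
  assumes g: "g \<in> sq_int (P r a)" and "\<And>\<phi>. \<phi> \<in> Cc_infty \<Longrightarrow> ip (P r a) g \<phi> = 0"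
  shows "AE z in P r a. g z = 0"
proof (rule complete_P[OF g])
  fix A B
  have "ip (P r a) g (hm A B) = - (\<Sum>i\<in>{}. 0 * ip (P r a) (\<lambda>z. 0) (delta r a i (hm A B)))"
  proof (rule weak_identity_extends[OF _ g _ poly_fun_hermite])
    show "ip (P r a) g \<phi> = - (\<Sum>i\<in>{}. 0 * ip (P r a) (\<lambda>z. 0) (delta r a i \<phi>))" if "\<phi> \<in> Cc_infty" for \<phi>
      using assms(2)[OF that] by simp
  qed simp
  thus "ip (P r a) g (hm A B) = 0" by simp
qed

lemma parseval_hm:
  assumes f: "f \<in> sq_int (P r a)" and g: "g \<in> sq_int (P r a)"
  shows "((\<lambda>(A, B). ip (P r a) f (hm A B) * cnj (ip (P r a) g (hm A B)) / of_real (N A B)) has_sum ip (P r a) f g) UNIV"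
proof -
  have "ip (P r a) f (e x) * cnj (ip (P r a) g (e x))
      = (case x of (A, B) \<Rightarrow> ip (P r a) f (hm A B) * cnj (ip (P r a) g (hm A B)) / of_real (N A B))" for x
  proof -
    obtain A B where x: "x = (A, B)" by (cases x)
    have "complex_of_real (1 / sqrt (N A B)) * of_real (1 / sqrt (N A B)) = 1 / of_real (N A B)"
    proof -
      have "1 / sqrt (N A B) * (1 / sqrt (N A B)) = 1 / N A B" using N_pos[of A B] by simp
      hence "complex_of_real (1 / sqrt (N A B)) * of_real (1 / sqrt (N A B)) = of_real (1 / N A B)"
        by (simp only: of_real_mult[symmetric])
      thus ?thesis by simp
    qed
    moreover have "(k * p) * (k * q) = p * q / n" if "k * k = 1 / n" for k p q n :: complex
    proof -
      have "(k * p) * (k * q) = (k * k) * (p * q)" by (simp only: mult_ac)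
      thus ?thesis by (simp add: that)
    qed
    ultimately have "(of_real (1 / sqrt (N A B)) * p) * (of_real (1 / sqrt (N A B)) * q) = p * q / of_real (N A B)" for p q :: complex
      by blast
    thus ?thesis by (simp only: x ip_e_right prod.case complex_cnj_mult complex_cnj_complex_of_real)
  qed
  thus ?thesis using E.parseval[OF complete_e f g] by simp
qed

lemma bessel_hm:
  assumes "finite S" "f \<in> sq_int (P r a)"
  shows "(\<Sum>(A, B)\<in>S. (cmod (ip (P r a) f (hm A B)))\<^sup>2 / N A B) \<le> nsq (P r a) f"
proof -
  have "(cmod (ip (P r a) f (e x)))\<^sup>2 = (case x of (A, B) \<Rightarrow> (cmod (ip (P r a) f (hm A B)))\<^sup>2 / N A B)" for x
  proof -
    obtain A B where x: "x = (A, B)" by (cases x)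
    show ?thesis
      using N_pos[of A B] by (simp add: x ip_e_right norm_mult norm_divide power_mult_distrib power_divide less_imp_le)
  qed
  thus ?thesis using E.bessel[OF assms] by (simp only:)
qed

lemma nsq_has_sum:
  assumes "f \<in> sq_int (P r a)"
  shows "((\<lambda>(A, B). (cmod (ip (P r a) f (hm A B)))\<^sup>2 / N A B) has_sum nsq (P r a) f) UNIV"
proof -
  have eq: "(\<lambda>(A, B). ip (P r a) f (hm A B) * cnj (ip (P r a) f (hm A B)) / of_real (N A B))
      = (\<lambda>x. complex_of_real (case x of (A, B) \<Rightarrow> (cmod (ip (P r a) f (hm A B)))\<^sup>2 / N A B))"
    by (rule ext) (simp add: case_prod_unfold complex_norm_square del: of_real_power)
  from parseval_hm[OF assms assms] show ?thesis
    unfolding eq ip_self by (simp only: has_sum_of_real_iff)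
qed

lemma ip_P_delta:
  assumes \<phi>: "\<phi> \<in> Cc_infty"
  shows "ip (P r a) (delta r a i \<phi>) (hm A B) = - (of_real (c i * real (count B i)) * ip (P r a) \<phi> (hm A (B - {#i#})))"
proof -
  have t: "tame \<phi>" by (rule tame_Cc_infty[OF \<phi>])
  have m: "\<phi> \<in> borel_measurable Q" "delta r a i \<phi> \<in> borel_measurable Q" "hm A B \<in> borel_measurable Q" for A B
    using tame_sq_int(1)[OF t] delta_sq_int[OF t] hm_sq_int by auto
  have "ip Q (delta r a i \<phi>) (hm A B) = - ip Q \<phi> (dbar_i i (hm A B))"
    using ip_delta[OF t tame_hm] by simp
  also have "ip Q \<phi> (dbar_i i (hm A B)) = of_real (c i * real (count B i)) * ip Q \<phi> (hm A (B - {#i#}))"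
    unfolding dbar_i_hm by (simp add: ip_cnj[of Q \<phi>] ip_scale_left)
  finally show ?thesis by (simp add: ip_P m)
qed

text \<open>Parseval's identity for \<open>u\<close> and \<open>delta r a i \<phi>\<close>. Terms in
  which \<open>i\<close> is not in the antiholomorphic degree vanish, the others are reindexed by
  adding \<open>i\<close>, and the lowering constant \<open>c i * (count B i + 1)\<close> cancels
  against the ratio of the norms. The weak derivative thus acts on coefficients as a pure
  shift.\<close>

lemma shift_has_sum:
  assumes u: "u \<in> sq_int (P r a)" and \<phi>: "\<phi> \<in> Cc_infty"
  shows "((\<lambda>(A, B). ip (P r a) u (hm A (add_mset i B)) * cnj (ip (P r a) \<phi> (hm A B)) / of_real (N A B))
    has_sum - ip (P r a) u (delta r a i \<phi>)) UNIV"
proof -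
  define F where "F = (\<lambda>(A, B). ip (P r a) u (hm A B) * cnj (ip (P r a) (delta r a i \<phi>) (hm A B)) / of_real (N A B))"
  have "(F has_sum ip (P r a) u (delta r a i \<phi>)) UNIV"
    unfolding F_def by (rule parseval_hm[OF u sq_int_P[OF delta_sq_int[OF tame_Cc_infty[OF \<phi>]]]])
  moreover have "F x = 0" if "x \<notin> range (\<lambda>(A, B). (A, add_mset i B))" for x
  proof -
    obtain A B where x: "x = (A, B)" by (cases x)
    have "i \<notin># B"
    proof
      assume "i \<in># B"
      then obtain B' where "B = add_mset i B'" by (blast dest: multi_member_split)
      hence "x = (\<lambda>(A, B). (A, add_mset i B)) (A, B')" by (simp add: x)
      thus False using that by blast
    qed
    thus ?thesis by (simp add: x F_def ip_P_delta[OF \<phi>] not_in_iff)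
  qed
  ultimately have "(F has_sum ip (P r a) u (delta r a i \<phi>)) (range (\<lambda>(A, B). (A, add_mset i B)))"
    by (subst has_sum_cong_neutral[where T = UNIV and g = F]) auto
  moreover have "inj (\<lambda>(A :: nat multiset, B). (A, add_mset i B))" by (auto simp: inj_def)
  ultimately have "((F \<circ> (\<lambda>(A, B). (A, add_mset i B))) has_sum ip (P r a) u (delta r a i \<phi>)) UNIV"
    by (subst has_sum_reindex[symmetric]) auto
  hence "((\<lambda>x. - (F \<circ> (\<lambda>(A, B). (A, add_mset i B))) x) has_sum - ip (P r a) u (delta r a i \<phi>)) UNIV"
    by (rule has_sum_uminusI)
  moreover have "- (F \<circ> (\<lambda>(A, B). (A, add_mset i B))) x
      = (case x of (A, B) \<Rightarrow> ip (P r a) u (hm A (add_mset i B)) * cnj (ip (P r a) \<phi> (hm A B)) / of_real (N A B))" for x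
  proof -
    obtain A B where x: "x = (A, B)" by (cases x)
    have "complex_of_real (c i) * (1 + of_nat (count B i)) \<noteq> 0"
      using c_pos[of i] of_nat_eq_0_iff[of "Suc (count B i)", where 'a = complex] by simp
    hence nz: "complex_of_real (c i) * (1 + of_nat (count B i)) \<noteq> 0" .
    have cancel: "p * (k * q) / (n * k) = p * q / n" if "k \<noteq> 0" for p q n k :: complex
      using that by simp
    have "- (F \<circ> (\<lambda>(A, B). (A, add_mset i B))) x
        = ip (P r a) u (hm A (add_mset i B)) * ((complex_of_real (c i) * (1 + of_nat (count B i))) * cnj (ip (P r a) \<phi> (hm A B)))
          / (of_real (N A B) * (complex_of_real (c i) * (1 + of_nat (count B i))))"
      by (simp add: x F_def ip_P_delta[OF \<phi>] N_add_right add.commute)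
    thus ?thesis unfolding cancel[OF nz] by (simp add: x)
  qed
  ultimately show ?thesis by simp
qed


lemma has_sum_finite_sum:
  fixes h :: "'j \<Rightarrow> 'i \<Rightarrow> 'b :: topological_comm_monoid_add"
  assumes "finite E" "\<And>x. x \<in> E \<Longrightarrow> (h x has_sum l x) T"
  shows "((\<lambda>y. \<Sum>x\<in>E. h x y) has_sum (\<Sum>x\<in>E. l x)) T"
  using assms by (induction E rule: finite_induct) (auto intro: has_sum_add)

lemma c_weight: "c i * (a i)\<^sup>2 = 1 / (2 * r\<^sup>2)"
  using r a[of i] by (simp add: c_def \<sigma>_def power_mult_distrib)

lemma form_norm_nsq: "form_norm r a s t f = sqrt (\<Sum>\<^sub>\<infinity>(I, J)\<in>MI s \<times> MI t. weight a I J * nsq (P r a) (f I J))"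
  by (simp add: form_norm_def nsq_def)

lemma weight_pos: "weight a I J > 0"
  unfolding weight_eq by (intro mult_pos_pos wt_pos a)

section \<open>Solving the equation for a closed form\<close>

context
  fixes s t :: nat and f :: form
  assumes f: "f \<in> L2_form r a s (t + 1)"
    and closed: "\<And>I L \<phi>. I \<in> MI s \<Longrightarrow> L \<in> MI (t + 2) \<Longrightarrow> \<phi> \<in> Cc_infty \<Longrightarrow>
      (\<Sum>i\<in>set L. of_int (sg i L) * ip (P r a) (f I (remove1 i L)) (delta r a i \<phi>)) = 0"
begin

definition F :: "nat list \<Rightarrow> nat multiset \<Rightarrow> nat list \<Rightarrow> nat multiset \<Rightarrow> complex" where
  "F I A K B = ip (P r a) (f I K) (hm A B)"

lemma f_sq_int: "I \<in> MI s \<Longrightarrow> K \<in> MI (Suc t) \<Longrightarrow> f I K \<in> sq_int (P r a)"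
  using f by (simp add: L2_form_def L2_eq)

text \<open>Closedness as an instance of \<open>weak_identity_extends\<close> with
  \<open>g = 0\<close>, evaluated at Hermite polynomials, where \<open>delta\<close> is a
  shift.\<close>

lemma F_closed:
  assumes I: "I \<in> MI s" and L: "L \<in> MI (Suc (Suc t))"
  shows "(\<Sum>i\<in>set L. of_int (sg i L) * F I A (remove1 i L) (add_mset i B)) = 0"
proof -
  have "ip (P r a) (\<lambda>z. 0) (hm A B) = - (\<Sum>i\<in>set L. of_int (sg i L) * ip (P r a) (f I (remove1 i L)) (delta r a i (hm A B)))"
  proof (rule weak_identity_extends)
    show "f I (remove1 i L) \<in> sq_int (P r a)" if "i \<in> set L" for i
      by (rule f_sq_int[OF I MI_remove1[OF L that]])
    show "ip (P r a) (\<lambda>z. 0) \<phi> = - (\<Sum>i\<in>set L. of_int (sg i L) * ip (P r a) (f I (remove1 i L)) (delta r a i \<phi>))"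
      if "\<phi> \<in> Cc_infty" for \<phi>
      using closed[OF I _ that, of L] L by (simp add: ip_def)
  qed (simp_all add: poly_fun_hermite)
  moreover have "ip (P r a) g (delta r a i (hm A B)) = - ip (P r a) g (hm A (add_mset i B))" for g i
    by (simp add: delta_hm ip_def)
  ultimately show ?thesis by (simp add: ip_def[of _ "\<lambda>z. 0"] F_def sum_negf)
qed

definition normsq :: real where
  "normsq = (\<Sum>\<^sub>\<infinity>(I, K)\<in>MI s \<times> MI (t + 1). weight a I K * nsq (P r a) (f I K))"

lemma weights_summable: "(\<lambda>(I, K). weight a I K * nsq (P r a) (f I K)) summable_on MI s \<times> MI (Suc t)"
  using f by (simp add: L2_form_def nsq_def)

text \<open>The blocks \<open>B + mset J = \<gamma>\<close> are invariant, so enlarging a finite set of indices to a union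
  of blocks turns the inequality into finitely many instances of \<open>homotopy_norm\<close>.\<close>

lemma homotopy_bound:
  assumes E: "finite E" "E \<subseteq> MI s \<times> MI t" and S: "finite S"
  shows "(\<Sum>(I, J)\<in>E. weight a I J * (\<Sum>(A, B)\<in>S. (cmod (homotopy t (F I A) J B))\<^sup>2 / N A B))
    \<le> 2 * r\<^sup>2 / (real t + 1) * normsq"
proof -
  define \<Gamma> where "\<Gamma> = (\<lambda>(J, B). B + mset J) ` (snd ` E \<times> snd ` S)"
  define X where "X = {(J, B). J \<in> MI t \<and> B + mset J \<in> \<Gamma>}"
  define Y where "Y = {(K, B). K \<in> MI (Suc t) \<and> B + mset K \<in> \<Gamma>}"
  have fin\<Gamma>: "finite \<Gamma>" using E S by (simp add: \<Gamma>_def)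
  have fin: "finite X" "finite Y" unfolding X_def Y_def using fin\<Gamma> by (simp_all only: finite_blocks)
  let ?C = "2 * r\<^sup>2 / (real t + 1)"
  have C: "?C \<ge> 0" by simp
  have wt: "wt a J > 0" for J by (rule wt_pos[OF a])
  have nonneg: "wt a J * ((cmod w)\<^sup>2 / N A B) \<ge> 0" for J A B w
    using wt[of J] N_pos[of A B] by simp
  have "(\<Sum>(I, J)\<in>E. weight a I J * (\<Sum>(A, B)\<in>S. (cmod (homotopy t (F I A) J B))\<^sup>2 / N A B))
      = (\<Sum>((I, J), (A, B))\<in>E \<times> S. wt a I * (wt a J * ((cmod (homotopy t (F I A) J B))\<^sup>2 / N A B)))"
    unfolding sum.cartesian_product[symmetric]
    by (simp add: sum_distrib_left case_prod_unfold weight_eq mult.assoc)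
  also have "\<dots> = (\<Sum>(I, A, J, B)\<in>(\<lambda>((I, J), (A, B)). (I, A, J, B)) ` (E \<times> S).
      wt a I * (wt a J * ((cmod (homotopy t (F I A) J B))\<^sup>2 / N A B)))"
    by (subst sum.reindex) (auto simp: inj_on_def case_prod_unfold)
  also have "\<dots> \<le> (\<Sum>(I, A, J, B)\<in>fst ` E \<times> fst ` S \<times> X.
      wt a I * (wt a J * ((cmod (homotopy t (F I A) J B))\<^sup>2 / N A B)))"
  proof (rule sum_mono2)
    show "finite (fst ` E \<times> fst ` S \<times> X)" using E S fin by simp
    show "(\<lambda>((I, J), (A, B)). (I, A, J, B)) ` (E \<times> S) \<subseteq> fst ` E \<times> fst ` S \<times> X"
    proof
      fix x assume "x \<in> (\<lambda>((I, J), (A, B)). (I, A, J, B)) ` (E \<times> S)"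
      then obtain I J A B where x: "x = (I, A, J, B)" and IJ: "(I, J) \<in> E" and AB: "(A, B) \<in> S" by auto
      have "J \<in> MI t" using IJ E(2) by blast
      moreover have "B + mset J \<in> \<Gamma>"
        unfolding \<Gamma>_def using IJ AB by (intro image_eqI[of _ _ "(J, B)"]) (auto intro: rev_image_eqI)
      ultimately show "x \<in> fst ` E \<times> fst ` S \<times> X"
        using IJ AB by (auto simp: x X_def intro: rev_image_eqI)
    qed
    show "0 \<le> (case x of (I, A, J, B) \<Rightarrow> wt a I * (wt a J * ((cmod (homotopy t (F I A) J B))\<^sup>2 / N A B)))" for x
      using mult_nonneg_nonneg[OF less_imp_le[OF wt] nonneg] by (simp add: case_prod_unfold)
  qed
  also have "\<dots> = (\<Sum>I\<in>fst ` E. \<Sum>A\<in>fst ` S. wt a I * (\<Sum>(J, B)\<in>X. wt a J * ((cmod (homotopy t (F I A) J B))\<^sup>2 / N A B)))"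
    unfolding sum.cartesian_product[symmetric] by (simp add: sum_distrib_left case_prod_unfold)
  also have "\<dots> \<le> (\<Sum>I\<in>fst ` E. \<Sum>A\<in>fst ` S. wt a I * (?C * (\<Sum>(K, B)\<in>Y. wt a K * ((cmod (F I A K B))\<^sup>2 / N A B))))"
  proof (intro sum_mono mult_left_mono)
    fix I A assume "I \<in> fst ` E"
    hence I: "I \<in> MI s" using E(2) by auto
    have "(\<Sum>(J, B)\<in>X. wt a J * ((cmod (homotopy t (F I A) J B))\<^sup>2 / N A B))
        \<le> 1 / (1 / (2 * r\<^sup>2) * (real t + 1)) * (\<Sum>(K, B)\<in>Y. wt a K * ((cmod (F I A K B))\<^sup>2 / N A B))"
      unfolding X_def Y_def
      by (rule homotopy_norm[where c = c, OF F_closed[OF I] N_add_right N_pos a c_weight _ fin\<Gamma>]) (use r in simp_all)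
    also have "1 / (1 / (2 * r\<^sup>2) * (real t + 1)) = ?C" by simp
    finally show "(\<Sum>(J, B)\<in>X. wt a J * ((cmod (homotopy t (F I A) J B))\<^sup>2 / N A B))
        \<le> ?C * (\<Sum>(K, B)\<in>Y. wt a K * ((cmod (F I A K B))\<^sup>2 / N A B))" .
  qed (use wt in \<open>auto intro: less_imp_le\<close>)
  also have "\<dots> = ?C * (\<Sum>(I, A, K, B)\<in>fst ` E \<times> fst ` S \<times> Y. wt a I * (wt a K * ((cmod (F I A K B))\<^sup>2 / N A B)))"
    unfolding sum.cartesian_product[symmetric]
    by (simp add: sum_distrib_left case_prod_unfold mult.left_commute)
  \<comment> \<open>Enlarging the set of pairs \<open>(K, B)\<close> to a product decouples the sum
    over \<open>(A, B)\<close> from \<open>K\<close>, as Bessel's inequality for each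
    \<open>f I K\<close> requires.\<close>
  also have "\<dots> \<le> ?C * (\<Sum>(I, A, K, B)\<in>fst ` E \<times> fst ` S \<times> (fst ` Y \<times> snd ` Y). wt a I * (wt a K * ((cmod (F I A K B))\<^sup>2 / N A B)))"
  proof (intro mult_left_mono C sum_mono2)
    show "finite (fst ` E \<times> fst ` S \<times> fst ` Y \<times> snd ` Y)" using E S fin by simp
    show "fst ` E \<times> fst ` S \<times> Y \<subseteq> fst ` E \<times> fst ` S \<times> fst ` Y \<times> snd ` Y"
      by (intro Sigma_mono order_refl) (auto intro: rev_image_eqI)
    show "0 \<le> (case x of (I, A, K, B) \<Rightarrow> wt a I * (wt a K * ((cmod (F I A K B))\<^sup>2 / N A B)))" for x
      using mult_nonneg_nonneg[OF less_imp_le[OF wt] nonneg] by (simp add: case_prod_unfold)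
  qed
  also have "(\<Sum>(I, A, K, B)\<in>fst ` E \<times> fst ` S \<times> (fst ` Y \<times> snd ` Y). wt a I * (wt a K * ((cmod (F I A K B))\<^sup>2 / N A B)))
      = (\<Sum>(I, K)\<in>fst ` E \<times> fst ` Y. weight a I K * (\<Sum>(A, B)\<in>fst ` S \<times> snd ` Y. (cmod (F I A K B))\<^sup>2 / N A B))"
  proof -
    have "(\<Sum>(I, A, K, B)\<in>fst ` E \<times> fst ` S \<times> (fst ` Y \<times> snd ` Y). wt a I * (wt a K * ((cmod (F I A K B))\<^sup>2 / N A B)))
        = (\<Sum>I\<in>fst ` E. \<Sum>A\<in>fst ` S. \<Sum>K\<in>fst ` Y. \<Sum>B\<in>snd ` Y. wt a I * (wt a K * ((cmod (F I A K B))\<^sup>2 / N A B)))"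
      by (simp only: sum.cartesian_product[symmetric] prod.case)
    also have "\<dots> = (\<Sum>I\<in>fst ` E. \<Sum>K\<in>fst ` Y. \<Sum>A\<in>fst ` S. \<Sum>B\<in>snd ` Y. wt a I * (wt a K * ((cmod (F I A K B))\<^sup>2 / N A B)))"
      by (intro sum.cong refl sum.swap)
    also have "\<dots> = (\<Sum>(I, K)\<in>fst ` E \<times> fst ` Y. weight a I K * (\<Sum>(A, B)\<in>fst ` S \<times> snd ` Y. (cmod (F I A K B))\<^sup>2 / N A B))"
      by (simp only: sum.cartesian_product[symmetric] prod.case sum_distrib_left weight_eq mult.assoc)
    finally show ?thesis .
  qed
  also have "?C * \<dots> \<le> ?C * (\<Sum>(I, K)\<in>fst ` E \<times> fst ` Y. weight a I K * nsq (P r a) (f I K))"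
  proof (intro mult_left_mono C sum_mono)
    fix x assume x: "x \<in> fst ` E \<times> fst ` Y"
    obtain I K where IK: "x = (I, K)" by (cases x)
    have "I \<in> MI s" "K \<in> MI (Suc t)" using x IK E(2) by (auto simp: Y_def)
    hence "(\<Sum>(A, B)\<in>fst ` S \<times> snd ` Y. (cmod (F I A K B))\<^sup>2 / N A B) \<le> nsq (P r a) (f I K)"
      unfolding F_def using S fin by (intro bessel_hm f_sq_int) auto
    thus "(case x of (I, K) \<Rightarrow> weight a I K * (\<Sum>(A, B)\<in>fst ` S \<times> snd ` Y. (cmod (F I A K B))\<^sup>2 / N A B))
        \<le> (case x of (I, K) \<Rightarrow> weight a I K * nsq (P r a) (f I K))"
      using weight_pos[of I K] by (simp add: IK mult_left_mono)
  qed
  also have "\<dots> \<le> ?C * normsq"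
    unfolding normsq_def
  proof (intro mult_left_mono C finite_sum_le_infsum)
    show "(\<lambda>(I, K). weight a I K * nsq (P r a) (f I K)) summable_on MI s \<times> MI (t + 1)"
      using weights_summable by simp
    show "finite (fst ` E \<times> fst ` Y)" using E fin by simp
    show "fst ` E \<times> fst ` Y \<subseteq> MI s \<times> MI (t + 1)" using E(2) by (auto simp: Y_def)
    show "0 \<le> (case x of (I, K) \<Rightarrow> weight a I K * nsq (P r a) (f I K))" for x
      using weight_pos by (cases x) (simp add: less_imp_le)
  qed
  finally show ?thesis .
qed

text \<open>For a single pair \<open>(I, J)\<close> the bound \<open>homotopy_bound\<close> says
  that the prescribed coefficients, rescaled to the orthonormal basis, are square-summable.\<close>

lemma exists_coefficient:
  assumes I: "I \<in> MI s" and J: "J \<in> MI t"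
  shows "\<exists>u. u \<in> sq_int (P r a) \<and> (\<forall>A B. ip (P r a) u (hm A B) = homotopy t (F I A) J B)"
proof -
  define k where "k = (\<lambda>(A, B). of_real (1 / sqrt (N A B)) * homotopy t (F I A) J B)"
  have bound: "(\<Sum>x\<in>S. (cmod (k x))\<^sup>2) \<le> 2 * r\<^sup>2 / (real t + 1) * normsq / weight a I J" if S: "finite S" for S
  proof -
    have "(cmod (k x))\<^sup>2 = (case x of (A, B) \<Rightarrow> (cmod (homotopy t (F I A) J B))\<^sup>2 / N A B)" for x
    proof -
      obtain A B where x: "x = (A, B)" by (cases x)
      show ?thesis
        using N_pos[of A B] by (simp add: x k_def norm_mult norm_divide power_mult_distrib power_divide less_imp_le)
    qed
    hence eq: "(\<Sum>x\<in>S. (cmod (k x))\<^sup>2) = (\<Sum>(A, B)\<in>S. (cmod (homotopy t (F I A) J B))\<^sup>2 / N A B)"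
      by (simp only:)
    have "weight a I J * (\<Sum>x\<in>S. (cmod (k x))\<^sup>2) \<le> 2 * r\<^sup>2 / (real t + 1) * normsq"
      using homotopy_bound[of "{(I, J)}" S] I J S unfolding eq by simp
    thus ?thesis by (simp only: pos_le_divide_eq[OF weight_pos] mult.commute)
  qed
  obtain u where u: "u \<in> sq_int (P r a)" "\<And>x. ip (P r a) u (e x) = k x"
    by (rule E.riesz_fischer[OF bound]) (assumption, blast)
  have "ip (P r a) u (hm A B) = homotopy t (F I A) J B" for A B
  proof -
    have "of_real (1 / sqrt (N A B)) * ip (P r a) u (hm A B) = of_real (1 / sqrt (N A B)) * homotopy t (F I A) J B"
      using u(2)[of "(A, B)"] by (simp only: ip_e_right k_def prod.case)
    moreover have "complex_of_real (1 / sqrt (N A B)) \<noteq> 0" using N_pos[of A B] by simp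
    ultimately show ?thesis by (simp only: mult_cancel_left simp_thms)
  qed
  thus ?thesis using u(1) by blast
qed

lemma exists_solution:
  obtains u where "u \<in> L2_form r a s t" "form_norm r a s t u \<le> sqrt (2 * r\<^sup>2 / (real t + 1)) * form_norm r a s (t + 1) f"
    "\<And>I K \<phi>. I \<in> MI s \<Longrightarrow> K \<in> MI (t + 1) \<Longrightarrow> \<phi> \<in> Cc_infty \<Longrightarrow>
      ip (P r a) (f I K) \<phi> = - (\<Sum>i\<in>set K. of_int (sg i K) * ip (P r a) (u I (remove1 i K)) (delta r a i \<phi>))"
proof -
  have "\<forall>I J. \<exists>u. I \<in> MI s \<longrightarrow> J \<in> MI t \<longrightarrow>
      u \<in> sq_int (P r a) \<and> (\<forall>A B. ip (P r a) u (hm A B) = homotopy t (F I A) J B)"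
    using exists_coefficient by blast
  then obtain u where "\<forall>I J. I \<in> MI s \<longrightarrow> J \<in> MI t \<longrightarrow>
      u I J \<in> sq_int (P r a) \<and> (\<forall>A B. ip (P r a) (u I J) (hm A B) = homotopy t (F I A) J B)"
    by metis
  hence u: "u I J \<in> sq_int (P r a)" "ip (P r a) (u I J) (hm A B) = homotopy t (F I A) J B"
    if "I \<in> MI s" "J \<in> MI t" for I J A B using that by auto
  let ?C = "2 * r\<^sup>2 / (real t + 1)"
  \<comment> \<open>The finite sum over \<open>E\<close> is itself the value of one series over the
    Hermite indices. Every finite part of that series is bounded by \<open>homotopy_bound\<close>
    uniformly in \<open>E\<close>, which bounds all coefficients jointly rather than one at a
    time.\<close>
  have finite_bound: "(\<Sum>(I, J)\<in>E. weight a I J * nsq (P r a) (u I J)) \<le> ?C * normsq"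
    if E: "finite E" "E \<subseteq> MI s \<times> MI t" for E
  proof (rule has_sum_le_finite_sums)
    show "((\<lambda>x. \<Sum>(I, J)\<in>E. weight a I J * (case x of (A, B) \<Rightarrow> (cmod (homotopy t (F I A) J B))\<^sup>2 / N A B))
        has_sum (\<Sum>(I, J)\<in>E. weight a I J * nsq (P r a) (u I J))) UNIV"
    proof (rule has_sum_finite_sum[OF E(1)])
      fix x assume x: "x \<in> E"
      obtain I J where IJ: "x = (I, J)" by (cases x)
      hence *: "I \<in> MI s" "J \<in> MI t" using x E(2) by auto
      show "((\<lambda>y. case x of (I, J) \<Rightarrow> weight a I J * (case y of (A, B) \<Rightarrow> (cmod (homotopy t (F I A) J B))\<^sup>2 / N A B))
          has_sum (case x of (I, J) \<Rightarrow> weight a I J * nsq (P r a) (u I J))) UNIV"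
        using has_sum_cmult_right[OF nsq_has_sum[OF u(1)[OF *]], of "weight a I J"]
        by (simp only: IJ prod.case u(2)[OF *])
    qed
    fix S :: "(nat multiset \<times> nat multiset) set" assume S: "finite S"
    have "(\<Sum>x\<in>S. \<Sum>(I, J)\<in>E. weight a I J * (case x of (A, B) \<Rightarrow> (cmod (homotopy t (F I A) J B))\<^sup>2 / N A B))
        = (\<Sum>(I, J)\<in>E. weight a I J * (\<Sum>(A, B)\<in>S. (cmod (homotopy t (F I A) J B))\<^sup>2 / N A B))"
      by (subst sum.swap) (simp add: sum_distrib_left case_prod_unfold)
    thus "(\<Sum>x\<in>S. \<Sum>(I, J)\<in>E. weight a I J * (case x of (A, B) \<Rightarrow> (cmod (homotopy t (F I A) J B))\<^sup>2 / N A B)) \<le> ?C * normsq"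
      using homotopy_bound[OF E S] by simp
  qed
  have nonneg: "0 \<le> (case x of (I, J) \<Rightarrow> weight a I J * nsq (P r a) (u I J))" for x
    using weight_pos by (cases x) (simp add: less_imp_le)
  have summable: "(\<lambda>(I, J). weight a I J * nsq (P r a) (u I J)) summable_on MI s \<times> MI t"
  proof (rule nonneg_bdd_above_summable_on[OF nonneg])
    show "bdd_above (sum (\<lambda>(I, J). weight a I J * nsq (P r a) (u I J)) ` {E. E \<subseteq> MI s \<times> MI t \<and> finite E})"
      by (rule bdd_aboveI2[where M = "?C * normsq"]) (use finite_bound in blast)
  qed
  show ?thesis
  proof (rule that)
    show "u \<in> L2_form r a s t"
      using summable u(1) by (simp add: L2_form_def L2_eq nsq_def)
    have "(\<Sum>\<^sub>\<infinity>(I, J)\<in>MI s \<times> MI t. weight a I J * nsq (P r a) (u I J)) \<le> ?C * normsq"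
      by (rule infsum_le_finite_sums[OF summable]) (rule finite_bound)
    hence "form_norm r a s t u \<le> sqrt (?C * normsq)" unfolding form_norm_nsq by (rule real_sqrt_le_mono)
    thus "form_norm r a s t u \<le> sqrt ?C * form_norm r a s (t + 1) f"
      unfolding form_norm_nsq normsq_def real_sqrt_mult .
  next
    fix I K \<phi> assume I: "I \<in> MI s" and K: "K \<in> MI (t + 1)" and \<phi>: "\<phi> \<in> Cc_infty"
    have K': "K \<in> MI (Suc t)" using K by simp
    have \<phi>_sq: "\<phi> \<in> sq_int (P r a)" by (rule sq_int_P[OF tame_sq_int(1)[OF tame_Cc_infty[OF \<phi>]]])
    have "((\<lambda>x. \<Sum>i\<in>set K. of_int (sg i K) * (case x of (A, B) \<Rightarrow>
          homotopy t (F I A) (remove1 i K) (add_mset i B) * cnj (ip (P r a) \<phi> (hm A B)) / of_real (N A B)))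
        has_sum (\<Sum>i\<in>set K. of_int (sg i K) * (- ip (P r a) (u I (remove1 i K)) (delta r a i \<phi>)))) UNIV"
    proof (rule has_sum_finite_sum[OF finite_set], rule has_sum_cmult_right)
      fix i assume i: "i \<in> set K"
      have J: "remove1 i K \<in> MI t" by (rule MI_remove1[OF K' i])
      show "((\<lambda>x. case x of (A, B) \<Rightarrow>
          homotopy t (F I A) (remove1 i K) (add_mset i B) * cnj (ip (P r a) \<phi> (hm A B)) / of_real (N A B))
        has_sum - ip (P r a) (u I (remove1 i K)) (delta r a i \<phi>)) UNIV"
        using shift_has_sum[OF u(1)[OF I J] \<phi>, of i] by (simp only: u(2)[OF I J])
    qed
    \<comment> \<open>Term by term \<open>homotopy_solves\<close> turns the shifted coefficients of
      \<open>u\<close> into those of \<open>f I K\<close>. Both sides of the weak equation are then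
      sums of the same series.\<close>
    moreover have "(\<Sum>i\<in>set K. of_int (sg i K) * (case x of (A, B) \<Rightarrow>
          homotopy t (F I A) (remove1 i K) (add_mset i B) * cnj (ip (P r a) \<phi> (hm A B)) / of_real (N A B)))
        = (case x of (A, B) \<Rightarrow> ip (P r a) (f I K) (hm A B) * cnj (ip (P r a) \<phi> (hm A B)) / of_real (N A B))" for x
    proof -
      obtain A B where x: "x = (A, B)" by (cases x)
      have "(\<Sum>i\<in>set K. of_int (sg i K) * homotopy t (F I A) (remove1 i K) (add_mset i B)) = F I A K B"
        by (rule homotopy_solves[OF K']) (rule F_closed[OF I])
      thus ?thesis
        by (simp add: x F_def sum_distrib_right[symmetric] sum_divide_distrib[symmetric] mult.assoc[symmetric])
    qed
    ultimately have "((\<lambda>(A, B). ip (P r a) (f I K) (hm A B) * cnj (ip (P r a) \<phi> (hm A B)) / of_real (N A B))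
        has_sum (\<Sum>i\<in>set K. of_int (sg i K) * (- ip (P r a) (u I (remove1 i K)) (delta r a i \<phi>)))) UNIV"
      by simp
    from has_sum_unique[OF parseval_hm[OF f_sq_int[OF I K'] \<phi>_sq] this]
    show "ip (P r a) (f I K) \<phi> = - (\<Sum>i\<in>set K. of_int (sg i K) * ip (P r a) (u I (remove1 i K)) (delta r a i \<phi>))"
      by (simp add: sum_negf)
  qed
qed

end

end

section \<open>From weak coefficients to the operators\<close>

theorem theorem128:
  fixes r :: real and a :: "nat \<Rightarrow> real" and s t :: nat and f :: form
  assumes "r > 0" and "\<And>i. a i > 0" and "summable a"
    and "f \<in> dbar_ker r a s (t + 1)"
  shows "\<exists>u\<in>L2_form r a s t.
           u \<in> dbar_dom r a s t \<and>
           form_eq r a s (t + 1) (dbar r a s t u) f \<and>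
           form_norm r a s t u
             \<le> sqrt (2 * r\<^sup>2 / (real t + 1)) * form_norm r a s (t + 1) f"
proof -
  interpret gauss_seq r a using assms(1-3) by unfold_locales
  let ?P = "P r a"
  have f: "f \<in> L2_form r a s (t + 1)" and ex: "\<exists>g. weak_dbar_coeffs r a s (t + 1) f g"
    and ker: "form_eq r a s (t + 1 + 1) (dbar r a s (t + 1) f) (\<lambda>I K z. 0)"
    using assms(4) by (auto simp: dbar_ker_def dbar_dom_def)
  define g where "g = (SOME g. weak_dbar_coeffs r a s (t + 1) f g)"
  have g: "weak_dbar_coeffs r a s (t + 1) f g" unfolding g_def by (rule someI_ex[OF ex])
  have sq: "h I J \<in> sq_int ?P" if "h \<in> L2_form r a s' t'" "I \<in> MI s'" "J \<in> MI t'" for h I J s' t'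
    using that by (simp add: L2_form_def L2_eq)
  have closed: "(\<Sum>i\<in>set L. of_int (sg i L) * ip ?P (f I (remove1 i L)) (delta r a i \<phi>)) = 0"
    if I: "I \<in> MI s" and L: "L \<in> MI (t + 2)" and \<phi>: "\<phi> \<in> Cc_infty" for I L \<phi>
  proof -
    have L: "L \<in> MI (t + 1 + 1)" using L by simp
    have "AE z in ?P. (-1) ^ s * g I L z = 0"
      using ker I L unfolding form_eq_def dbar_def g_def by blast
    hence "AE z in ?P. g I L z = 0" by eventually_elim simp
    hence "AE z in ?P. g I L z * cnj (\<phi> z) = 0" by eventually_elim simp
    hence "(\<integral>z. g I L z * cnj (\<phi> z) \<partial>?P) = 0" by (rule integral_eq_zero_AE)
    moreover have "(\<integral>z. g I L z * cnj (\<phi> z) \<partial>?P)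
        = - (\<Sum>i\<in>set L. of_int (sg i L) * ip ?P (f I (remove1 i L)) (delta r a i \<phi>))"
      using g I L \<phi> weak_rhs[of "t + 1" "f I" L \<phi>] sq[OF f I] tame_Cc_infty[OF \<phi>]
      unfolding weak_dbar_coeffs_def by simp
    ultimately show ?thesis by simp
  qed
  \<comment> \<open>\<open>dbar\<close> multiplies the weak coefficients by \<open>(-1) ^ s\<close>,
    so the coefficients to be realised are those of \<open>f\<close> with this sign; it is its own
    inverse and changes no norm.\<close>
  define f' :: form where "f' = (\<lambda>I K z. (-1) ^ s * f I K z)"
  have cmod_f': "cmod (f' I K z) = cmod (f I K z)" for I K z by (simp add: f'_def norm_mult norm_power)
  have f': "f' \<in> L2_form r a s (t + 1)"
  proof -
    have "f' I K \<in> sq_int ?P" if "I \<in> MI s" "K \<in> MI (t + 1)" for I K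
      unfolding f'_def by (rule sq_int_scale[OF sq[OF f that]])
    thus ?thesis using f by (simp add: L2_form_def L2_eq cmod_f')
  qed
  have norm_f': "form_norm r a s (t + 1) f' = form_norm r a s (t + 1) f"
    by (simp add: form_norm_def cmod_f')
  have closed': "(\<Sum>i\<in>set L. of_int (sg i L) * ip ?P (f' I (remove1 i L)) (delta r a i \<phi>)) = 0"
    if "I \<in> MI s" "L \<in> MI (t + 2)" "\<phi> \<in> Cc_infty" for I L \<phi>
  proof -
    have "(\<Sum>i\<in>set L. of_int (sg i L) * ip ?P (f' I (remove1 i L)) (delta r a i \<phi>))
        = (-1) ^ s * (\<Sum>i\<in>set L. of_int (sg i L) * ip ?P (f I (remove1 i L)) (delta r a i \<phi>))"
      by (simp only: f'_def ip_scale_left sum_distrib_left mult.left_commute)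
    thus ?thesis using closed[OF that] by simp
  qed
  obtain u where u: "u \<in> L2_form r a s t"
    and norm: "form_norm r a s t u \<le> sqrt (2 * r\<^sup>2 / (real t + 1)) * form_norm r a s (t + 1) f'"
    and weak: "\<And>I K \<phi>. I \<in> MI s \<Longrightarrow> K \<in> MI (t + 1) \<Longrightarrow> \<phi> \<in> Cc_infty \<Longrightarrow>
      ip ?P (f' I K) \<phi> = - (\<Sum>i\<in>set K. of_int (sg i K) * ip ?P (u I (remove1 i K)) (delta r a i \<phi>))"
    using exists_solution[OF f' closed'] by blast
  have rhs: "- (\<integral>z. (\<Sum>\<^sub>\<infinity>i. \<Sum>\<^sub>\<infinity>J\<in>MI t. of_int (eps K i J) * u I J z * cnj (delta r a i \<phi> z)) \<partial>?P)
      = ip ?P (f' I K) \<phi>"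
    if "I \<in> MI s" "K \<in> MI (t + 1)" "\<phi> \<in> Cc_infty" for I K \<phi>
  proof -
    have "(\<integral>z. (\<Sum>\<^sub>\<infinity>i. \<Sum>\<^sub>\<infinity>J\<in>MI t. of_int (eps K i J) * u I J z * cnj (delta r a i \<phi> z)) \<partial>?P)
        = (\<Sum>i\<in>set K. of_int (sg i K) * ip ?P (u I (remove1 i K)) (delta r a i \<phi>))"
      by (rule weak_rhs[OF sq[OF u that(1)] that(2) tame_Cc_infty[OF that(3)]])
    thus ?thesis using weak[OF that] by simp
  qed
  have weak_f': "weak_dbar_coeffs r a s t u f'"
    unfolding weak_dbar_coeffs_def
  proof (intro conjI ballI)
    show "f' \<in> L2_form r a s (t + 1)" by (rule f')
    fix I K \<phi> assume "I \<in> MI s" "K \<in> MI (t + 1)" "\<phi> \<in> Cc_infty"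
    from rhs[OF this] show "(\<integral>z. f' I K z * cnj (\<phi> z) \<partial>?P)
        = - (\<integral>z. (\<Sum>\<^sub>\<infinity>i. \<Sum>\<^sub>\<infinity>J\<in>MI t. of_int (eps K i J) * u I J z * cnj (delta r a i \<phi> z)) \<partial>?P)"
      unfolding ip_def by (rule sym)
  qed
  \<comment> \<open>\<open>dbar\<close> uses coefficients picked by choice, possibly different from
    \<open>f'\<close>. Both satisfy the same weak equation, and test functions determine them almost
    everywhere.\<close>
  define k where "k = (SOME g. weak_dbar_coeffs r a s t u g)"
  have k: "weak_dbar_coeffs r a s t u k"
    using someI[of "weak_dbar_coeffs r a s t u", OF weak_f'] unfolding k_def .
  have "form_eq r a s (t + 1) (dbar r a s t u) f"
    unfolding form_eq_def
  proof (intro ballI)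
    fix I K assume I: "I \<in> MI s" and K: "K \<in> MI (t + 1)"
    have k_sq: "k I K \<in> sq_int ?P" and f'_sq: "f' I K \<in> sq_int ?P"
      using k f' sq I K unfolding weak_dbar_coeffs_def by blast+
    have "AE z in ?P. k I K z - f' I K z = 0"
    proof (rule complete_Cc_infty[OF sq_int_diff[OF k_sq f'_sq]])
      fix \<phi> assume \<phi>: "\<phi> \<in> Cc_infty"
      have "ip ?P (k I K) \<phi> = ip ?P (f' I K) \<phi>"
        using k I K \<phi> unfolding rhs[OF I K \<phi>, symmetric] weak_dbar_coeffs_def ip_def[of _ "k I K"] by blast
      thus "ip ?P (\<lambda>z. k I K z - f' I K z) \<phi> = 0"
        using ip_diff_left[OF k_sq f'_sq sq_int_P[OF tame_sq_int(1)[OF tame_Cc_infty[OF \<phi>]]]] by simp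
    qed
    moreover have "(-1 :: complex) ^ s * (-1) ^ s = 1" by (simp flip: power_mult_distrib)
    hence "(-1) ^ s * f' I K z = f I K z" for z by (simp add: f'_def mult.assoc[symmetric])
    ultimately show "AE z in ?P. dbar r a s t u I K z = f I K z"
      unfolding dbar_def k_def[symmetric] by (auto elim: eventually_mono)
  qed
  moreover have "u \<in> dbar_dom r a s t" using u weak_f' unfolding dbar_dom_def by blast
  ultimately show ?thesis using u norm unfolding norm_f' by blast
qed

end
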